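(* Let $g$ be the complete rotationally symmetric Riemannian metric on $\mathbb{R}^2$ given in polar coordinates by $g=dr^2+(f\circ r)^2\,d\theta^2$, where $f\in C^\infty(\mathbb{R}_{>0},\mathbb{R}_{>0})$ satisfies $f(r)=\sin r$ for $r\in(0,\frac{3\pi}{4})$, $f'(r)<0$ for $r>\frac{\pi}{2}$, and $\lim_{r\to\infty}f(r)=0$. Let $R_0=\frac{\pi}{2}$ and $R_1=\frac{3\pi}{4}$. Then there exist $\varepsilon_0>0$ and a $C^\infty$-family of Riemannian metrics $g_\varepsilon$, $\varepsilon\in(-\varepsilon_0,\varepsilon_0)$, on $\mathbb{R}^2$ such that the following is true: (i) $g_0=g$, and $g_\varepsilon$ and $g$ coincide outside the set $\{(r,\theta)\mid R_0<r<R_1,\ 0<\theta<\pi\}$. (ii) If $0<|\varepsilon|<\varepsilon_0$, then $(\mathbb{R}^2,g_\varepsilon)$ has precisely two injective geodesics, up to reparameterization.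
   Context: $\mathbb{R}^2\setminus\{(0,0)\}$ is parameterized by standard polar coordinates $(r,\theta)\in(0,\infty)\times S^1$, $S^1=\mathbb{R}/2\pi\mathbb{Z}$. Since $f=\sin$ on $(0,\frac{3\pi}{4})$, the metric $g$ agrees there with the round metric of curvature one in geodesic polar coordinates, so it extends smoothly to the origin and gives a complete metric on $\mathbb{R}^2$. A $C^\infty$-family means that $g_\varepsilon$ at the point $p$ depends smoothly on $(\varepsilon,p)$. An injective geodesic of $(\mathbb{R}^2,g_\varepsilon)$ is a geodesic $c\colon\mathbb{R}\to\mathbb{R}^2$, parameterized by arclength, that is injective as a map on $\mathbb{R}$ (so periodic geodesics are not injective). Up to reparameterization means up to replacing $c(s)$ by $c(\pm s+s_0)$, $s_0\in\mathbb{R}$. *)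

theory Defs
  imports "HOL-Analysis.Analysis"
begin

primrec C_k_on :: "nat \<Rightarrow> 'a::euclidean_space set \<Rightarrow> ('a \<Rightarrow> 'b::real_normed_vector) \<Rightarrow> bool"
  where
    "C_k_on 0 S f \<longleftrightarrow> continuous_on S f"
  | "C_k_on (Suc k) S f \<longleftrightarrow>
       (\<forall>x\<in>S. f differentiable (at x)) \<and>
       (\<forall>v. C_k_on k S (\<lambda>x. frechet_derivative f (at x) v))"

text \<open>Intended for open \<open>S\<close> only, where the derivatives depend just on \<open>f\<close> restricted to \<open>S\<close>
  and \<open>C_k_on k S f\<close> says that \<open>f\<close> is \<open>k\<close> times continuously differentiable on \<open>S\<close>.\<close>

definition smooth_on :: "'a::euclidean_space set \<Rightarrow> ('a \<Rightarrow> 'b::real_normed_vector) \<Rightarrow> bool"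
  where "smooth_on S f \<longleftrightarrow> (\<forall>k. C_k_on k S f)"

text \<open>A metric on \<open>\<real>\<^sup>n\<close> is given by its Gram matrix \<open>(g\<^sub>i\<^sub>j)\<close> in Cartesian coordinates,
  so that the inner product of \<open>v\<close> and \<open>w\<close> in the tangent space at \<open>x\<close> is
  \<open>v \<bullet> (g x *v w)\<close>.\<close>

definition riemannian_metric :: "(real^'n \<Rightarrow> real^'n^'n) \<Rightarrow> bool"
  where "riemannian_metric g \<longleftrightarrow>
    smooth_on UNIV g \<and>
    (\<forall>x. transpose (g x) = g x) \<and>
    (\<forall>x v. v \<noteq> 0 \<longrightarrow> v \<bullet> (g x *v v) > 0)"

definition partial :: "'n \<Rightarrow> (real^'n \<Rightarrow> real) \<Rightarrow> real^'n \<Rightarrow> real"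
  where "partial i h x = frechet_derivative h (at x) (axis i 1)"

text \<open>The Christoffel symbol \<open>\<Gamma>\<^sup>k\<^sub>i\<^sub>j\<close> of the Levi-Civita connection at \<open>x\<close>.\<close>

definition christoffel ::
    "(real^'n \<Rightarrow> real^'n^'n) \<Rightarrow> real^'n \<Rightarrow> 'n \<Rightarrow> 'n \<Rightarrow> 'n \<Rightarrow> real"
  where "christoffel g x k i j =
    (1/2) * (\<Sum>l\<in>UNIV. matrix_inv (g x) $ k $ l *
      (partial i (\<lambda>y. g y $ j $ l) x + partial j (\<lambda>y. g y $ i $ l) x
        - partial l (\<lambda>y. g y $ i $ j) x))"

definition geodesic :: "(real^'n \<Rightarrow> real^'n^'n) \<Rightarrow> (real \<Rightarrow> real^'n) \<Rightarrow> bool"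
  where "geodesic g c \<longleftrightarrow> (\<exists>c'. \<forall>t.
    (c has_vector_derivative c' t) (at t) \<and>
    (c' has_vector_derivative
      (\<chi> k. - (\<Sum>i\<in>UNIV. \<Sum>j\<in>UNIV. christoffel g (c t) k i j * c' t $ i * c' t $ j))) (at t))"

definition arclength_parameterized ::
    "(real^'n \<Rightarrow> real^'n^'n) \<Rightarrow> (real \<Rightarrow> real^'n) \<Rightarrow> bool"
  where "arclength_parameterized g c \<longleftrightarrow>
    (\<forall>t. vector_derivative c (at t) \<bullet> (g (c t) *v vector_derivative c (at t)) = 1)"

definition injective_geodesics :: "(real^'n \<Rightarrow> real^'n^'n) \<Rightarrow> (real \<Rightarrow> real^'n) set"
  where "injective_geodesics g = {c. geodesic g c \<and> arclength_parameterized g c \<and> inj c}"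

definition reparam :: "((real \<Rightarrow> 'a) \<times> (real \<Rightarrow> 'a)) set"
  where "reparam = {(c, d). \<exists>\<sigma>\<in>{1, -1}. \<exists>s0. \<forall>s. d s = c (\<sigma> * s + s0)}"

lemma equiv_reparam: "equiv UNIV (reparam :: ((real \<Rightarrow> 'a) \<times> (real \<Rightarrow> 'a)) set)"
proof (rule equivI)
  show "refl (reparam :: ((real \<Rightarrow> 'a) \<times> (real \<Rightarrow> 'a)) set)"
    by (auto simp: refl_on_def reparam_def intro!: exI[of _ 0])
  show "sym (reparam :: ((real \<Rightarrow> 'a) \<times> (real \<Rightarrow> 'a)) set)"
  proof (rule symI)
    fix c d :: "real \<Rightarrow> 'a"
    assume "(c, d) \<in> reparam"
    then obtain \<sigma> s0 where s: "\<sigma> \<in> {1, -1}" "\<And>s. d s = c (\<sigma> * s + s0)"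
      unfolding reparam_def by blast
    then have "c s = d (\<sigma> * s + (- \<sigma> * s0))" for s
      by (auto simp: algebra_simps)
    with s(1) show "(d, c) \<in> reparam"
      unfolding reparam_def by blast
  qed
  show "trans (reparam :: ((real \<Rightarrow> 'a) \<times> (real \<Rightarrow> 'a)) set)"
  proof (rule transI)
    fix c d e :: "real \<Rightarrow> 'a"
    assume "(c, d) \<in> reparam" "(d, e) \<in> reparam"
    then obtain \<sigma> s0 \<tau> t0 where
      s: "\<sigma> \<in> {1, -1}" "\<And>s. d s = c (\<sigma> * s + s0)" and
      t: "\<tau> \<in> {1, -1}" "\<And>s. e s = d (\<tau> * s + t0)"
      unfolding reparam_def by blast
    have "e s = c ((\<sigma> * \<tau>) * s + (\<sigma> * t0 + s0))" for s
      by (simp add: s(2) t(2) algebra_simps)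
    moreover have "\<sigma> * \<tau> \<in> {1, -1}"
      using s(1) t(1) by auto
    ultimately show "(c, e) \<in> reparam"
      unfolding reparam_def by blast
  qed
qed auto

definition polar :: "real \<Rightarrow> real \<Rightarrow> real^2"
  where "polar r \<theta> = vector [r * cos \<theta>, r * sin \<theta>]"

text \<open>\<open>g = dr\<^sup>2 + f(r)\<^sup>2 d\<theta>\<^sup>2\<close> on the complement of the origin, expressed on the
  coordinate vector fields. If \<open>g\<close> is continuous, these conditions also determine it at the origin,
  and they make it rotationally symmetric. Completeness is automatic as well, since closed balls of
  the metric are closed Euclidean balls about the origin when centred there, hence compact.\<close>

definition polar_form :: "(real^2 \<Rightarrow> real^2^2) \<Rightarrow> (real \<Rightarrow> real) \<Rightarrow> bool"
  where "polar_form g f \<longleftrightarrow> (\<forall>r>0. \<forall>\<theta>.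
    let d_r = vector_derivative (\<lambda>s. polar s \<theta>) (at r);
        d_\<theta> = vector_derivative (\<lambda>\<phi>. polar r \<phi>) (at \<theta>)
    in d_r \<bullet> (g (polar r \<theta>) *v d_r) = 1 \<and>
       d_r \<bullet> (g (polar r \<theta>) *v d_\<theta>) = 0 \<and>
       d_\<theta> \<bullet> (g (polar r \<theta>) *v d_\<theta>) = (f r)\<^sup>2)"

end

theory Submission imports Defs begin

text \<open>For \<open>g\<close> itself the angular momentum \<open>L = f(r)\<^sup>2 \<theta>'\<close> is constant along geodesics, and the
  injective geodesics are the lines through the origin, where \<open>L = 0\<close>. The perturbation
  \<open>g + \<epsilon>\<^sup>2 \<beta> r\<^sup>2 dr\<^sup>2\<close> destroys all of these lines but the two coordinate axes. Here \<open>\<beta>\<close> is the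
  bump \<open>flat y * cutoff (r\<^sup>2)\<close>, supported in \<open>2 \<pi> / 3 \<le> r \<le> 3 \<pi> / 4\<close>, \<open>y \<ge> 0\<close>; on each half circle in
  the interior of its support it increases up to the vertical axis and decreases beyond it. Hence
  \<open>L' = \<epsilon>\<^sup>2 / 2 * (\<partial>\<beta> / \<partial>\<theta>) * (r r')\<^sup>2\<close> is a torque that always points towards the vertical axis.

  The region \<open>r \<le> \<pi> / 2\<close> is a round hemisphere. A geodesic that enters its interior follows half
  of a great circle and leaves at the antipodal point. Two such half circles always intersect
  (\<open>passages_intersect\<close>), so an injective geodesic passes through the hemisphere at most once.
  Outside, the logarithm of the radius is concave along all geodesics (\<open>concavity\<close>): there
  \<open>f' \<le> 0\<close>, and on the support of \<open>\<beta>\<close> the Hessian is negative definite with a margin that a small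
  \<open>\<epsilon>\<close> does not use up. Therefore a geodesic that stays outside during a half line of time is the
  equator, which is periodic, or its radius grows to infinity, and then \<open>\<bar>L\<bar> \<le> f(r)\<close> forces
  \<open>L = 0\<close> from the radius \<open>3 \<pi> / 4\<close> on. Since a geodesic outside the hemisphere for all times would
  be the equator, an injective geodesic consists of one half great circle and two ends on which \<open>L\<close>
  finally vanishes.

  Follow such an end outwards from the equator. As \<open>\<epsilon>\<close> is small, the end does not cross the vertical
  axis (\<open>n1_nearly_constant\<close>), so the torque on it has a sign, and as \<open>L\<close> is zero finally, \<open>L\<close> can
  only have been directed away from the vertical axis before. An end that starts in \<open>y \<le> 0\<close> is then
  carried away from the support, feels no torque and has \<open>L = 0\<close> throughout (\<open>L_vanishes\<close>). As the
  two ends start at antipodal points, one of them starts in \<open>y \<le> 0\<close>; the hemisphere transmits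
  \<open>L = 0\<close> to the other one, on which \<open>L\<close> is monotone with zero boundary values and hence vanishes too.
  So there is no torque at all, and the end in \<open>y \<ge> 0\<close> must run along a coordinate axis
  (\<open>injective_geodesic_on_axis\<close>). Conversely the axes, parameterized by arc length, are geodesics,
  because they are critical for the angular dependence of the metric.\<close>

section \<open>Calculus of smooth functions\<close>

lemma C_k_on_cong:
  assumes "open S" "\<And>x. x \<in> S \<Longrightarrow> f x = h x"
  shows "C_k_on k S f \<longleftrightarrow> C_k_on k S h"
  using assms(2)
proof (induction k arbitrary: f h)
  case 0
  then show ?case
    by (auto cong: continuous_on_cong)
next
  case (Suc k)
  have D: "(f has_derivative D) (at x) \<longleftrightarrow> (h has_derivative D) (at x)" if "x \<in> S" for x D
  proof
    show "(h has_derivative D) (at x)" if "(f has_derivative D) (at x)"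
      by (rule has_derivative_transform_within_open[OF that assms(1) \<open>x \<in> S\<close>]) (rule Suc.prems)
    show "(f has_derivative D) (at x)" if "(h has_derivative D) (at x)"
      by (rule has_derivative_transform_within_open[OF that assms(1) \<open>x \<in> S\<close>]) (rule Suc.prems[symmetric])
  qed
  have "f differentiable (at x) \<longleftrightarrow> h differentiable (at x)" if "x \<in> S" for x
    using D[OF that] by (auto simp: differentiable_def)
  moreover have "frechet_derivative f (at x) = frechet_derivative h (at x)" if "x \<in> S" for x
    using D[OF that] by (simp add: frechet_derivative_def)
  moreover have "C_k_on k S (\<lambda>x. frechet_derivative f (at x) v) \<longleftrightarrow>
      C_k_on k S (\<lambda>x. frechet_derivative h (at x) v)" for v
    by (rule Suc.IH) (simp add: calculation)
  ultimately show ?case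
    by simp
qed

lemma C_k_on_Suc_imp: "C_k_on (Suc k) S f \<Longrightarrow> C_k_on k S f"
proof (induction k arbitrary: f)
  case 0
  then show ?case
    by (auto intro!: continuous_at_imp_continuous_on differentiable_imp_continuous_within)
qed auto

lemma C_k_on_SucI:
  assumes "open S" "\<And>x. x \<in> S \<Longrightarrow> (f has_derivative f' x) (at x)"
    and "\<And>v. C_k_on k S (\<lambda>x. f' x v)"
  shows "C_k_on (Suc k) S f"
proof -
  have "frechet_derivative f (at x) = f' x" if "x \<in> S" for x
    using frechet_derivative_at[OF assms(2)[OF that]] by simp
  then have "C_k_on k S (\<lambda>x. frechet_derivative f (at x) v)" for v
    using assms(3)[of v] by (subst C_k_on_cong[OF assms(1), of _ "\<lambda>x. f' x v"]) auto
  then show ?thesis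
    using assms(2) by (auto simp: differentiable_def)
qed

lemma C_k_on_SucE:
  assumes "C_k_on (Suc k) S f" "x \<in> S"
  shows "(f has_derivative frechet_derivative f (at x)) (at x)"
  using assms by (simp add: frechet_derivative_works)

lemma C_k_on_const: "open S \<Longrightarrow> C_k_on k S (\<lambda>x. c)"
proof (induction k arbitrary: c)
  case (Suc k)
  then show ?case
    by (intro C_k_on_SucI[where f' = "\<lambda>x v. 0"]) auto
qed simp

lemma C_k_on_linear: "open S \<Longrightarrow> bounded_linear l \<Longrightarrow> C_k_on k S l"
proof (cases k)
  case (Suc k')
  assume "open S" "bounded_linear l"
  then show ?thesis
    unfolding Suc
    by (intro C_k_on_SucI[where f' = "\<lambda>x. l"] C_k_on_const bounded_linear_imp_has_derivative)
qed (auto intro: linear_continuous_on)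

lemma C_k_on_add:
  "open S \<Longrightarrow> C_k_on k S f \<Longrightarrow> C_k_on k S h \<Longrightarrow> C_k_on k S (\<lambda>x. f x + h x)"
proof (induction k arbitrary: f h)
  case (Suc k)
  show ?case
  proof (rule C_k_on_SucI[OF \<open>open S\<close>])
    show "((\<lambda>x. f x + h x) has_derivative
        (\<lambda>v. frechet_derivative f (at x) v + frechet_derivative h (at x) v)) (at x)"
      if "x \<in> S" for x
      using Suc.prems that by (intro has_derivative_add C_k_on_SucE[where k = k and S = S])
    show "C_k_on k S (\<lambda>x. frechet_derivative f (at x) v + frechet_derivative h (at x) v)" for v
      using Suc by simp
  qed
qed (auto intro: continuous_intros)

lemma C_k_on_bilinear:
  assumes B: "bounded_bilinear B" and "open S"
  shows "C_k_on k S f \<Longrightarrow> C_k_on k S h \<Longrightarrow> C_k_on k S (\<lambda>x. B (f x) (h x))"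
proof (induction k arbitrary: f h)
  case 0
  then show ?case
    by (auto intro: bounded_bilinear.continuous_on[OF B])
next
  case (Suc k)
  then have "C_k_on k S f" "C_k_on k S h"
    by (blast intro: C_k_on_Suc_imp)+
  moreover have "C_k_on k S (\<lambda>x. frechet_derivative f (at x) v)"
    "C_k_on k S (\<lambda>x. frechet_derivative h (at x) v)" for v
    using Suc.prems by simp_all
  ultimately have "C_k_on k S (\<lambda>x. B (f x) (frechet_derivative h (at x) v)
      + B (frechet_derivative f (at x) v) (h x))" for v
    by (intro C_k_on_add[OF assms(2)] Suc.IH)
  then show ?case
    using Suc.prems
    by (intro C_k_on_SucI[OF assms(2), where f' = "\<lambda>x v. B (f x) (frechet_derivative h (at x) v)
        + B (frechet_derivative f (at x) v) (h x)"]
        bounded_bilinear.FDERIV[OF B] C_k_on_SucE[where k = k and S = S])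
qed

lemmas C_k_on_mult = C_k_on_bilinear[OF bounded_bilinear_mult]

lemma C_k_on_compose_linear:
  fixes f :: "'b::euclidean_space \<Rightarrow> 'c::real_normed_vector"
  assumes l: "bounded_linear l" and S: "open S" and T: "\<And>x. x \<in> S \<Longrightarrow> l x \<in> T"
  shows "C_k_on k T f \<Longrightarrow> C_k_on k S (\<lambda>x. f (l x))"
proof (induction k arbitrary: f)
  case 0
  then show ?case
    using T by (auto intro: continuous_on_compose2[OF _ linear_continuous_on[OF l]])
next
  case (Suc k)
  show ?case
  proof (rule C_k_on_SucI[OF S, where f' = "\<lambda>x v. frechet_derivative f (at (l x)) (l v)"])
    show "((\<lambda>x. f (l x)) has_derivative (\<lambda>v. frechet_derivative f (at (l x)) (l v))) (at x)"
      if "x \<in> S" for x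
      using has_derivative_compose[OF bounded_linear_imp_has_derivative[OF l]
          C_k_on_SucE[OF Suc.prems T[OF that]]] .
    show "C_k_on k S (\<lambda>x. frechet_derivative f (at (l x)) (l v))" for v
      using Suc.prems by (intro Suc.IH[of "\<lambda>y. frechet_derivative f (at y) (l v)"]) simp
  qed
qed

lemma C_k_on_compose_real:
  fixes h :: "'a::euclidean_space \<Rightarrow> real"
  assumes D: "\<And>n x. (\<phi> n has_real_derivative \<phi> (Suc n) x) (at x)" and S: "open S"
  shows "C_k_on k S h \<Longrightarrow> C_k_on k S (\<lambda>x. \<phi> n (h x))"
proof (induction k arbitrary: n)
  case 0
  have "continuous_on UNIV (\<phi> n)"
    using D by (meson DERIV_isCont continuous_at_imp_continuous_on)
  then show ?case
    using 0 by (auto intro: continuous_on_compose2)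
next
  case (Suc k)
  show ?case
  proof (rule C_k_on_SucI[OF S,
        where f' = "\<lambda>x v. \<phi> (Suc n) (h x) * frechet_derivative h (at x) v"])
    fix x assume "x \<in> S"
    show "((\<lambda>x. \<phi> n (h x)) has_derivative
        (\<lambda>v. \<phi> (Suc n) (h x) * frechet_derivative h (at x) v)) (at x)"
      using has_derivative_compose[OF C_k_on_SucE[OF Suc.prems \<open>x \<in> S\<close>]
          D[of n "h x", unfolded has_field_derivative_def]] .
  next
    fix v
    show "C_k_on k S (\<lambda>x. \<phi> (Suc n) (h x) * frechet_derivative h (at x) v)"
      using Suc C_k_on_Suc_imp[OF Suc.prems] by (intro C_k_on_mult S) auto
  qed
qed

section \<open>A flat function\<close>

text \<open>All derivatives of the flat function \<open>exp (- 1 / s)\<close> have the shape \<open>p (1 / s) * exp (- 1 / s)\<close>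
  with a polynomial \<open>p\<close>, and the family of these functions is closed under differentiation, also
  at \<open>0\<close>.\<close>

definition flat_poly :: "real poly \<Rightarrow> real \<Rightarrow> real"
  where "flat_poly p s = (if s > 0 then poly p (1 / s) * exp (- 1 / s) else 0)"

definition flat_poly_deriv :: "real poly \<Rightarrow> real poly"
  where "flat_poly_deriv p = [:0, 0, 1:] * (p - pderiv p)"

lemma flat_poly_tendsto_0:
  fixes p :: "real poly"
  shows "((\<lambda>s. poly p (1 / s) * exp (- 1 / s)) \<longlongrightarrow> 0) (at_right 0)"
proof -
  have "((\<lambda>x. \<Sum>i\<le>degree p. coeff p i * (x ^ i / exp x)) \<longlongrightarrow> (\<Sum>i\<le>degree p. coeff p i * 0)) at_top"
    by (rule tendsto_sum, rule tendsto_mult[OF tendsto_const], rule tendsto_power_div_exp_0)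
  then have "((\<lambda>x. poly p x * exp (- x)) \<longlongrightarrow> 0) at_top"
    by (simp add: poly_altdef sum_divide_distrib exp_minus field_simps)
  from filterlim_compose[OF this filterlim_inverse_at_top_right] show ?thesis
    by (simp add: inverse_eq_divide)
qed

lemma flat_poly_deriv: "(flat_poly p has_real_derivative flat_poly (flat_poly_deriv p) s) (at s)"
proof (cases s "0 :: real" rule: linorder_cases)
  case less
  have "((\<lambda>s. 0) has_real_derivative 0) (at s)"
    by simp
  then have "(flat_poly p has_real_derivative 0) (at s)"
    by (rule has_field_derivative_transform_within_open[of _ _ _ "{..<0}"])
      (use less in \<open>auto simp: flat_poly_def\<close>)
  then show ?thesis
    using less by (simp add: flat_poly_def)
next
  case greater
  have "((\<lambda>s. poly p (1 / s) * exp (- 1 / s)) has_real_derivative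
      flat_poly (flat_poly_deriv p) s) (at s)"
    using greater
    by (auto intro!: derivative_eq_intros DERIV_chain2[of "poly p"] poly_DERIV
        simp: flat_poly_def flat_poly_deriv_def field_simps power2_eq_square)
  then show ?thesis
    by (rule has_field_derivative_transform_within_open[of _ _ _ "{0<..}"])
      (use greater in \<open>auto simp: flat_poly_def\<close>)
next
  case equal
  have "((\<lambda>s. poly (pCons 0 p) (1 / s) * exp (- 1 / s)) \<longlongrightarrow> 0) (at_right 0)"
    by (rule flat_poly_tendsto_0)
  then have "((\<lambda>s. flat_poly p s / s) \<longlongrightarrow> 0) (at_right 0)"
    by (rule Lim_transform_eventually) (auto simp: eventually_at_right_field flat_poly_def intro!: exI[of _ 1])
  moreover have "((\<lambda>s. flat_poly p s / s) \<longlongrightarrow> 0) (at_left 0)"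
    by (rule tendsto_eventually) (auto simp: eventually_at_left_field flat_poly_def intro!: exI[of _ "-1"])
  ultimately have "((\<lambda>s. flat_poly p s / s) \<longlongrightarrow> 0) (at 0)"
    by (simp add: filterlim_split_at)
  then show ?thesis
    using equal by (simp add: has_field_derivative_iff flat_poly_def)
qed

definition flat :: "real \<Rightarrow> real"
  where "flat = flat_poly 1"

definition flat' :: "real \<Rightarrow> real"
  where "flat' = flat_poly [:0, 0, 1:]"

lemma C_k_on_flat:
  assumes "open S" "C_k_on k S h"
  shows "C_k_on k S (\<lambda>x. flat (h x))"
proof -
  have "C_k_on k S (\<lambda>x. flat_poly ((flat_poly_deriv ^^ 0) 1) (h x))"
    using flat_poly_deriv assms
    by (intro C_k_on_compose_real[where \<phi> = "\<lambda>n. flat_poly ((flat_poly_deriv ^^ n) 1)"]) auto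
  then show ?thesis
    by (simp add: flat_def)
qed

lemma flat_deriv: "(flat has_real_derivative flat' s) (at s)"
proof -
  have "flat_poly_deriv 1 = [:0, 0, 1:]"
    by (simp add: flat_poly_deriv_def)
  then show ?thesis
    using flat_poly_deriv[of 1 s] by (simp add: flat_def flat'_def)
qed

lemma flat_eq_0: "s \<le> 0 \<Longrightarrow> flat s = 0" and flat_pos: "s > 0 \<Longrightarrow> flat s > 0"
  and flat'_eq_0: "s \<le> 0 \<Longrightarrow> flat' s = 0" and flat'_pos: "s > 0 \<Longrightarrow> flat' s > 0"
  by (auto simp: flat_def flat'_def flat_poly_def)

lemma flat_nonneg: "0 \<le> flat s" and flat_le_1: "flat s \<le> 1"
  and flat'_nonneg: "0 \<le> flat' s"
  by (auto simp: flat_def flat'_def flat_poly_def)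

lemma flat'_le_1: "flat' s \<le> 1"
proof (cases "s > 0")
  case True
  \<comment> \<open>\<open>exp x \<ge> x\<^sup>2\<close> holds at \<open>x = 1 / s\<close>, because \<open>exp (x / 2) \<ge> 1 + x / 2 + x\<^sup>2 / 8 \<ge> x\<close>.\<close>
  define x where "x = 1 / s"
  have "x > 0"
    using True by (simp add: x_def)
  have "1 + x / 2 + (x / 2)\<^sup>2 / 2 \<le> exp (x / 2)"
    using \<open>x > 0\<close> exp_lower_Taylor_quadratic[of "x / 2"] by simp
  moreover have "x \<le> 1 + x / 2 + (x / 2)\<^sup>2 / 2"
    using sum_squares_ge_zero[of "x - 2" 2] zero_le_power2[of "x - 2"]
    by (simp add: power2_eq_square field_simps)
  ultimately have "x ^ 2 \<le> (exp (x / 2)) ^ 2"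
    using \<open>x > 0\<close> by (intro power_mono) auto
  then have "x\<^sup>2 \<le> exp x"
    by (simp add: exp_double[symmetric])
  then have "x\<^sup>2 * exp (- x) \<le> 1"
    by (simp add: exp_minus field_simps)
  then show ?thesis
    using True by (simp add: flat'_def flat_poly_def x_def power2_eq_square)
qed (simp add: flat'_eq_0)

section \<open>Geodesics in coordinates\<close>

lemma riemannian_metric_has_derivative:
  assumes "riemannian_metric g"
  shows "(g has_derivative frechet_derivative g (at x)) (at x)"
proof -
  have "C_k_on (Suc 0) UNIV g"
    using assms unfolding riemannian_metric_def smooth_on_def by blast
  then show ?thesis
    using C_k_on_SucE by blast
qed

lemma riemannian_metric_symmetric:
  assumes "riemannian_metric g"
  shows "v \<bullet> (g x *v w) = w \<bullet> (g x *v v)"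
  using assms by (metis dot_lmul_matrix inner_commute riemannian_metric_def transpose_matrix_vector)

lemma riemannian_metric_matrix_inv:
  fixes g :: "real^'n \<Rightarrow> real^'n^'n"
  assumes "riemannian_metric g"
  shows "g x *v (matrix_inv (g x) *v v) = v" "matrix_inv (g x) *v (g x *v v) = v"
proof -
  have "\<forall>v. g x *v v = 0 \<longrightarrow> v = 0"
    using assms unfolding riemannian_metric_def by (metis inner_zero_right less_irrefl)
  then have "invertible (g x)"
    using matrix_left_invertible_ker invertible_left_inverse by blast
  then have "g x ** matrix_inv (g x) = mat 1 \<and> matrix_inv (g x) ** g x = mat 1"
    unfolding matrix_inv_def invertible_def by (rule someI_ex)
  then show "g x *v (matrix_inv (g x) *v v) = v" "matrix_inv (g x) *v (g x *v v) = v"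
    by (simp_all add: matrix_vector_mul_assoc)
qed

lemma bounded_bilinear_matrix_vector_mult:
  "bounded_bilinear ((*v) :: real^'n^'m \<Rightarrow> real^'n \<Rightarrow> real^'m)"
  unfolding bilinear_conv_bounded_bilinear[symmetric] bilinear_def
  by (auto intro!: linearI simp: matrix_vector_mult_add_rdistrib scaleR_matrix_vector_assoc)

lemma metric_form_has_derivative:
  fixes g :: "real^'n \<Rightarrow> real^'n^'n"
  assumes "riemannian_metric g"
  shows "((\<lambda>x. v \<bullet> (g x *v w)) has_derivative (\<lambda>h. v \<bullet> (frechet_derivative g (at x) h *v w))) (at x)"
proof -
  have "bounded_linear (\<lambda>A :: real^'n^'n. v \<bullet> (A *v w))"
    by (intro linear_conv_bounded_linear[THEN iffD1] linearI)
      (simp_all add: matrix_vector_mult_add_rdistrib inner_add_right scaleR_matrix_vector_assoc[symmetric])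
  from bounded_linear.has_derivative[OF this riemannian_metric_has_derivative[OF assms]]
  show ?thesis .
qed

lemma metric_deriv_symmetric:
  fixes g :: "real^'n \<Rightarrow> real^'n^'n"
  assumes "riemannian_metric g"
  shows "v \<bullet> (frechet_derivative g (at x) h *v w) = w \<bullet> (frechet_derivative g (at x) h *v v)"
proof -
  have "(\<lambda>x. v \<bullet> (g x *v w)) = (\<lambda>x. w \<bullet> (g x *v v))"
    using riemannian_metric_symmetric[OF assms] by blast
  then have "((\<lambda>x. v \<bullet> (g x *v w)) has_derivative (\<lambda>h. w \<bullet> (frechet_derivative g (at x) h *v v))) (at x)"
    using metric_form_has_derivative[OF assms, of w v] by simp
  from has_derivative_unique[OF metric_form_has_derivative[OF assms] this] show ?thesis
    by meson
qed

text \<open>Lowering the index of the geodesic equation removes the inverse matrix and leaves only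
  directional derivatives of the metric.\<close>

lemma christoffel_lower:
  fixes g :: "real^'n \<Rightarrow> real^'n^'n"
  assumes g: "riemannian_metric g"
  shows "w \<bullet> (g x *v (\<chi> k. - (\<Sum>i\<in>UNIV. \<Sum>j\<in>UNIV. christoffel g x k i j * v $ i * v $ j))) =
    1/2 * (v \<bullet> (frechet_derivative g (at x) w *v v)) - v \<bullet> (frechet_derivative g (at x) v *v w)"
proof -
  define D where "D = frechet_derivative g (at x)"
  have D: "(g has_derivative D) (at x)"
    using riemannian_metric_has_derivative[OF g] by (simp add: D_def)
  have comp: "((\<lambda>y. g y $ j $ l) has_derivative (\<lambda>h. D h $ j $ l)) (at x)" for j l
    by (intro bounded_linear.has_derivative[OF bounded_linear_vec_nth] D)
  have partial: "partial i (\<lambda>y. g y $ j $ l) x = D (axis i 1) $ j $ l" for i j l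
    unfolding partial_def using frechet_derivative_at[OF comp] by metis
  have lin: "D u $ j $ l = (\<Sum>i\<in>UNIV. u $ i * D (axis i 1) $ j $ l)" for u j l
  proof -
    have "linear (\<lambda>h. D h $ j $ l)"
      using comp has_derivative_linear by blast
    from linear_sum[OF this, of "\<lambda>i. u $ i *\<^sub>R axis i 1" UNIV] show ?thesis
      using linear_scale[OF \<open>linear (\<lambda>h. D h $ j $ l)\<close>] basis_expansion[of u]
      by (simp add: scalar_mult_eq_scaleR)
  qed
  define T where "T l = (\<Sum>i\<in>UNIV. \<Sum>j\<in>UNIV. (D (axis i 1) $ j $ l + D (axis j 1) $ i $ l
      - D (axis l 1) $ i $ j) * v $ i * v $ j) / 2" for l
  have "(\<Sum>i\<in>UNIV. \<Sum>j\<in>UNIV. christoffel g x k i j * v $ i * v $ j) =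
      (\<Sum>i\<in>UNIV. \<Sum>j\<in>UNIV. \<Sum>l\<in>UNIV. matrix_inv (g x) $ k $ l *
        ((D (axis i 1) $ j $ l + D (axis j 1) $ i $ l - D (axis l 1) $ i $ j) * v $ i * v $ j) / 2)" for k
    unfolding christoffel_def partial
    by (intro sum.cong refl) (simp add: sum_distrib_right sum_divide_distrib mult.assoc)
  also have "\<dots> k = (\<Sum>i\<in>UNIV. \<Sum>l\<in>UNIV. \<Sum>j\<in>UNIV. matrix_inv (g x) $ k $ l *
        ((D (axis i 1) $ j $ l + D (axis j 1) $ i $ l - D (axis l 1) $ i $ j) * v $ i * v $ j) / 2)" for k
    by (intro sum.cong refl sum.swap)
  also have "\<dots> k = (\<Sum>l\<in>UNIV. \<Sum>i\<in>UNIV. \<Sum>j\<in>UNIV. matrix_inv (g x) $ k $ l *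
        ((D (axis i 1) $ j $ l + D (axis j 1) $ i $ l - D (axis l 1) $ i $ j) * v $ i * v $ j) / 2)" for k
    by (rule sum.swap)
  also have "\<dots> k = (\<Sum>l\<in>UNIV. matrix_inv (g x) $ k $ l * T l)" for k
    unfolding T_def by (simp add: sum_distrib_left sum_divide_distrib)
  finally have "(\<chi> k. - (\<Sum>i\<in>UNIV. \<Sum>j\<in>UNIV. christoffel g x k i j * v $ i * v $ j)) =
      - (matrix_inv (g x) *v (\<chi> l. T l))"
    by (simp add: vec_eq_iff matrix_vector_mult_def)
  moreover have "g x *v - (matrix_inv (g x) *v (\<chi> l. T l)) = - (\<chi> l. T l)"
    using linear_neg[OF matrix_vector_mul_linear, of "g x"]
    by (simp add: riemannian_metric_matrix_inv[OF g])
  moreover have "w \<bullet> (- (\<chi> l. T l)) = 1/2 * (v \<bullet> (D w *v v)) - v \<bullet> (D v *v w)"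
  proof -
    have 1: "(\<Sum>l\<in>UNIV. \<Sum>i\<in>UNIV. \<Sum>j\<in>UNIV. w $ l * (D (axis i 1) $ j $ l * v $ i * v $ j)) = v \<bullet> (D v *v w)"
    proof -
      have "(\<Sum>l\<in>UNIV. \<Sum>i\<in>UNIV. \<Sum>j\<in>UNIV. w $ l * (D (axis i 1) $ j $ l * v $ i * v $ j)) =
          (\<Sum>l\<in>UNIV. \<Sum>j\<in>UNIV. \<Sum>i\<in>UNIV. w $ l * (D (axis i 1) $ j $ l * v $ i * v $ j))"
        by (intro sum.cong refl sum.swap)
      also have "\<dots> = (\<Sum>j\<in>UNIV. \<Sum>l\<in>UNIV. \<Sum>i\<in>UNIV. w $ l * (D (axis i 1) $ j $ l * v $ i * v $ j))"
        by (rule sum.swap)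
      also have "\<dots> = v \<bullet> (D v *v w)"
        by (simp add: inner_vec_def matrix_vector_mult_def lin[of v] sum_distrib_left sum_distrib_right mult_ac)
      finally show ?thesis .
    qed
    have 2: "(\<Sum>l\<in>UNIV. \<Sum>i\<in>UNIV. \<Sum>j\<in>UNIV. w $ l * (D (axis j 1) $ i $ l * v $ i * v $ j)) = v \<bullet> (D v *v w)"
    proof -
      have "(\<Sum>l\<in>UNIV. \<Sum>i\<in>UNIV. \<Sum>j\<in>UNIV. w $ l * (D (axis j 1) $ i $ l * v $ i * v $ j)) =
          (\<Sum>l\<in>UNIV. \<Sum>j\<in>UNIV. \<Sum>i\<in>UNIV. w $ l * (D (axis j 1) $ i $ l * v $ i * v $ j))"
        by (intro sum.cong refl sum.swap)
      also have "\<dots> = (\<Sum>l\<in>UNIV. \<Sum>i\<in>UNIV. \<Sum>j\<in>UNIV. w $ l * (D (axis i 1) $ j $ l * v $ i * v $ j))"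
        by (simp add: mult_ac)
      finally show ?thesis
        using 1 by simp
    qed
    have 3: "(\<Sum>l\<in>UNIV. \<Sum>i\<in>UNIV. \<Sum>j\<in>UNIV. w $ l * (D (axis l 1) $ i $ j * v $ i * v $ j)) = v \<bullet> (D w *v v)"
    proof -
      have "(\<Sum>l\<in>UNIV. \<Sum>i\<in>UNIV. \<Sum>j\<in>UNIV. w $ l * (D (axis l 1) $ i $ j * v $ i * v $ j)) =
          (\<Sum>i\<in>UNIV. \<Sum>l\<in>UNIV. \<Sum>j\<in>UNIV. w $ l * (D (axis l 1) $ i $ j * v $ i * v $ j))"
        by (rule sum.swap)
      also have "\<dots> = (\<Sum>i\<in>UNIV. \<Sum>j\<in>UNIV. \<Sum>l\<in>UNIV. w $ l * (D (axis l 1) $ i $ j * v $ i * v $ j))"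
        by (intro sum.cong refl sum.swap)
      also have "\<dots> = v \<bullet> (D w *v v)"
        by (simp add: inner_vec_def matrix_vector_mult_def lin[of w] sum_distrib_left sum_distrib_right mult_ac)
      finally show ?thesis .
    qed
    have "w \<bullet> (\<chi> l. T l) = ((\<Sum>l\<in>UNIV. \<Sum>i\<in>UNIV. \<Sum>j\<in>UNIV. w $ l * (D (axis i 1) $ j $ l * v $ i * v $ j))
        + (\<Sum>l\<in>UNIV. \<Sum>i\<in>UNIV. \<Sum>j\<in>UNIV. w $ l * (D (axis j 1) $ i $ l * v $ i * v $ j))
        - (\<Sum>l\<in>UNIV. \<Sum>i\<in>UNIV. \<Sum>j\<in>UNIV. w $ l * (D (axis l 1) $ i $ j * v $ i * v $ j))) / 2"
      unfolding T_def inner_vec_def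
      by (simp add: sum_distrib_left sum_divide_distrib sum.distrib[symmetric] sum_subtractf[symmetric]
          algebra_simps diff_divide_distrib add_divide_distrib)
    then show ?thesis
      unfolding 1 2 3 by simp
  qed
  ultimately show ?thesis
    by (simp add: D_def)
qed

lemma geodesic_iff:
  fixes g :: "real^'n \<Rightarrow> real^'n^'n"
  assumes g: "riemannian_metric g"
  shows "geodesic g c \<longleftrightarrow> (\<exists>c' c''. \<forall>t.
    (c has_vector_derivative c' t) (at t) \<and> (c' has_vector_derivative c'' t) (at t) \<and>
    (\<forall>w. w \<bullet> (g (c t) *v c'' t) = 1/2 * (c' t \<bullet> (frechet_derivative g (at (c t)) w *v c' t))
      - c' t \<bullet> (frechet_derivative g (at (c t)) (c' t) *v w)))"
    (is "_ \<longleftrightarrow> ?R")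
proof
  assume "geodesic g c"
  then obtain c' where "\<And>t. (c has_vector_derivative c' t) (at t)"
    "\<And>t. (c' has_vector_derivative
      (\<chi> k. - (\<Sum>i\<in>UNIV. \<Sum>j\<in>UNIV. christoffel g (c t) k i j * c' t $ i * c' t $ j))) (at t)"
    unfolding geodesic_def by blast
  then show ?R
    by (intro exI[of _ c'] exI[of _ "\<lambda>t. \<chi> k. - (\<Sum>i\<in>UNIV. \<Sum>j\<in>UNIV. christoffel g (c t) k i j * c' t $ i * c' t $ j)"]
        allI conjI christoffel_lower[OF g])
next
  assume ?R
  then obtain c' c'' where c: "\<And>t. (c has_vector_derivative c' t) (at t)"
    "\<And>t. (c' has_vector_derivative c'' t) (at t)"
    "\<And>t w. w \<bullet> (g (c t) *v c'' t) = 1/2 * (c' t \<bullet> (frechet_derivative g (at (c t)) w *v c' t))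
      - c' t \<bullet> (frechet_derivative g (at (c t)) (c' t) *v w)"
    by blast
  have acc: "c'' t = (\<chi> k. - (\<Sum>i\<in>UNIV. \<Sum>j\<in>UNIV. christoffel g (c t) k i j * c' t $ i * c' t $ j))" (is "_ = ?r") for t
  proof -
    have "g (c t) *v c'' t = g (c t) *v ?r"
      by (rule vector_eq_ldot[THEN iffD1]) (simp only: c(3) christoffel_lower[OF g] simp_thms)
    then have "matrix_inv (g (c t)) *v (g (c t) *v c'' t) = matrix_inv (g (c t)) *v (g (c t) *v ?r)"
      by (simp only:)
    then show ?thesis
      by (simp only: riemannian_metric_matrix_inv(2)[OF g])
  qed
  show "geodesic g c"
    unfolding geodesic_def
    by (intro exI[of _ c'] allI conjI c(1) c(2)[unfolded acc])
qed

text \<open>Noether's identity: the momentum of a geodesic in the direction of a field \<open>W\<close> along it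
  changes at the rate by which the flow of \<open>W\<close> changes the metric.\<close>

lemma momentum_derivative:
  fixes g :: "real^'n \<Rightarrow> real^'n^'n"
  assumes g: "riemannian_metric g"
    and c: "(c has_vector_derivative c' t) (at t)" "(c' has_vector_derivative a) (at t)"
    and a: "\<And>w. w \<bullet> (g (c t) *v a) = 1/2 * (c' t \<bullet> (frechet_derivative g (at (c t)) w *v c' t))
      - c' t \<bullet> (frechet_derivative g (at (c t)) (c' t) *v w)"
    and W: "(W has_vector_derivative W') (at t)"
  shows "((\<lambda>t. W t \<bullet> (g (c t) *v c' t)) has_real_derivative
    W' \<bullet> (g (c t) *v c' t) + 1/2 * (c' t \<bullet> (frechet_derivative g (at (c t)) (W t) *v c' t))) (at t)"
proof -
  define D where "D = frechet_derivative g (at (c t))"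
  have "((\<lambda>t. g (c t)) has_vector_derivative D (c' t)) (at t)"
    using vector_derivative_diff_chain_within[OF c(1) has_derivative_at_withinI[OF riemannian_metric_has_derivative[OF g]]]
    by (simp add: o_def D_def)
  then have "((\<lambda>t. g (c t) *v c' t) has_vector_derivative g (c t) *v a + D (c' t) *v c' t) (at t)"
    by (rule bounded_bilinear.has_vector_derivative[OF bounded_bilinear_matrix_vector_mult _ c(2)])
  from bounded_bilinear.has_vector_derivative[OF bounded_bilinear_inner W this]
  have "((\<lambda>t. W t \<bullet> (g (c t) *v c' t)) has_vector_derivative
      W t \<bullet> (g (c t) *v a + D (c' t) *v c' t) + W' \<bullet> (g (c t) *v c' t)) (at t)" .
  moreover have "W t \<bullet> (D (c' t) *v c' t) = c' t \<bullet> (D (c' t) *v W t)"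
    unfolding D_def by (rule metric_deriv_symmetric[OF g])
  ultimately show ?thesis
    by (simp add: has_real_derivative_iff_has_vector_derivative inner_add_right a D_def add.commute)
qed

section \<open>Rotationally symmetric metrics on the plane\<close>

definition rot :: "real^2 \<Rightarrow> real^2"
  where "rot x = vector [- x $ 2, x $ 1]"

text \<open>\<open>wedge x v\<close> is \<open>r\<^sup>2 d\<theta>(v)\<close> at the point \<open>x\<close>, just as \<open>x \<bullet> v\<close> is \<open>r dr(v)\<close>.\<close>

definition wedge :: "real^2 \<Rightarrow> real^2 \<Rightarrow> real"
  where "wedge x v = x $ 1 * v $ 2 - x $ 2 * v $ 1"

lemma rot_nth [simp]: "rot x $ 1 = - x $ 2" "rot x $ 2 = x $ 1"
  by (simp_all add: rot_def)

lemma inner_2: "x \<bullet> y = x $ 1 * y $ 1 + x $ 2 * y $ 2" for x y :: "real^2"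
  by (simp add: inner_vec_def sum_2)

lemma norm_2: "(norm x)\<^sup>2 = (x $ 1)\<^sup>2 + (x $ 2)\<^sup>2" for x :: "real^2"
  unfolding power2_norm_eq_inner inner_2 by (simp add: power2_eq_square)

lemma vec2_eq_iff: "x = y \<longleftrightarrow> x $ 1 = y $ 1 \<and> x $ 2 = y $ 2" for x y :: "'a^2"
  by (simp add: vec_eq_iff forall_2)

lemma rot_0 [simp]: "rot 0 = 0"
  by (simp add: vec2_eq_iff)

lemma bounded_linear_rot: "bounded_linear rot"
  by (intro linear_conv_bounded_linear[THEN iffD1] linearI) (simp_all add: vec2_eq_iff)

lemma polar_cases:
  obtains \<theta> where "x = polar (norm x) \<theta>"
proof -
  have "(x $ 1)\<^sup>2 + (x $ 2)\<^sup>2 = (norm x)\<^sup>2"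
    by (simp add: norm_2)
  then have "(x $ 1 / norm x)\<^sup>2 + (x $ 2 / norm x)\<^sup>2 = 1" if "x \<noteq> 0"
    using that by (simp add: power_divide add_divide_distrib[symmetric])
  then obtain \<theta> where "x \<noteq> 0 \<Longrightarrow> x $ 1 / norm x = cos \<theta>" "x \<noteq> 0 \<Longrightarrow> x $ 2 / norm x = sin \<theta>"
    by (metis sincos_total_2pi_le)
  then show ?thesis
    by (intro that[of \<theta>]) (cases "x = 0", simp_all add: vec2_eq_iff[of _ "vector _"] polar_def field_simps)
qed

lemma vector_derivative_polar:
  "vector_derivative (\<lambda>s. polar s \<theta>) (at r) = vector [cos \<theta>, sin \<theta>]"
  "vector_derivative (\<lambda>\<phi>. polar r \<phi>) (at \<theta>) = vector [- r * sin \<theta>, r * cos \<theta>]"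
proof -
  have e: "polar r \<theta> = (r * cos \<theta>) *\<^sub>R vector [1, 0] + (r * sin \<theta>) *\<^sub>R vector [0, 1]" for r \<theta>
    by (simp add: vec2_eq_iff polar_def)
  have "((\<lambda>s. polar s \<theta>) has_vector_derivative vector [cos \<theta>, sin \<theta>]) (at r)"
    unfolding e by (auto intro!: derivative_eq_intros simp: vec2_eq_iff)
  then show "vector_derivative (\<lambda>s. polar s \<theta>) (at r) = vector [cos \<theta>, sin \<theta>]"
    by (rule vector_derivative_at)
  have "((\<lambda>\<phi>. polar r \<phi>) has_vector_derivative vector [- r * sin \<theta>, r * cos \<theta>]) (at \<theta>)"
    unfolding e by (auto intro!: derivative_eq_intros simp: vec2_eq_iff)
  then show "vector_derivative (\<lambda>\<phi>. polar r \<phi>) (at \<theta>) = vector [- r * sin \<theta>, r * cos \<theta>]"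
    by (rule vector_derivative_at)
qed

text \<open>The metric \<open>dr\<^sup>2 + f(r)\<^sup>2 d\<theta>\<^sup>2\<close> in terms of the forms \<open>r dr\<close> and \<open>r\<^sup>2 d\<theta>\<close>, without angles.\<close>

lemma polar_form_inner:
  assumes g: "riemannian_metric g" and p: "polar_form g f" and "x \<noteq> 0"
  shows "v \<bullet> (g x *v w) = (x \<bullet> v) * (x \<bullet> w) / (x \<bullet> x)
    + (f (norm x))\<^sup>2 * (wedge x v * wedge x w) / (x \<bullet> x)\<^sup>2"
proof -
  obtain \<theta> where \<theta>: "x = polar (norm x) \<theta>"
    by (rule polar_cases)
  define r where "r = norm x"
  have "r > 0"
    using assms(3) by (simp add: r_def)
  define dr d\<theta> :: "real^2" where "dr = vector [cos \<theta>, sin \<theta>]" and "d\<theta> = vector [- r * sin \<theta>, r * cos \<theta>]"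
  have x: "x $ 1 = r * cos \<theta>" "x $ 2 = r * sin \<theta>"
    using \<theta> by (auto simp: r_def polar_def vec2_eq_iff)
  have xx: "x \<bullet> x = r\<^sup>2"
    by (simp add: r_def power2_norm_eq_inner)
  have "dr \<bullet> (g x *v dr) = 1 \<and> dr \<bullet> (g x *v d\<theta>) = 0 \<and> d\<theta> \<bullet> (g x *v d\<theta>) = (f r)\<^sup>2"
    using p[unfolded polar_form_def vector_derivative_polar Let_def, rule_format, OF \<open>r > 0\<close>, of \<theta>] \<theta>
    by (simp add: dr_def d\<theta>_def r_def)
  moreover have "d\<theta> \<bullet> (g x *v dr) = dr \<bullet> (g x *v d\<theta>)"
    by (rule riemannian_metric_symmetric[OF g])
  ultimately have bil: "(a *\<^sub>R dr + b *\<^sub>R d\<theta>) \<bullet> (g x *v (a' *\<^sub>R dr + b' *\<^sub>R d\<theta>)) = a * a' + b * b' * (f r)\<^sup>2" for a b a' b'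
    by (simp add: matrix_vector_right_distrib matrix_vector_mult_scaleR inner_add_left inner_add_right)
  have dec: "u = ((x \<bullet> u) / r) *\<^sub>R dr + (wedge x u / r\<^sup>2) *\<^sub>R d\<theta>" for u
  proof -
    have "(x \<bullet> u) / r = cos \<theta> * u $ 1 + sin \<theta> * u $ 2"
      "wedge x u / r\<^sup>2 * r = cos \<theta> * u $ 2 - sin \<theta> * u $ 1"
      using \<open>r > 0\<close> by (simp_all add: inner_2 wedge_def x field_simps power2_eq_square)
    moreover have "u $ 1 = (cos \<theta> * u $ 1 + sin \<theta> * u $ 2) * cos \<theta> - (cos \<theta> * u $ 2 - sin \<theta> * u $ 1) * sin \<theta>"
      "u $ 2 = (cos \<theta> * u $ 1 + sin \<theta> * u $ 2) * sin \<theta> + (cos \<theta> * u $ 2 - sin \<theta> * u $ 1) * cos \<theta>"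
      using sin_cos_squared_add3[of \<theta>] by algebra+
    ultimately show ?thesis
      by (simp add: vec2_eq_iff dr_def d\<theta>_def mult.assoc[symmetric])
  qed
  have "v \<bullet> (g x *v w) = (x \<bullet> v) / r * ((x \<bullet> w) / r) + wedge x v / r\<^sup>2 * (wedge x w / r\<^sup>2) * (f r)\<^sup>2"
    using bil[of "(x \<bullet> v) / r" "wedge x v / r\<^sup>2" "(x \<bullet> w) / r" "wedge x w / r\<^sup>2"]
    unfolding dec[symmetric] .
  then show ?thesis
    by (simp add: xx r_def[symmetric] power2_eq_square mult_ac)
qed

text \<open>At the origin it is enough for what follows that \<open>g\<close> is conformal to the Euclidean metric. This
  comes by continuity from the points on the line spanned by \<open>v\<close>.\<close>

lemma polar_form_origin:
  assumes g: "riemannian_metric g" and p: "polar_form g f"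
  shows "v \<bullet> (g 0 *v rot v) = 0"
proof (cases "v = 0")
  case False
  have "((\<lambda>s. v \<bullet> (g (s *\<^sub>R v) *v rot v)) \<longlongrightarrow> v \<bullet> (g 0 *v rot v)) (at (0::real))"
  proof -
    have "isCont (\<lambda>x. v \<bullet> (g x *v rot v)) (0 *\<^sub>R v)"
      using has_derivative_continuous[OF metric_form_has_derivative[OF g]] by simp
    moreover have "((\<lambda>s. s *\<^sub>R v) \<longlongrightarrow> 0 *\<^sub>R v) (at (0::real))"
      by (intro tendsto_intros)
    ultimately show ?thesis
      using isCont_tendsto_compose[of "0 *\<^sub>R v" "\<lambda>x. v \<bullet> (g x *v rot v)" "\<lambda>s. s *\<^sub>R v"] by simp
  qed
  moreover have "((\<lambda>s. v \<bullet> (g (s *\<^sub>R v) *v rot v)) \<longlongrightarrow> 0) (at (0::real))"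
  proof (rule tendsto_eventually)
    have "v \<bullet> (g (s *\<^sub>R v) *v rot v) = 0" if "s \<noteq> 0" for s :: real
      using polar_form_inner[OF g p, of "s *\<^sub>R v" v "rot v"] that False
      by (simp add: inner_2 wedge_def)
    then show "\<forall>\<^sub>F s in at (0::real). v \<bullet> (g (s *\<^sub>R v) *v rot v) = 0"
      by (auto simp: eventually_at_filter)
  qed
  ultimately show ?thesis
    using tendsto_unique trivial_limit_at by blast
qed simp

section \<open>The perturbation\<close>

text \<open>The support \<open>2 \<pi> / 3 \<le> r \<le> 3 \<pi> / 4\<close> keeps a distance from the equator \<open>r = \<pi> / 2\<close>, so that \<open>f'\<close> is
  bounded away from zero on it. The argument of the cutoff is \<open>r\<^sup>2\<close>, which is a polynomial in
  Cartesian coordinates.\<close>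

definition cutoff :: "real \<Rightarrow> real"
  where "cutoff q = flat (q - (2 * pi / 3)\<^sup>2) * flat ((3 * pi / 4)\<^sup>2 - q)"

definition cutoff' :: "real \<Rightarrow> real"
  where "cutoff' q = flat' (q - (2 * pi / 3)\<^sup>2) * flat ((3 * pi / 4)\<^sup>2 - q)
    - flat (q - (2 * pi / 3)\<^sup>2) * flat' ((3 * pi / 4)\<^sup>2 - q)"

text \<open>On half circles \<open>y > 0\<close> in the open annulus the bump is an increasing function of \<open>y = r sin \<theta>\<close>; it is flat at
  \<open>y = 0\<close>. So every radial line in the upper half plane except the vertical axis meets points with
  nonzero angular derivative, and none in the closed lower half plane does.\<close>

definition bump :: "real^2 \<Rightarrow> real"
  where "bump x = flat (x $ 2) * cutoff (x \<bullet> x)"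

definition outer :: "real^2 \<Rightarrow> real^2 \<Rightarrow> real^2^2"
  where "outer x y = (\<chi> i j. x $ i * y $ j)"

text \<open>The form \<open>outer x x\<close> is \<open>r\<^sup>2 dr\<^sup>2\<close>. The parameter enters by its square because the sign matters: the
  metric has to be enlarged for the torque to point towards the vertical axis.\<close>

definition perturb :: "(real^2 \<Rightarrow> real^2^2) \<Rightarrow> real \<Rightarrow> real^2 \<Rightarrow> real^2^2"
  where "perturb g \<epsilon> x = g x + (\<epsilon>\<^sup>2 * bump x) *\<^sub>R outer x x"

lemma cutoff_deriv: "(cutoff has_real_derivative cutoff' q) (at q)"
  unfolding cutoff_def[abs_def] cutoff'_def
  by (auto intro!: derivative_eq_intros DERIV_chain2[OF flat_deriv])

lemma cutoff_nonneg: "0 \<le> cutoff q" and cutoff_le_1: "cutoff q \<le> 1"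
  and abs_cutoff'_le_1: "\<bar>cutoff' q\<bar> \<le> 1"
proof -
  have *: "0 \<le> a * b \<and> a * b \<le> 1" if "0 \<le> a" "a \<le> 1" "0 \<le> b" "b \<le> 1" for a b :: real
    using that by (simp add: mult_le_one)
  show "0 \<le> cutoff q" "cutoff q \<le> 1"
    unfolding cutoff_def by (auto simp: * flat_nonneg flat_le_1)
  show "\<bar>cutoff' q\<bar> \<le> 1"
    using *[OF flat'_nonneg flat'_le_1 flat_nonneg flat_le_1, of "q - (2 * pi / 3)\<^sup>2" "(3 * pi / 4)\<^sup>2 - q"]
      *[OF flat_nonneg flat_le_1 flat'_nonneg flat'_le_1, of "q - (2 * pi / 3)\<^sup>2" "(3 * pi / 4)\<^sup>2 - q"]
    unfolding cutoff'_def by linarith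
qed

lemma cutoff_eq_0:
  assumes "q \<le> (2 * pi / 3)\<^sup>2 \<or> q \<ge> (3 * pi / 4)\<^sup>2"
  shows "cutoff q = 0" "cutoff' q = 0"
  using assms by (auto simp: cutoff_def cutoff'_def flat_eq_0 flat'_eq_0)

lemma cutoff_pos: "(2 * pi / 3)\<^sup>2 < q \<Longrightarrow> q < (3 * pi / 4)\<^sup>2 \<Longrightarrow> cutoff q > 0"
  by (simp add: cutoff_def flat_pos)

lemma bump_nonneg: "0 \<le> bump x" and bump_le_1: "bump x \<le> 1"
  by (simp_all add: bump_def flat_nonneg cutoff_nonneg flat_le_1 cutoff_le_1 mult_le_one)

lemma bump_eq_0_outside:
  assumes "x \<notin> {polar r \<theta> | r \<theta>. pi / 2 < r \<and> r < 3 * pi / 4 \<and> 0 < \<theta> \<and> \<theta> < pi}"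
  shows "bump x = 0"
proof (rule ccontr)
  assume "bump x \<noteq> 0"
  then have "cutoff (x \<bullet> x) \<noteq> 0" and x2: "x $ 2 > 0"
    using flat_eq_0[of "x $ 2"] by (auto simp: bump_def not_le[symmetric])
  then have "(2 * pi / 3)\<^sup>2 < (norm x)\<^sup>2" "(norm x)\<^sup>2 < (3 * pi / 4)\<^sup>2"
    using cutoff_eq_0(1)[of "x \<bullet> x"] by (auto simp: power2_norm_eq_inner not_le[symmetric])
  then have r: "2 * pi / 3 < norm x" "norm x < 3 * pi / 4"
    using power_less_imp_less_base[of "2 * pi / 3" 2 "norm x"]
      power_less_imp_less_base[of "norm x" 2 "3 * pi / 4"] by auto
  have *: "(x $ 1)\<^sup>2 + (x $ 2)\<^sup>2 = (norm x)\<^sup>2"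
    by (simp add: norm_2)
  have "norm x > 0"
    using x2 by auto
  define \<theta> where "\<theta> = arccos (x $ 1 / norm x)"
  have "\<bar>x $ 1\<bar>\<^sup>2 < (norm x)\<^sup>2"
    unfolding *[symmetric] using x2 by simp
  then have "\<bar>x $ 1\<bar> < norm x"
    by (rule power2_less_imp_less) simp
  then have b: "- 1 < x $ 1 / norm x" "x $ 1 / norm x < 1"
    using \<open>norm x > 0\<close> by (auto simp: field_simps)
  then have \<theta>: "0 < \<theta>" "\<theta> < pi" "cos \<theta> = x $ 1 / norm x"
    using arccos_lt_bounded[OF b] by (auto simp: \<theta>_def)
  have "(sin \<theta>)\<^sup>2 = (x $ 2 / norm x)\<^sup>2"
    using * \<open>norm x > 0\<close> by (simp add: sin_squared_eq \<theta>(3) power_divide field_simps)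
  then have "sin \<theta> = x $ 2 / norm x"
    by (rule power2_eq_imp_eq)
      (use sin_gt_zero[OF \<theta>(1,2)] x2 \<open>norm x > 0\<close> in simp_all)
  then have "x = polar (norm x) \<theta>"
    using \<theta>(3) \<open>norm x > 0\<close> by (simp add: vec2_eq_iff polar_def)
  moreover have "pi / 2 < norm x"
    using r(1) pi_gt_zero by linarith
  ultimately show False
    using assms r \<theta> by blast
qed

lemma perturb_inner:
  "v \<bullet> (perturb g \<epsilon> x *v w) = v \<bullet> (g x *v w) + \<epsilon>\<^sup>2 * bump x * ((x \<bullet> v) * (x \<bullet> w))"
proof -
  have "v \<bullet> (outer x x *v w) = (x \<bullet> v) * (x \<bullet> w)"
    by (simp add: outer_def inner_2 matrix_vector_mult_def sum_2 algebra_simps)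
  then show ?thesis
    by (simp add: perturb_def matrix_vector_mult_add_rdistrib inner_add_right scaleR_matrix_vector_assoc[symmetric])
qed

lemma C_k_on_bump:
  assumes S: "open S" and l: "C_k_on k S l"
  shows "C_k_on k S (\<lambda>y. bump (l y))"
proof -
  have nth: "C_k_on k S (\<lambda>y. l y $ i)" for i
    using C_k_on_bilinear[OF bounded_bilinear_inner S l C_k_on_const[OF S], of "axis i 1"]
    by (simp add: inner_axis)
  have "C_k_on k S (\<lambda>y. l y \<bullet> l y + a)" "C_k_on k S (\<lambda>y. a + (-1) *\<^sub>R (l y \<bullet> l y))" for a
    by (intro C_k_on_add C_k_on_bilinear[OF bounded_bilinear_inner] C_k_on_bilinear[OF bounded_bilinear_scaleR] C_k_on_const S l)+
  from this(1)[of "- (2 * pi / 3)\<^sup>2"] this(2)[of "(3 * pi / 4)\<^sup>2"]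
  show ?thesis
    unfolding bump_def cutoff_def by (intro C_k_on_mult C_k_on_flat S nth) simp_all
qed

lemma bounded_bilinear_outer: "bounded_bilinear outer"
  unfolding bilinear_conv_bounded_bilinear[symmetric] bilinear_def
  by (auto intro!: linearI simp: outer_def vec_eq_iff algebra_simps)

lemma smooth_on_perturb:
  assumes g: "riemannian_metric g" and T: "open T"
  shows "smooth_on (T \<times> UNIV) (\<lambda>(\<epsilon>, x). perturb g \<epsilon> x)"
  unfolding smooth_on_def
proof
  fix k
  let ?S = "T \<times> UNIV :: (real \<times> (real^2)) set"
  have S: "open ?S"
    using T by (intro open_Times) auto
  have g: "C_k_on k UNIV g"
    using g unfolding riemannian_metric_def smooth_on_def by blast
  show "C_k_on k ?S (\<lambda>(\<epsilon>, x). perturb g \<epsilon> x)"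
    unfolding perturb_def case_prod_unfold power2_eq_square
    by (intro C_k_on_add C_k_on_bilinear[OF bounded_bilinear_scaleR] C_k_on_mult C_k_on_bump
        C_k_on_bilinear[OF bounded_bilinear_outer] C_k_on_linear S bounded_linear_fst bounded_linear_snd
        C_k_on_compose_linear[OF bounded_linear_snd S _ g]) auto
qed

lemma riemannian_metric_perturb:
  assumes g: "riemannian_metric g"
  shows "riemannian_metric (perturb g \<epsilon>)"
  unfolding riemannian_metric_def
proof (intro conjI allI impI)
  show "smooth_on UNIV (perturb g \<epsilon>)"
    unfolding smooth_on_def perturb_def[abs_def]
  proof
    fix k
    have "C_k_on k UNIV g" "C_k_on k UNIV (\<lambda>x :: real^2. x)"
      using g C_k_on_linear[OF open_UNIV bounded_linear_ident]
      unfolding riemannian_metric_def smooth_on_def by blast+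
    then show "C_k_on k UNIV (\<lambda>x. g x + (\<epsilon>\<^sup>2 * bump x) *\<^sub>R outer x x)"
      by (intro C_k_on_add C_k_on_bilinear[OF bounded_bilinear_scaleR] C_k_on_mult C_k_on_bump
          C_k_on_bilinear[OF bounded_bilinear_outer] C_k_on_const open_UNIV)
  qed
  show "transpose (perturb g \<epsilon> x) = perturb g \<epsilon> x" for x
    using g by (simp add: riemannian_metric_def perturb_def outer_def transpose_def vec_eq_iff mult.commute)
  show "v \<bullet> (perturb g \<epsilon> x *v v) > 0" if "v \<noteq> 0" for x v
    using g that bump_nonneg[of x] unfolding perturb_inner riemannian_metric_def
    by (metis add_pos_nonneg mult_nonneg_nonneg zero_le_power2 zero_le_square)
qed

lemma bump_has_derivative:
  "(bump has_derivative (\<lambda>h. flat' (x $ 2) * cutoff (x \<bullet> x) * h $ 2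
     + 2 * flat (x $ 2) * cutoff' (x \<bullet> x) * (x \<bullet> h))) (at x)"
proof -
  have 1: "((\<lambda>x. flat (x $ 2)) has_derivative (\<lambda>h. flat' (x $ 2) * h $ 2)) (at x)"
    using has_derivative_compose[OF bounded_linear_imp_has_derivative[OF bounded_linear_vec_nth]
        flat_deriv[unfolded has_field_derivative_def]] .
  have "((\<lambda>x. x \<bullet> x) has_derivative (\<lambda>h. 2 * (x \<bullet> h))) (at x)"
    by (auto intro!: derivative_eq_intros simp: inner_commute)
  from has_derivative_compose[OF this cutoff_deriv[unfolded has_field_derivative_def]]
  have "((\<lambda>x. cutoff (x \<bullet> x)) has_derivative (\<lambda>h. cutoff' (x \<bullet> x) * (2 * (x \<bullet> h)))) (at x)" .
  from has_derivative_mult[OF 1 this] show ?thesis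
    unfolding bump_def[abs_def] by (simp add: mult_ac add.commute)
qed

section \<open>Equations of motion\<close>

text \<open>The derivatives of the bump along the rotation field \<open>\<partial> / \<partial>\<theta>\<close> and the dilation field
  \<open>r \<partial> / \<partial>r\<close>.\<close>

definition bump_angular :: "real^2 \<Rightarrow> real"
  where "bump_angular x = flat' (x $ 2) * cutoff (x \<bullet> x) * x $ 1"

definition bump_radial :: "real^2 \<Rightarrow> real"
  where "bump_radial x = flat' (x $ 2) * cutoff (x \<bullet> x) * x $ 2
    + 2 * flat (x $ 2) * cutoff' (x \<bullet> x) * (x \<bullet> x)"

lemma bump_eq_0:
  assumes "x \<bullet> x \<le> (2 * pi / 3)\<^sup>2 \<or> x \<bullet> x \<ge> (3 * pi / 4)\<^sup>2"
  shows "bump x = 0" "bump_angular x = 0" "bump_radial x = 0"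
  using cutoff_eq_0[OF assms] by (simp_all add: bump_def bump_angular_def bump_radial_def)

locale perturbed_plane =
  fixes f :: "real \<Rightarrow> real" and g :: "real^2 \<Rightarrow> real^2^2" and \<epsilon> :: real
  assumes smooth_f: "smooth_on {0<..} f"
    and f_pos: "\<And>r. r > 0 \<Longrightarrow> f r > 0"
    and f_sin: "\<And>r. 0 < r \<Longrightarrow> r < 3 * pi / 4 \<Longrightarrow> f r = sin r"
    and deriv_f_neg: "\<And>r. r > pi / 2 \<Longrightarrow> deriv f r < 0"
    and f_tendsto_0: "(f \<longlongrightarrow> 0) at_top"
    and metric: "riemannian_metric g"
    and polar_form: "polar_form g f"
    and \<epsilon>: "\<epsilon> \<noteq> 0" "\<epsilon>\<^sup>2 \<le> 1 / 10000"
begin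

abbreviation G :: "real^2 \<Rightarrow> real^2^2"
  where "G \<equiv> perturb g \<epsilon>"

lemma metric_G: "riemannian_metric G"
  by (rule riemannian_metric_perturb[OF metric])

lemma f_deriv: "r > 0 \<Longrightarrow> (f has_real_derivative deriv f r) (at r)"
proof -
  assume "r > 0"
  have "C_k_on (Suc 0) {0<..} f"
    using smooth_f by (auto simp: smooth_on_def)
  then have "f differentiable (at r)"
    using \<open>r > 0\<close> by simp
  then show ?thesis
    using DERIV_deriv_iff_real_differentiable by blast
qed

lemma deriv_f_continuous: "continuous_on {0<..} (deriv f)"
proof -
  have "C_k_on (Suc 0) {0<..} f"
    using smooth_f by (auto simp: smooth_on_def)
  then have "continuous_on {0<..} (\<lambda>r. frechet_derivative f (at r) 1)"
    by simp
  moreover have "frechet_derivative f (at r) 1 = deriv f r" if "r \<in> {0<..}" for r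
    using fun_cong[OF frechet_derivative_at[OF f_deriv[of r, unfolded has_field_derivative_def]], of 1] that
    by simp
  ultimately show ?thesis
    by (rule continuous_on_eq)
qed

lemma deriv_f_cos:
  assumes "0 < r" "r < 3 * pi / 4"
  shows "deriv f r = cos r"
proof -
  have "(f has_real_derivative cos r) (at r)"
    by (rule has_field_derivative_transform_within_open[OF DERIV_sin, where S = "{0<..<3 * pi / 4}"])
      (use assms f_sin in auto)
  then show ?thesis
    by (rule DERIV_imp_deriv)
qed

lemma G_inner:
  assumes "x \<noteq> 0"
  shows "v \<bullet> (G x *v w) = (x \<bullet> v) * (x \<bullet> w) / (x \<bullet> x)
    + (f (norm x))\<^sup>2 * (wedge x v * wedge x w) / (x \<bullet> x)\<^sup>2 + \<epsilon>\<^sup>2 * bump x * ((x \<bullet> v) * (x \<bullet> w))"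
  unfolding perturb_inner polar_form_inner[OF metric polar_form assms] ..

text \<open>In its Euler-Lagrange form the geodesic equation involves the metric only through the derivatives
  of its quadratic forms at fixed \<open>v\<close>.\<close>

lemma G_deriv:
  assumes "x \<noteq> 0"
  shows "v \<bullet> (frechet_derivative G (at x) h *v v) =
    2 * (x \<bullet> v) * (h \<bullet> v) / (x \<bullet> x) - 2 * (x \<bullet> v)\<^sup>2 * (x \<bullet> h) / (x \<bullet> x)\<^sup>2
    + 2 * f (norm x) * deriv f (norm x) * (x \<bullet> h) / norm x * (wedge x v)\<^sup>2 / (x \<bullet> x)\<^sup>2
    + 2 * (f (norm x))\<^sup>2 * wedge x v * wedge h v / (x \<bullet> x)\<^sup>2
    - 4 * (f (norm x))\<^sup>2 * (wedge x v)\<^sup>2 * (x \<bullet> h) / (x \<bullet> x) ^ 3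
    + \<epsilon>\<^sup>2 * (flat' (x $ 2) * cutoff (x \<bullet> x) * h $ 2 + 2 * flat (x $ 2) * cutoff' (x \<bullet> x) * (x \<bullet> h)) * (x \<bullet> v)\<^sup>2
    + 2 * \<epsilon>\<^sup>2 * bump x * (x \<bullet> v) * (h \<bullet> v)"
    (is "_ = ?R h")
proof -
  let ?Q = "\<lambda>x. (x \<bullet> v)\<^sup>2 / (x \<bullet> x) + (f (norm x))\<^sup>2 * (wedge x v)\<^sup>2 / (x \<bullet> x)\<^sup>2
    + \<epsilon>\<^sup>2 * bump x * (x \<bullet> v)\<^sup>2"
  have xx: "x \<bullet> x \<noteq> 0" and nx: "norm x \<noteq> 0" "norm x > 0"
    using assms by simp_all
  have "(norm has_derivative (\<lambda>h. (x \<bullet> h) / norm x)) (at x)"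
    using has_derivative_norm[OF assms] assms by (simp add: sgn_div_norm inner_commute divide_inverse mult.commute)
  from has_derivative_compose[OF this f_deriv[OF nx(2), unfolded has_field_derivative_def]]
  have f: "((\<lambda>x. f (norm x)) has_derivative (\<lambda>h. deriv f (norm x) * ((x \<bullet> h) / norm x))) (at x)" .
  have w: "((\<lambda>x. wedge x v) has_derivative (\<lambda>h. wedge h v)) (at x)"
    by (intro bounded_linear_imp_has_derivative linear_conv_bounded_linear[THEN iffD1] linearI)
      (simp_all add: wedge_def algebra_simps)
  have i: "((\<lambda>x. x \<bullet> v) has_derivative (\<lambda>h. h \<bullet> v)) (at x)"
    by (auto intro!: derivative_eq_intros)
  have n: "((\<lambda>x. x \<bullet> x) has_derivative (\<lambda>h. 2 * (x \<bullet> h))) (at x)"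
    by (auto intro!: derivative_eq_intros simp: inner_commute)
  have 1: "((\<lambda>x. (x \<bullet> v)\<^sup>2 / (x \<bullet> x)) has_derivative
      (\<lambda>h. 2 * (x \<bullet> v) * (h \<bullet> v) / (x \<bullet> x) - 2 * (x \<bullet> v)\<^sup>2 * (x \<bullet> h) / (x \<bullet> x)\<^sup>2)) (at x)"
    by (rule has_derivative_eq_rhs[OF has_derivative_divide[OF has_derivative_power[OF i] n xx]])
      (use xx in \<open>simp add: fun_eq_iff field_simps power2_eq_square\<close>)
  have "((\<lambda>x. (f (norm x) * wedge x v) / (x \<bullet> x)) has_derivative
      (\<lambda>h. deriv f (norm x) * (x \<bullet> h) / norm x * wedge x v / (x \<bullet> x) + f (norm x) * wedge h v / (x \<bullet> x)
        - 2 * f (norm x) * wedge x v * (x \<bullet> h) / (x \<bullet> x)\<^sup>2)) (at x)"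
    by (rule has_derivative_eq_rhs[OF has_derivative_divide[OF has_derivative_mult[OF f w] n xx]])
      (use xx nx(1) in \<open>simp add: fun_eq_iff field_simps power2_eq_square\<close>)
  note fw = has_derivative_power[OF this, of 2]
  have 2: "((\<lambda>x. (f (norm x))\<^sup>2 * (wedge x v)\<^sup>2 / (x \<bullet> x)\<^sup>2) has_derivative
      (\<lambda>h. 2 * f (norm x) * deriv f (norm x) * (x \<bullet> h) / norm x * (wedge x v)\<^sup>2 / (x \<bullet> x)\<^sup>2
        + 2 * (f (norm x))\<^sup>2 * wedge x v * wedge h v / (x \<bullet> x)\<^sup>2
        - 4 * (f (norm x))\<^sup>2 * (wedge x v)\<^sup>2 * (x \<bullet> h) / (x \<bullet> x) ^ 3)) (at x)"
  proof -
    have "2 * (F * W / q) * (F' * X / N * W / q + F * W' / q - 2 * F * W * X / q\<^sup>2) =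
        2 * F * F' * X / N * W\<^sup>2 / q\<^sup>2 + 2 * F\<^sup>2 * W * W' / q\<^sup>2 - 4 * F\<^sup>2 * W\<^sup>2 * X / q ^ 3"
      for F W q F' X N W' :: real
      by (simp add: divide_inverse power2_eq_square power3_eq_cube inverse_mult_distrib algebra_simps)
    note alg = this[of "f (norm x)" "wedge x v" "x \<bullet> x" "deriv f (norm x)" _ "norm x"]
    have "((\<lambda>x. (f (norm x) * wedge x v / (x \<bullet> x))\<^sup>2) has_derivative
      (\<lambda>h. 2 * (f (norm x) * wedge x v / (x \<bullet> x)) *
        (deriv f (norm x) * (x \<bullet> h) / norm x * wedge x v / (x \<bullet> x) + f (norm x) * wedge h v / (x \<bullet> x)
        - 2 * f (norm x) * wedge x v * (x \<bullet> h) / (x \<bullet> x)\<^sup>2))) (at x)"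
      by (rule has_derivative_eq_rhs[OF fw]) (simp add: fun_eq_iff mult_ac)
    then show ?thesis
      unfolding alg power_mult_distrib power_divide .
  qed
  have 3: "((\<lambda>x. \<epsilon>\<^sup>2 * bump x * (x \<bullet> v)\<^sup>2) has_derivative
      (\<lambda>h. \<epsilon>\<^sup>2 * (flat' (x $ 2) * cutoff (x \<bullet> x) * h $ 2 + 2 * flat (x $ 2) * cutoff' (x \<bullet> x) * (x \<bullet> h)) * (x \<bullet> v)\<^sup>2
        + 2 * \<epsilon>\<^sup>2 * bump x * (x \<bullet> v) * (h \<bullet> v))) (at x)"
    by (rule has_derivative_eq_rhs[OF has_derivative_mult[OF has_derivative_mult[OF has_derivative_const bump_has_derivative]
          has_derivative_power[OF i]]]) (simp add: fun_eq_iff algebra_simps)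
  define d1 d2 d3 where
    "d1 h = 2 * (x \<bullet> v) * (h \<bullet> v) / (x \<bullet> x) - 2 * (x \<bullet> v)\<^sup>2 * (x \<bullet> h) / (x \<bullet> x)\<^sup>2"
    and "d2 h = 2 * f (norm x) * deriv f (norm x) * (x \<bullet> h) / norm x * (wedge x v)\<^sup>2 / (x \<bullet> x)\<^sup>2
        + 2 * (f (norm x))\<^sup>2 * wedge x v * wedge h v / (x \<bullet> x)\<^sup>2
        - 4 * (f (norm x))\<^sup>2 * (wedge x v)\<^sup>2 * (x \<bullet> h) / (x \<bullet> x) ^ 3"
    and "d3 h = \<epsilon>\<^sup>2 * (flat' (x $ 2) * cutoff (x \<bullet> x) * h $ 2 + 2 * flat (x $ 2) * cutoff' (x \<bullet> x) * (x \<bullet> h)) * (x \<bullet> v)\<^sup>2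
        + 2 * \<epsilon>\<^sup>2 * bump x * (x \<bullet> v) * (h \<bullet> v)" for h
  note 1 = 1[folded d1_def] and 2 = 2[folded d2_def] and 3 = 3[folded d3_def]
  have "(?Q has_derivative ?R) (at x)"
  proof -
    have alg: "(A - B) + (C + D - E) + (P + Q) = A - B + C + D - E + P + Q" for A B C D E P Q :: real
      by simp
    have R: "d1 h + d2 h + d3 h = ?R h" for h
      unfolding d1_def d2_def d3_def by (rule alg)
    show ?thesis
      using has_derivative_add[OF has_derivative_add[OF 1 2] 3] unfolding R .
  qed
  then have "((\<lambda>x. v \<bullet> (G x *v v)) has_derivative ?R) (at x)"
  proof (rule has_derivative_transform_within_open)
    show "open (- {0 :: real^2})" "x \<in> - {0}"
      using assms by auto
    show "?Q y = v \<bullet> (G y *v v)" if "y \<in> - {0}" for y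
      using G_inner[of y v v] that by (simp add: power2_eq_square)
  qed
  from fun_cong[OF has_derivative_unique[OF metric_form_has_derivative[OF metric_G] this], of h]
  show ?thesis .
qed

end

locale unit_geodesic = perturbed_plane +
  fixes c c' c'' :: "real \<Rightarrow> real^2"
  assumes c_deriv: "\<And>t. (c has_vector_derivative c' t) (at t)"
    and c'_deriv: "\<And>t. (c' has_vector_derivative c'' t) (at t)"
    and geodesic_equation: "\<And>t w. w \<bullet> (G (c t) *v c'' t) =
      1/2 * (c' t \<bullet> (frechet_derivative G (at (c t)) w *v c' t))
      - c' t \<bullet> (frechet_derivative G (at (c t)) (c' t) *v w)"
    and unit_speed: "\<And>t. c' t \<bullet> (G (c t) *v c' t) = 1"
begin

text \<open>In polar coordinates \<open>c = r (cos \<theta>, sin \<theta>)\<close> the quantities below are \<open>w = r' / r\<close>, \<open>\<omega> = \<theta>'\<close>,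
  \<open>n1 = cos \<theta>\<close> and \<open>n2 = sin \<theta>\<close>. Working with \<open>n1\<close> and \<open>n2\<close> avoids the choice of a continuous angle
  along the curve. \<open>L\<close> is the angular momentum; it is defined also when \<open>c\<close> is at the origin.\<close>

definition r :: "real \<Rightarrow> real" where "r t = norm (c t)"
definition q :: "real \<Rightarrow> real" where "q t = c t \<bullet> c t"
definition w :: "real \<Rightarrow> real" where "w t = (c t \<bullet> c' t) / q t"
definition \<omega> :: "real \<Rightarrow> real" where "\<omega> t = wedge (c t) (c' t) / q t"
definition L :: "real \<Rightarrow> real" where "L t = rot (c t) \<bullet> (G (c t) *v c' t)"
definition n1 :: "real \<Rightarrow> real" where "n1 t = c t $ 1 / r t"
definition n2 :: "real \<Rightarrow> real" where "n2 t = c t $ 2 / r t"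

lemma q_eq: "q t = (r t)\<^sup>2"
  by (simp add: q_def r_def power2_norm_eq_inner)

lemma r_nonneg: "r t \<ge> 0" and r_pos_iff: "r t > 0 \<longleftrightarrow> c t \<noteq> 0" and q_pos: "r t > 0 \<Longrightarrow> q t > 0"
  by (simp_all add: r_def q_def)

lemma c_continuous: "continuous_on A c"
  using has_vector_derivative_continuous[OF c_deriv]
  by (simp add: continuous_at_imp_continuous_on)

lemma r_continuous: "continuous_on A r"
  unfolding r_def[abs_def] by (intro continuous_on_norm c_continuous)

lemma coord_deriv: "((\<lambda>t. c t $ i) has_real_derivative c' t $ i) (at t)"
  "((\<lambda>t. c' t $ i) has_real_derivative c'' t $ i) (at t)"
  using bounded_linear.has_vector_derivative[OF bounded_linear_vec_nth c_deriv]
    bounded_linear.has_vector_derivative[OF bounded_linear_vec_nth c'_deriv]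
  by (simp_all add: has_real_derivative_iff_has_vector_derivative)

lemma momentum:
  assumes "(W has_vector_derivative W') (at t)"
  shows "((\<lambda>t. W t \<bullet> (G (c t) *v c' t)) has_real_derivative
    W' \<bullet> (G (c t) *v c' t) + 1/2 * (c' t \<bullet> (frechet_derivative G (at (c t)) (W t) *v c' t))) (at t)"
  by (rule momentum_derivative[OF metric_G c_deriv c'_deriv geodesic_equation assms])

text \<open>Noether's identity for the rotation field: \<open>g\<close> is invariant and \<open>dr\<close> is invariant, so only the
  angular derivative of the bump contributes.\<close>

lemma L_deriv: "(L has_real_derivative \<epsilon>\<^sup>2 / 2 * bump_angular (c t) * (c t \<bullet> c' t)\<^sup>2) (at t)"
proof -
  have "((\<lambda>t. rot (c t)) has_vector_derivative rot (c' t)) (at t)"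
    using bounded_linear.has_vector_derivative[OF bounded_linear_rot c_deriv] .
  note D = momentum[OF this]
  have e: "rot (c' t) \<bullet> (G (c t) *v c' t) + 1/2 * (c' t \<bullet> (frechet_derivative G (at (c t)) (rot (c t)) *v c' t)) =
      \<epsilon>\<^sup>2 / 2 * bump_angular (c t) * (c t \<bullet> c' t)\<^sup>2"
  proof (cases "c t = 0")
    case True
    have "frechet_derivative G (at (c t)) 0 = 0"
      using has_derivative_linear[OF riemannian_metric_has_derivative[OF metric_G]] linear_0 by blast
    moreover have "rot (c' t) \<bullet> (G (c t) *v c' t) = 0"
      using polar_form_origin[OF metric polar_form, of "c' t"] True
        riemannian_metric_symmetric[OF metric_G, of "rot (c' t)" 0 "c' t"]
      by (simp add: perturb_inner)
    ultimately show ?thesis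
      using True by (simp add: bump_angular_def)
  next
    case False
    have o: "c t \<bullet> rot (c t) = 0"
      by (simp add: inner_2)
    have "rot (c' t) \<bullet> (G (c t) *v c' t) = (c t \<bullet> rot (c' t)) * (c t \<bullet> c' t) / (c t \<bullet> c t)
        + (f (norm (c t)))\<^sup>2 * (wedge (c t) (rot (c' t)) * wedge (c t) (c' t)) / (c t \<bullet> c t)\<^sup>2
        + \<epsilon>\<^sup>2 * bump (c t) * ((c t \<bullet> rot (c' t)) * (c t \<bullet> c' t))"
      by (rule G_inner[OF False])
    moreover have "c t \<bullet> rot (c' t) = - (rot (c t) \<bullet> c' t)"
      "wedge (c t) (rot (c' t)) = c t \<bullet> c' t" "wedge (rot (c t)) (c' t) = - (c t \<bullet> c' t)"
      by (simp_all add: inner_2 wedge_def)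
    ultimately show ?thesis
      unfolding G_deriv[OF False] o
      by (simp add: bump_angular_def field_simps power2_eq_square)
  qed
  show ?thesis
    using D unfolding e L_def[abs_def] .
qed

lemma L_eq: "r t > 0 \<Longrightarrow> L t = (f (r t))\<^sup>2 * \<omega> t"
proof -
  assume "r t > 0"
  then have "c t \<noteq> 0"
    by (simp add: r_pos_iff)
  have "c t \<bullet> rot (c t) = 0" "wedge (c t) (rot (c t)) = c t \<bullet> c t"
    by (simp_all add: inner_2 wedge_def)
  then show ?thesis
    using \<open>c t \<noteq> 0\<close> unfolding L_def G_inner[OF \<open>c t \<noteq> 0\<close>]
    by (simp add: r_def \<omega>_def q_def power2_eq_square)
qed

lemma radial_angular:
  assumes "r t > 0"
  shows "c t \<bullet> c' t = q t * w t" "wedge (c t) (c' t) = q t * \<omega> t"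
  using q_pos[OF assms] by (simp_all add: w_def \<omega>_def)

lemma energy:
  assumes "r t > 0"
  shows "(q t + \<epsilon>\<^sup>2 * bump (c t) * (q t)\<^sup>2) * (w t)\<^sup>2 + (f (r t))\<^sup>2 * (\<omega> t)\<^sup>2 = 1"
proof -
  have "c t \<noteq> 0"
    using assms by (simp add: r_pos_iff)
  then show ?thesis
    using unit_speed[of t] q_pos[OF assms]
    unfolding G_inner[OF \<open>c t \<noteq> 0\<close>] radial_angular[OF assms] q_def[symmetric] r_def[symmetric]
    by (simp add: field_simps power2_eq_square)
qed

lemma q_deriv: "r t > 0 \<Longrightarrow> (q has_real_derivative 2 * q t * w t) (at t)"
proof -
  assume "r t > 0"
  have "(q has_real_derivative 2 * (c t \<bullet> c' t)) (at t)"
    unfolding q_def[abs_def] inner_2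
    by (auto intro!: derivative_eq_intros coord_deriv)
  then show ?thesis
    using q_pos[OF \<open>r t > 0\<close>] by (simp add: w_def)
qed

lemma r_deriv: "r t > 0 \<Longrightarrow> (r has_real_derivative r t * w t) (at t)"
proof -
  assume "r t > 0"
  have e: "(\<lambda>t. sqrt (q t)) = r"
    by (simp add: fun_eq_iff q_eq r_nonneg)
  have "(r has_real_derivative inverse (sqrt (q t)) / 2 * (2 * q t * w t)) (at t)"
    using DERIV_chain2[OF DERIV_real_sqrt[OF q_pos] q_deriv] \<open>r t > 0\<close> unfolding e by blast
  moreover have "inverse (sqrt (q t)) / 2 * (2 * q t * w t) = r t * w t"
    using \<open>r t > 0\<close> by (simp add: q_eq power2_eq_square field_simps)
  ultimately show ?thesis
    by (simp only:)
qed

lemma n_deriv: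
  assumes "r t > 0"
  shows "(n1 has_real_derivative - \<omega> t * n2 t) (at t)" "(n2 has_real_derivative \<omega> t * n1 t) (at t)"
proof -
  have e: "q t = c t $ 1 * c t $ 1 + c t $ 2 * c t $ 2"
    by (simp add: q_def inner_2)
  have *: "c' t $ 1 - c t $ 1 * w t = - \<omega> t * c t $ 2" "c' t $ 2 - c t $ 2 * w t = \<omega> t * c t $ 1"
    using q_pos[OF assms] unfolding w_def \<omega>_def wedge_def inner_2
    by (simp_all add: field_simps) (simp_all add: e algebra_simps)
  have "(n1 has_real_derivative (c' t $ 1 - c t $ 1 * w t) / r t) (at t)"
    "(n2 has_real_derivative (c' t $ 2 - c t $ 2 * w t) / r t) (at t)"
    using assms unfolding n1_def[abs_def] n2_def[abs_def]
    by (auto intro!: derivative_eq_intros coord_deriv r_deriv simp: field_simps)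
  then show "(n1 has_real_derivative - \<omega> t * n2 t) (at t)" "(n2 has_real_derivative \<omega> t * n1 t) (at t)"
    unfolding * by (simp_all add: n1_def n2_def)
qed

text \<open>The Euler-Lagrange equation of the logarithmic radius, whose rate of change is \<open>w\<close>. It comes
  from the momentum in the direction of the dilation field, which is the inertia in the
  denominator times \<open>w\<close>; the inertia is differentiated along the curve and moved to the right.\<close>

lemma w_deriv:
  assumes "r t > 0"
  shows "(w has_real_derivative (- q t * (w t)\<^sup>2
      - \<epsilon>\<^sup>2 * (q t)\<^sup>2 * (bump_radial (c t) / 2 + 2 * bump (c t)) * (w t)\<^sup>2
      - \<epsilon>\<^sup>2 * (q t)\<^sup>2 * bump_angular (c t) * \<omega> t * w t
      + r t * f (r t) * deriv f (r t) * (\<omega> t)\<^sup>2)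
    / (q t + \<epsilon>\<^sup>2 * bump (c t) * (q t)\<^sup>2)) (at t)"
    (is "(w has_real_derivative ?N / ?A) _")
proof -
  have x: "c t \<noteq> 0" and q: "q t > 0"
    using assms by (simp_all add: r_pos_iff q_pos)
  have A: "?A > 0"
    using q bump_nonneg[of "c t"] by (intro add_pos_nonneg mult_nonneg_nonneg) auto
  define p where "p t = c t \<bullet> (G (c t) *v c' t)" for t
  define w2 where "w2 = (c' t \<bullet> c' t + c t \<bullet> c'' t) / q t - 2 * (w t)\<^sup>2"
  have w2: "(w has_real_derivative w2) (at t)"
  proof -
    have "((\<lambda>t. c t \<bullet> c' t) has_real_derivative c' t \<bullet> c' t + c t \<bullet> c'' t) (at t)"
      unfolding inner_2 by (auto intro!: derivative_eq_intros coord_deriv)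
    from DERIV_divide[OF this q_deriv[OF assms]] show ?thesis
      using q unfolding w_def[abs_def, symmetric] w2_def radial_angular[OF assms]
      by (auto elim!: DERIV_cong simp: divide_simps power2_eq_square algebra_simps)
  qed
  have bd0: "((\<lambda>t. bump (c t)) has_real_derivative
      flat' (c t $ 2) * cutoff (q t) * c' t $ 2 + 2 * flat (c t $ 2) * cutoff' (q t) * (c t \<bullet> c' t)) (at t)"
    using vector_derivative_diff_chain_within[OF c_deriv has_derivative_at_withinI[OF bump_has_derivative]]
    by (simp add: o_def has_real_derivative_iff_has_vector_derivative q_def)
  have b': "flat' (c t $ 2) * cutoff (q t) * c' t $ 2 + 2 * flat (c t $ 2) * cutoff' (q t) * (c t \<bullet> c' t) =
      bump_radial (c t) * w t + bump_angular (c t) * \<omega> t" (is "?b = _")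
  proof -
    have "c' t $ 2 = c t $ 2 * w t + \<omega> t * c t $ 1"
      using q unfolding w_def \<omega>_def wedge_def by (simp add: field_simps) (simp add: q_def inner_2 algebra_simps)
    moreover have "c t \<bullet> c' t = q t * w t"
      using q by (simp add: w_def)
    ultimately show ?thesis
      by (simp add: bump_radial_def bump_angular_def q_def algebra_simps)
  qed
  define bb where "bb = bump_radial (c t) * w t + bump_angular (c t) * \<omega> t"
  have bd: "((\<lambda>t. bump (c t)) has_real_derivative bb) (at t)"
    using bd0 unfolding b' bb_def .
  have "(p has_real_derivative 1 + 1/2 * (c' t \<bullet> (frechet_derivative G (at (c t)) (c t) *v c' t))) (at t)"
    using momentum[OF c_deriv[of t]] unfolding p_def[abs_def] unit_speed .
  moreover have "(p has_real_derivative 2 * q t * w t * w t + q t * w2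
      + \<epsilon>\<^sup>2 * (bump_radial (c t) * w t + bump_angular (c t) * \<omega> t) * (q t)\<^sup>2 * w t
      + \<epsilon>\<^sup>2 * bump (c t) * (4 * (q t)\<^sup>2 * (w t)\<^sup>2 + (q t)\<^sup>2 * w2)) (at t)"
  proof -
    have "((\<lambda>t. q t * w t + \<epsilon>\<^sup>2 * bump (c t) * (q t)\<^sup>2 * w t) has_real_derivative 2 * q t * w t * w t + q t * w2
      + \<epsilon>\<^sup>2 * (bump_radial (c t) * w t + bump_angular (c t) * \<omega> t) * (q t)\<^sup>2 * w t
      + \<epsilon>\<^sup>2 * bump (c t) * (4 * (q t)\<^sup>2 * (w t)\<^sup>2 + (q t)\<^sup>2 * w2)) (at t)"
    proof -
      have q2: "((\<lambda>t. (q t)\<^sup>2) has_real_derivative 4 * (q t)\<^sup>2 * w t) (at t)"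
        using DERIV_mult[OF q_deriv[OF assms] q_deriv[OF assms]]
        by (simp add: power2_eq_square mult_ac)
      show ?thesis
        using DERIV_add[OF DERIV_mult[OF q_deriv[OF assms] w2]
              DERIV_mult[OF DERIV_mult[OF DERIV_cmult[OF bd, of "\<epsilon>\<^sup>2"] q2] w2]]
        by (rule DERIV_cong) (unfold bb_def, algebra)
    qed
    moreover have "open (r -` {0<..})"
      using r_continuous by (intro open_vimage) auto
    moreover have "q s * w s + \<epsilon>\<^sup>2 * bump (c s) * (q s)\<^sup>2 * w s = p s" if "s \<in> r -` {0<..}" for s
    proof -
      have "c s \<noteq> 0"
        using that by (auto simp: r_pos_iff[symmetric])
      moreover have "wedge (c s) (c s) = 0"
        by (simp add: wedge_def)
      ultimately show ?thesis
        unfolding p_def G_inner[OF \<open>c s \<noteq> 0\<close>] w_def q_def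
        by (simp add: power2_eq_square)
    qed
    ultimately show ?thesis
      using assms has_field_derivative_transform_within_open[where S = "r -` {0<..}" and g = p] by blast
  qed
  ultimately have "2 * q t * w t * w t + q t * w2
      + \<epsilon>\<^sup>2 * (bump_radial (c t) * w t + bump_angular (c t) * \<omega> t) * (q t)\<^sup>2 * w t
      + \<epsilon>\<^sup>2 * bump (c t) * (4 * (q t)\<^sup>2 * (w t)\<^sup>2 + (q t)\<^sup>2 * w2) =
      1 + 1/2 * (c' t \<bullet> (frechet_derivative G (at (c t)) (c t) *v c' t))"
    by (rule DERIV_unique[symmetric])
  also have "1/2 * (c' t \<bullet> (frechet_derivative G (at (c t)) (c t) *v c' t)) =
      r t * f (r t) * deriv f (r t) * (\<omega> t)\<^sup>2 - (f (r t))\<^sup>2 * (\<omega> t)\<^sup>2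
      + \<epsilon>\<^sup>2 * bump_radial (c t) / 2 * (q t)\<^sup>2 * (w t)\<^sup>2 + \<epsilon>\<^sup>2 * bump (c t) * (q t)\<^sup>2 * (w t)\<^sup>2"
  proof -
    note m = radial_angular[OF assms]
    have n: "norm (c t) = r t"
      by (simp add: r_def)
    show ?thesis
      unfolding G_deriv[OF x] m n q_def[symmetric] bump_radial_def
      using assms q by (simp add: field_simps power2_eq_square power3_eq_cube) (simp add: q_eq algebra_simps power2_eq_square)
  qed
  also have "1 = (q t + \<epsilon>\<^sup>2 * bump (c t) * (q t)\<^sup>2) * (w t)\<^sup>2 + (f (r t))\<^sup>2 * (\<omega> t)\<^sup>2"
    using energy[OF assms] by simp
  finally have "w2 * ?A = ?N"
    by (simp add: algebra_simps power2_eq_square)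
  then have "w2 = ?N / ?A"
    using A by (simp add: field_simps)
  then show ?thesis
    using w2 by simp
qed

end

section \<open>Geodesics outside the hemisphere\<close>

context perturbed_plane
begin

lemma f_ge:
  assumes "pi / 2 \<le> \<rho>" "\<rho> \<le> 3 * pi / 4"
  shows "(f \<rho>)\<^sup>2 \<ge> 1 / 2"
proof -
  have s: "sqrt 2 / 2 \<le> sin x" if "pi / 2 \<le> x" "x \<le> 3 * pi / 4" for x
  proof -
    have "cos (pi / 4) \<le> cos (x - pi / 2)"
      using that pi_gt_zero by (intro cos_monotone_0_pi_le) linarith+
    then show ?thesis
      by (simp add: cos_45 cos_diff)
  qed
  have "sqrt 2 / 2 \<le> f \<rho>"
  proof (rule tendsto_lowerbound)
    show "(f \<longlongrightarrow> f \<rho>) (at_left \<rho>)"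
      using f_deriv[of \<rho>] assms(1) pi_gt_zero
      by (intro tendsto_within_subset[OF isContD[OF DERIV_isCont]]) auto
    have "\<forall>\<^sub>F x in at_left \<rho>. x \<in> {pi / 4<..<\<rho>}"
      using assms(1) pi_gt_zero by (intro eventually_at_left_real) linarith
    then show "\<forall>\<^sub>F x in at_left \<rho>. sqrt 2 / 2 \<le> f x"
    proof eventually_elim
      case (elim x)
      show ?case
      proof (cases "x < pi / 2")
        case True
        have "sin (pi / 4) \<le> sin x"
          using elim True pi_gt_zero by (intro sin_monotone_2pi_le) auto
        then show ?thesis
          using elim assms f_sin[of x] pi_gt_zero by (simp add: sin_45)
      next
        case False
        then show ?thesis
          using s[of x] elim assms f_sin[of x] pi_gt_zero by simp
      qed
    qed
  qed simp
  then have "(sqrt 2 / 2)\<^sup>2 \<le> (f \<rho>)\<^sup>2"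
    by (intro power_mono) auto
  then show ?thesis
    by (simp add: power_divide)
qed

lemma slope_on_support:
  assumes "2 * pi / 3 < \<rho>" "\<rho> < 3 * pi / 4"
  shows "\<rho> * f \<rho> * deriv f \<rho> \<le> - 1 / 2"
proof -
  have p: "pi > 3" "pi < 4"
    using pi_gt3 pi_less_4 by auto
  have "cos \<rho> \<le> cos (2 * pi / 3)"
    using assms p by (intro cos_monotone_0_pi_le) linarith+
  then have c: "cos \<rho> \<le> - 1 / 2"
    by (simp add: cos_120)
  have "sin (pi / 6) \<le> sin (pi - \<rho>)"
    using assms p by (intro sin_monotone_2pi_le) linarith+
  then have "1 / 2 \<le> sin \<rho>"
    by (simp add: sin_30)
  then have "1 \<le> \<rho> * sin \<rho>"
    using mult_mono[of 2 \<rho> "1/2" "sin \<rho>"] assms p by simp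
  then have "1 * (1 / 2) \<le> (\<rho> * sin \<rho>) * (- cos \<rho>)"
    using c by (intro mult_mono) auto
  moreover have "f \<rho> = sin \<rho>" "deriv f \<rho> = cos \<rho>"
    using assms p f_sin deriv_f_cos by auto
  ultimately show ?thesis
    by simp
qed

lemma slope_nonpos:
  assumes "pi / 2 \<le> \<rho>"
  shows "\<rho> * f \<rho> * deriv f \<rho> \<le> 0"
proof (cases "\<rho> = pi / 2")
  case True
  then show ?thesis
    unfolding True using deriv_f_cos[of "pi / 2"] pi_gt_zero by simp
next
  case False
  then show ?thesis
  proof -
    have "\<rho> > 0"
      using assms pi_gt_zero by linarith
    then show ?thesis
      using False assms deriv_f_neg[of \<rho>] f_pos[of \<rho>]
      by (intro mult_nonneg_nonpos mult_nonneg_nonneg) auto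
  qed
qed

end

context unit_geodesic
begin

lemma bump_vanishes:
  assumes "r t \<le> 2 * pi / 3 \<or> r t \<ge> 3 * pi / 4"
  shows "bump (c t) = 0" "bump_angular (c t) = 0" "bump_radial (c t) = 0"
proof -
  have "c t \<bullet> c t \<le> (2 * pi / 3)\<^sup>2 \<or> c t \<bullet> c t \<ge> (3 * pi / 4)\<^sup>2"
    using assms r_nonneg[of t] pi_gt_zero unfolding q_def[symmetric] q_eq
    by (auto intro: power_mono)
  from bump_eq_0[OF this]
  show "bump (c t) = 0" "bump_angular (c t) = 0" "bump_radial (c t) = 0" .
qed

lemma n_eq: "c t $ 1 = r t * n1 t" "c t $ 2 = r t * n2 t"
  using r_pos_iff[of t] r_nonneg[of t] by (cases "r t = 0"; simp add: n1_def n2_def r_def)+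

lemma n_unit:
  assumes "r t > 0"
  shows "(n1 t)\<^sup>2 + (n2 t)\<^sup>2 = 1" "\<bar>n1 t\<bar> \<le> 1" "\<bar>n2 t\<bar> \<le> 1"
proof -
  show 1: "(n1 t)\<^sup>2 + (n2 t)\<^sup>2 = 1"
  proof -
    have "(r t)\<^sup>2 * ((n1 t)\<^sup>2 + (n2 t)\<^sup>2) = (r t)\<^sup>2 * 1"
      using norm_2[of "c t"] unfolding n_eq r_def[symmetric] by (simp add: power_mult_distrib distrib_left)
    then show ?thesis
      using assms by simp
  qed
  then have "(n1 t)\<^sup>2 \<le> 1" "(n2 t)\<^sup>2 \<le> 1"
    using zero_le_power2[of "n1 t"] zero_le_power2[of "n2 t"] by linarith+
  then show "\<bar>n1 t\<bar> \<le> 1" "\<bar>n2 t\<bar> \<le> 1"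
    by (simp_all add: abs_square_le_1)
qed

lemma perturbed_inertia: "r t > 0 \<Longrightarrow> q t \<le> q t + \<epsilon>\<^sup>2 * bump (c t) * (q t)\<^sup>2"
  and perturbed_inertia_le: "r t > 0 \<Longrightarrow> q t + \<epsilon>\<^sup>2 * bump (c t) * (q t)\<^sup>2 \<le> 2 * q t"
proof -
  assume "r t > 0"
  then have q: "q t > 0"
    by (rule q_pos)
  show "q t \<le> q t + \<epsilon>\<^sup>2 * bump (c t) * (q t)\<^sup>2"
    using bump_nonneg by simp
  show "q t + \<epsilon>\<^sup>2 * bump (c t) * (q t)\<^sup>2 \<le> 2 * q t"
  proof (cases "r t \<le> 2 * pi / 3 \<or> r t \<ge> 3 * pi / 4")
    case True
    then show ?thesis
      using bump_vanishes[OF True] q by simp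
  next
    case False
    then have "r t \<le> 3"
      using pi_less_4 by auto
    then have "q t \<le> 3\<^sup>2"
      unfolding q_eq using r_nonneg[of t] by (intro power_mono) auto
    moreover have "\<epsilon>\<^sup>2 * bump (c t) \<le> 1 / 10000 * 1"
      using \<epsilon> bump_le_1 bump_nonneg by (intro mult_mono) auto
    ultimately have "\<epsilon>\<^sup>2 * bump (c t) * q t \<le> 1 / 10000 * 9"
      using q by (intro mult_mono) auto
    then have "\<epsilon>\<^sup>2 * bump (c t) * q t * q t \<le> 1 * q t"
      using q by (intro mult_right_mono) auto
    then show ?thesis
      by (simp add: power2_eq_square)
  qed
qed

lemma w_le: "r t > 0 \<Longrightarrow> q t * (w t)\<^sup>2 \<le> 1"
  and \<omega>_le: "r t > 0 \<Longrightarrow> (f (r t))\<^sup>2 * (\<omega> t)\<^sup>2 \<le> 1"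
proof -
  assume r: "r t > 0"
  have "q t * (w t)\<^sup>2 \<le> (q t + \<epsilon>\<^sup>2 * bump (c t) * (q t)\<^sup>2) * (w t)\<^sup>2"
    by (intro mult_right_mono perturbed_inertia[OF r]) simp
  moreover have "0 \<le> (f (r t))\<^sup>2 * (\<omega> t)\<^sup>2" "0 \<le> q t * (w t)\<^sup>2"
    using q_pos[OF r] by simp_all
  ultimately show "q t * (w t)\<^sup>2 \<le> 1" "(f (r t))\<^sup>2 * (\<omega> t)\<^sup>2 \<le> 1"
    using energy[OF r] by linarith+
qed

text \<open>Outside the hemisphere the logarithmic radius is concave along every geodesic. For \<open>g\<close> this
  is immediate from \<open>f' \<le> 0\<close>; the logarithm makes the concavity uniform in all directions over the
  support of the perturbation, which therefore cannot destroy it.\<close>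

lemma concavity:
  assumes "r t \<ge> pi / 2"
  obtains a where "(w has_real_derivative a) (at t)"
    and "a \<le> - (q t * (w t)\<^sup>2 - r t * f (r t) * deriv f (r t) * (\<omega> t)\<^sup>2) / (4 * q t)"
proof -
  have r: "r t > 0"
    using assms pi_gt_zero by linarith
  have q: "q t > 0"
    by (rule q_pos[OF r])
  define s where "s = r t * f (r t) * deriv f (r t)"
  have s: "s \<le> 0"
    using slope_nonpos[OF assms] by (simp add: s_def)
  define X where "X = q t * (w t)\<^sup>2 - s * (\<omega> t)\<^sup>2"
  have X: "X \<ge> 0"
    using q s unfolding X_def by (simp add: mult_nonpos_nonneg order_trans[of _ 0])
  define A where "A = q t + \<epsilon>\<^sup>2 * bump (c t) * (q t)\<^sup>2"
  have A: "A > 0" "A \<le> 2 * q t"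
    using perturbed_inertia[OF r] perturbed_inertia_le[OF r] q by (auto simp: A_def)
  define N where "N = - q t * (w t)\<^sup>2
      - \<epsilon>\<^sup>2 * (q t)\<^sup>2 * (bump_radial (c t) / 2 + 2 * bump (c t)) * (w t)\<^sup>2
      - \<epsilon>\<^sup>2 * (q t)\<^sup>2 * bump_angular (c t) * \<omega> t * w t + s * (\<omega> t)\<^sup>2"
  have N: "N \<le> - X / 2"
  proof (cases "r t \<le> 2 * pi / 3 \<or> r t \<ge> 3 * pi / 4")
    case True
    then show ?thesis
      using bump_vanishes[OF True] X by (simp add: N_def X_def)
  next
    case False
    have p: "pi > 3" "pi < 4"
      using pi_gt3 pi_less_4 by auto
    have r3: "2 \<le> r t" "r t \<le> 3"
      using False p by linarith+
    have q9: "2\<^sup>2 \<le> q t" "q t \<le> 3\<^sup>2"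
      unfolding q_eq using power_mono[of 2 "r t" 2] power_mono[of "r t" 3 2] r3 by auto
    define k where "k = \<epsilon>\<^sup>2 * (q t)\<^sup>2"
    have "k \<le> 1 / 10000 * (3\<^sup>2)\<^sup>2"
      unfolding k_def using \<epsilon> q9 by (intro mult_mono power_mono) auto
    then have k: "0 \<le> k" "k \<le> 1 / 100"
      by (auto simp: k_def)
    have c: "\<bar>c t $ 1\<bar> \<le> 3" "\<bar>c t $ 2\<bar> \<le> 3"
      using component_le_norm_cart[of "c t" 1] component_le_norm_cart[of "c t" 2] r3 by (auto simp: r_def)
    have fc: "0 \<le> flat' y * cutoff z" "flat' y * cutoff z \<le> 1" for y z
      using flat'_nonneg[of y] cutoff_nonneg[of z] flat'_le_1[of y] cutoff_le_1[of z] by (auto simp: mult_le_one)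
    have ba: "\<bar>bump_angular (c t)\<bar> \<le> 3"
      using mult_mono[OF fc(2) c(1), of "c t $ 2" "c t \<bullet> c t"] fc(1)
      by (simp add: bump_angular_def abs_mult abs_of_nonneg flat'_nonneg cutoff_nonneg)
    have "\<bar>flat' (c t $ 2) * cutoff (c t \<bullet> c t) * c t $ 2\<bar> \<le> 1 * 3"
      using mult_mono[OF fc(2) c(2), of "c t $ 2" "c t \<bullet> c t"] fc(1)
      by (simp add: abs_mult abs_of_nonneg flat'_nonneg cutoff_nonneg)
    moreover have "\<bar>flat (c t $ 2) * cutoff' (c t \<bullet> c t) * (c t \<bullet> c t)\<bar> \<le> 1 * 1 * 9"
      unfolding abs_mult q_def[symmetric] using q9 q flat_nonneg[of "c t $ 2"] flat_le_1[of "c t $ 2"]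
      by (intro mult_mono abs_cutoff'_le_1) auto
    ultimately have "\<bar>bump_radial (c t)\<bar> \<le> 21"
      unfolding bump_radial_def by linarith
    then have "- (bump_radial (c t) / 2 + 2 * bump (c t)) \<le> 11"
      using bump_nonneg[of "c t"] by linarith
    then have "- (bump_radial (c t) / 2 + 2 * bump (c t)) * k \<le> 11 * k"
      using k by (intro mult_right_mono)
    then have "- k * (bump_radial (c t) / 2 + 2 * bump (c t)) \<le> 11 / 100"
      using k by (simp only: mult_minus_left mult.commute[of k])
    then have 1: "- k * (bump_radial (c t) / 2 + 2 * bump (c t)) * (w t)\<^sup>2 \<le> 11 / 100 * (w t)\<^sup>2"
      by (intro mult_right_mono) auto
    have "\<bar>k * bump_angular (c t)\<bar> \<le> 1 / 100 * 3"
      unfolding abs_mult using k ba by (intro mult_mono) auto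
    then have "\<bar>k * bump_angular (c t) * (\<omega> t * w t)\<bar> \<le> 3 / 100 * \<bar>\<omega> t * w t\<bar>"
      unfolding abs_mult[of _ "\<omega> t * w t"] by (intro mult_right_mono) auto
    moreover have "2 * \<bar>\<omega> t * w t\<bar> \<le> (\<omega> t)\<^sup>2 + (w t)\<^sup>2"
      using zero_le_power2[of "\<bar>\<omega> t\<bar> - \<bar>w t\<bar>"] by (simp add: power2_diff abs_mult)
    ultimately have 2: "- k * bump_angular (c t) * \<omega> t * w t \<le> 3 / 200 * ((\<omega> t)\<^sup>2 + (w t)\<^sup>2)"
      by (simp add: mult.assoc)
    have 3: "4 * (w t)\<^sup>2 \<le> q t * (w t)\<^sup>2"
      using q9 by (intro mult_right_mono) auto
    have "s \<le> - 1 / 2"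
      using slope_on_support[of "r t"] False by (simp add: s_def)
    then have 4: "s * (\<omega> t)\<^sup>2 \<le> - 1 / 2 * (\<omega> t)\<^sup>2"
      by (intro mult_right_mono) auto
    have "N = - q t * (w t)\<^sup>2 + - k * (bump_radial (c t) / 2 + 2 * bump (c t)) * (w t)\<^sup>2
      + - k * bump_angular (c t) * \<omega> t * w t + s * (\<omega> t)\<^sup>2"
      by (simp add: N_def k_def)
    then show ?thesis
      using 1 2 3 4 zero_le_power2[of "w t"] zero_le_power2[of "\<omega> t"] unfolding X_def by argo
  qed
  have "N / A \<le> - X / (4 * q t)"
  proof -
    have "N / A \<le> (- X / 2) / A"
      using N A by (intro divide_right_mono) auto
    also have "\<dots> \<le> (- X / 2) / (2 * q t)"
      using A X q by (intro divide_left_mono_neg) auto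
    finally show ?thesis
      by simp
  qed
  moreover have "(w has_real_derivative N / A) (at t)"
    using w_deriv[OF r] unfolding N_def A_def s_def .
  ultimately show ?thesis
    using that unfolding X_def s_def by blast
qed

lemma log_radius_deriv: "r t > 0 \<Longrightarrow> ((\<lambda>t. ln (r t)) has_real_derivative w t) (at t)"
  by (rule DERIV_cong[OF DERIV_chain2[OF DERIV_ln r_deriv]]) auto

lemma w_nonincreasing:
  assumes "\<And>u. s \<le> u \<Longrightarrow> u \<le> t \<Longrightarrow> r u \<ge> pi / 2" "s \<le> t"
  shows "w t \<le> w s"
proof (rule DERIV_nonpos_imp_nonincreasing[OF assms(2)])
  fix u assume u: "s \<le> u" "u \<le> t"
  obtain a where a: "(w has_real_derivative a) (at u)"
    "a \<le> - (q u * (w u)\<^sup>2 - r u * f (r u) * deriv f (r u) * (\<omega> u)\<^sup>2) / (4 * q u)"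
    using concavity[OF assms(1)[OF u]] .
  have "r u > 0"
    using assms(1)[OF u] pi_gt_zero by linarith
  then have "q u > 0"
    by (rule q_pos)
  then have "q u * (w u)\<^sup>2 - r u * f (r u) * deriv f (r u) * (\<omega> u)\<^sup>2 \<ge> 0"
    using slope_nonpos[OF assms(1)[OF u]] by (simp add: mult_nonpos_nonneg order_trans[of _ 0])
  then have "a \<le> 0"
    using a(2) \<open>q u > 0\<close> by (intro order_trans[OF a(2)]) (simp add: divide_nonpos_pos)
  then show "\<exists>y. (w has_real_derivative y) (at u) \<and> y \<le> 0"
    using a(1) by blast
qed

lemma log_radius_le:
  assumes "\<And>u. s \<le> u \<Longrightarrow> u \<le> t \<Longrightarrow> r u > 0 \<and> w u \<le> b" "s \<le> t"
  shows "ln (r t) \<le> ln (r s) + b * (t - s)"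
proof -
  have "ln (r t) - b * t \<le> ln (r s) - b * s"
  proof (rule DERIV_nonpos_imp_nonincreasing[OF assms(2)])
    fix u assume u: "s \<le> u" "u \<le> t"
    have "((\<lambda>t. ln (r t) - b * t) has_real_derivative w u - b) (at u)"
      using DERIV_diff[OF log_radius_deriv DERIV_cmult[OF DERIV_ident, of b]] assms(1)[OF u] by simp
    then show "\<exists>y. ((\<lambda>t. ln (r t) - b * t) has_real_derivative y) (at u) \<and> y \<le> 0"
      using assms(1)[OF u] by auto
  qed
  then show ?thesis
    by (simp add: algebra_simps)
qed

lemma log_radius_ge:
  assumes "\<And>u. s \<le> u \<Longrightarrow> u \<le> t \<Longrightarrow> r u > 0 \<and> w u \<ge> b" "s \<le> t"
  shows "ln (r t) \<ge> ln (r s) + b * (t - s)"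
proof -
  have "ln (r t) - b * t \<ge> ln (r s) - b * s"
  proof (rule DERIV_nonneg_imp_nondecreasing[OF assms(2)])
    fix u assume u: "s \<le> u" "u \<le> t"
    have "((\<lambda>t. ln (r t) - b * t) has_real_derivative w u - b) (at u)"
      using DERIV_diff[OF log_radius_deriv DERIV_cmult[OF DERIV_ident, of b]] assms(1)[OF u] by simp
    then show "\<exists>y. ((\<lambda>t. ln (r t) - b * t) has_real_derivative y) (at u) \<and> y \<ge> 0"
      using assms(1)[OF u] by auto
  qed
  then show ?thesis
    by (simp add: algebra_simps)
qed

end

section \<open>Geodesics that never return to the hemisphere\<close>

locale outgoing = unit_geodesic +
  fixes t0 :: real
  assumes outside: "\<And>t. t0 \<le> t \<Longrightarrow> r t \<ge> pi / 2"
begin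

lemma r_pos: "t0 \<le> t \<Longrightarrow> r t > 0"
  using outside[of t] pi_gt_zero by linarith

lemma w_antimono: "t0 \<le> s \<Longrightarrow> s \<le> t \<Longrightarrow> w t \<le> w s"
  by (rule w_nonincreasing) (use outside in auto)

text \<open>A concave function that is bounded below on a half line is nondecreasing.\<close>

lemma w_nonneg:
  assumes "t0 \<le> s"
  shows "w s \<ge> 0"
proof (rule ccontr)
  assume "\<not> w s \<ge> 0"
  define T where "T = (ln (r s) - ln (pi / 2) + 1) / - w s"
  have "ln (pi / 2) \<le> ln (r s)"
    by (rule iffD2[OF ln_le_cancel_iff[OF pi_half_gt_zero r_pos[OF assms]] outside[OF assms]])
  then have "T \<ge> 0"
    using \<open>\<not> w s \<ge> 0\<close> unfolding T_def by (intro divide_nonneg_pos) linarith+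
  have "ln (r (s + T)) \<le> ln (r s) + w s * (s + T - s)"
    using assms \<open>T \<ge> 0\<close> r_pos w_antimono by (intro log_radius_le) auto
  also have "w s * (s + T - s) = - (ln (r s) - ln (pi / 2) + 1)"
    using \<open>\<not> w s \<ge> 0\<close> by (simp add: T_def)
  finally have "ln (r (s + T)) < ln (pi / 2)"
    by simp
  moreover have "ln (pi / 2) \<le> ln (r (s + T))"
  proof -
    have "t0 \<le> s + T"
      using assms \<open>T \<ge> 0\<close> by simp
    from iffD2[OF ln_le_cancel_iff[OF pi_half_gt_zero r_pos[OF this]] outside[OF this]]
    show ?thesis .
  qed
  ultimately show False
    by simp
qed

lemma r_mono:
  assumes "t0 \<le> s" "s \<le> t"
  shows "r s \<le> r t"
proof (rule DERIV_nonneg_imp_nondecreasing[OF assms(2)])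
  fix u assume "s \<le> u" "u \<le> t"
  then show "\<exists>y. (r has_real_derivative y) (at u) \<and> 0 \<le> y"
    using r_deriv[OF r_pos, of u] w_nonneg[of u] r_pos[of u] assms
    by (intro exI[of _ "r u * w u"]) (auto intro: mult_nonneg_nonneg)
qed

text \<open>In a bounded annulus away from the equator the concavity is uniform, so \<open>w\<close> would become
  negative there.\<close>

lemma unbounded:
  assumes "t0 \<le> s" "r s > pi / 2"
  obtains t where "s \<le> t" "r t > R"
proof (rule ccontr)
  assume "\<not> thesis"
  then have R: "r t \<le> R" if "s \<le> t" for t
    using that \<open>\<And>t. s \<le> t \<Longrightarrow> r t > R \<Longrightarrow> thesis\<close> by force
  have rs: "r s \<le> r t" if "s \<le> t" for t
    using r_mono assms(1) that by simp
  have "r s > 0"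
    using r_pos assms by simp
  define h where "h \<rho> = - (\<rho> * deriv f \<rho> / f \<rho>)" for \<rho>
  have "continuous_on {r s..R} f"
    using f_deriv \<open>r s > 0\<close> by (intro DERIV_continuous_on[of _ _ "deriv f"]) (auto intro: has_field_derivative_at_within)
  moreover have "f \<rho> \<noteq> 0" if "\<rho> \<in> {r s..R}" for \<rho>
    using f_pos[of \<rho>] that \<open>r s > 0\<close> by auto
  moreover have "continuous_on {r s..R} (deriv f)"
    using \<open>r s > 0\<close> by (intro continuous_on_subset[OF deriv_f_continuous]) auto
  ultimately have "continuous_on {r s..R} h"
    unfolding h_def by (intro continuous_intros) auto
  then obtain \<rho>0 where \<rho>0: "\<rho>0 \<in> {r s..R}" "\<And>\<rho>. \<rho> \<in> {r s..R} \<Longrightarrow> h \<rho>0 \<le> h \<rho>"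
    using continuous_attains_inf[of "{r s..R}" h] R[of s] by auto
  have "h \<rho>0 > 0"
    using \<rho>0(1) \<open>r s > 0\<close> deriv_f_neg[of \<rho>0] f_pos[of \<rho>0] assms(2) unfolding h_def
    by (simp add: mult_pos_neg divide_neg_pos)
  define \<kappa> where "\<kappa> = min (1 / 2) (h \<rho>0)"
  have \<kappa>: "\<kappa> > 0" "\<kappa> \<le> 1 / 2" "\<kappa> \<le> h \<rho>0"
    using \<open>h \<rho>0 > 0\<close> by (auto simp: \<kappa>_def)
  have "R > 0"
    using R[of s] \<open>r s > 0\<close> by simp
  define k where "k = \<kappa> / (4 * R\<^sup>2)"
  have "k > 0"
    using \<kappa> \<open>R > 0\<close> by (simp add: k_def)
  \<comment> \<open>On a compact annulus the acceleration of the logarithmic radius is bounded away from zero.\<close>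
  have decay: "\<exists>a. (w has_real_derivative a) (at t) \<and> a \<le> - k" if "s \<le> t" for t
  proof -
    have rt: "r t \<in> {r s..R}" "r t > 0"
      using rs R that r_pos assms by auto
    have q: "q t > 0" "q t \<le> R\<^sup>2"
      using q_pos[OF rt(2)] rt by (auto simp: q_eq intro: power_mono)
    have "t0 \<le> t"
      using assms that by simp
    obtain a where a: "(w has_real_derivative a) (at t)"
      "a \<le> - (q t * (w t)\<^sup>2 - r t * f (r t) * deriv f (r t) * (\<omega> t)\<^sup>2) / (4 * q t)"
      by (rule concavity[OF outside[OF \<open>t0 \<le> t\<close>]])
    have "f (r t) > 0"
      using f_pos rt by simp
    then have e: "r t * f (r t) * deriv f (r t) = - h (r t) * (f (r t))\<^sup>2"
      by (simp add: h_def power2_eq_square)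
    have "1 \<le> 2 * q t * (w t)\<^sup>2 + (f (r t))\<^sup>2 * (\<omega> t)\<^sup>2"
      using energy[OF rt(2)] mult_right_mono[OF perturbed_inertia_le[OF rt(2)], of "(w t)\<^sup>2"] by simp
    then have "\<kappa> * 1 \<le> \<kappa> * (2 * q t * (w t)\<^sup>2 + (f (r t))\<^sup>2 * (\<omega> t)\<^sup>2)"
      using \<kappa> by (intro mult_left_mono) auto
    also have "\<dots> = \<kappa> * (2 * q t * (w t)\<^sup>2) + \<kappa> * ((f (r t))\<^sup>2 * (\<omega> t)\<^sup>2)"
      by (rule distrib_left)
    also have "\<dots> \<le> 1 / 2 * (2 * q t * (w t)\<^sup>2) + h (r t) * ((f (r t))\<^sup>2 * (\<omega> t)\<^sup>2)"
      using \<kappa> \<rho>0(2)[OF rt(1)] q by (intro add_mono mult_right_mono) auto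
    finally have X: "\<kappa> \<le> q t * (w t)\<^sup>2 - r t * f (r t) * deriv f (r t) * (\<omega> t)\<^sup>2"
      unfolding e by simp
    have "k \<le> \<kappa> / (4 * q t)"
      unfolding k_def using q \<kappa> \<open>R > 0\<close> by (intro divide_left_mono) auto
    also have "\<dots> \<le> (q t * (w t)\<^sup>2 - r t * f (r t) * deriv f (r t) * (\<omega> t)\<^sup>2) / (4 * q t)"
      using X q by (intro divide_right_mono) auto
    finally have "a \<le> - k"
      using a(2) unfolding minus_divide_left[symmetric] by linarith
    then show ?thesis
      using a(1) by blast
  qed
  define T where "T = (w s + 1) / k"
  have "T \<ge> 0"
    using w_nonneg[OF assms(1)] \<open>k > 0\<close> by (simp add: T_def)
  have "w (s + T) + k * (s + T) \<le> w s + k * s"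
  proof (rule DERIV_nonpos_imp_nonincreasing[where f = "\<lambda>t. w t + k * t"])
    fix u assume "s \<le> u" "u \<le> s + T"
    then obtain a where "(w has_real_derivative a) (at u)" "a \<le> - k"
      using decay by blast
    then show "\<exists>y. ((\<lambda>t. w t + k * t) has_real_derivative y) (at u) \<and> y \<le> 0"
      using DERIV_add[OF _ DERIV_cmult[OF DERIV_ident, of k]] by (intro exI[of _ "a + k"]) auto
  qed (use \<open>T \<ge> 0\<close> in simp)
  moreover have "k * T = w s + 1"
    using \<open>k > 0\<close> by (simp add: T_def)
  ultimately have "w (s + T) < 0"
    by (simp add: distrib_left)
  moreover have "w (s + T) \<ge> 0"
    using w_nonneg assms \<open>T \<ge> 0\<close> by simp
  ultimately show False
    by simp
qed

end

text \<open>A geodesic that leaves the hemisphere for good and is not the equator.\<close>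

locale escaping = outgoing +
  assumes start: "r t0 = pi / 2"
    and leaves: "\<exists>s\<ge>t0. r s > pi / 2"
begin

text \<open>The time at which the geodesic leaves the support of the perturbation for good.\<close>

definition t1 :: real
  where "t1 = (SOME t. t0 \<le> t \<and> r t = 3 * pi / 4)"

lemma t1: "t0 \<le> t1" "r t1 = 3 * pi / 4"
proof -
  obtain s where s: "t0 \<le> s" "r s > pi / 2"
    using leaves by auto
  obtain t where t: "s \<le> t" "r t > 3 * pi / 4"
    using unbounded[OF s] by blast
  have "r t0 \<le> 3 * pi / 4"
    using start pi_gt_zero by linarith
  then have "\<exists>x. t0 \<le> x \<and> x \<le> t \<and> r x = 3 * pi / 4"
    using t s by (intro IVT' r_continuous) auto
  then have "\<exists>x. t0 \<le> x \<and> r x = 3 * pi / 4"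
    by blast
  from someI_ex[OF this] show "t0 \<le> t1" "r t1 = 3 * pi / 4"
    unfolding t1_def by auto
qed

lemma r_beyond: "t1 \<le> t \<Longrightarrow> r t \<ge> 3 * pi / 4"
  using r_mono[of t1 t] t1 by simp

lemma r_between: "t0 \<le> t \<Longrightarrow> t \<le> t1 \<Longrightarrow> r t \<le> 3 * pi / 4"
  using r_mono[of t t1] t1 by simp

text \<open>Clairaut's relation: beyond the perturbation \<open>L\<close> is constant, and \<open>\<bar>L\<bar> \<le> f(r)\<close> by unit speed, while
  the radius tends to infinity.\<close>

lemma L_beyond:
  assumes "t1 \<le> t"
  shows "L t = 0"
proof (rule ccontr)
  assume "L t \<noteq> 0"
  have const: "L u = L t" if "t \<le> u" for u
  proof -
    have "(L has_real_derivative 0) (at v)" if "t \<le> v" for v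
      using L_deriv[of v] bump_vanishes(2)[of v] r_beyond[of v] that assms by simp
    then show ?thesis
      using DERIV_isconst3 that by (metis DERIV_isconst_end DERIV_isCont continuous_at_imp_continuous_on atLeastAtMost_iff le_less)
  qed
  have "\<forall>\<^sub>F x in at_top. f x < \<bar>L t\<bar>"
    using f_tendsto_0 \<open>L t \<noteq> 0\<close> by (intro order_tendstoD(2)) auto
  then obtain R where R: "\<And>x. x \<ge> R \<Longrightarrow> f x < \<bar>L t\<bar>"
    by (auto simp: eventually_at_top_linorder)
  have "r t > pi / 2"
    using r_beyond[OF assms] pi_gt_zero by linarith
  then obtain u where u: "t \<le> u" "r u > R"
    using unbounded[of t R] assms t1 by auto
  have ru: "r u > 0"
    using r_pos u assms t1 by simp
  have "(L u)\<^sup>2 = (f (r u))\<^sup>2 * ((f (r u))\<^sup>2 * (\<omega> u)\<^sup>2)"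
    unfolding L_eq[OF ru] by (simp add: power2_eq_square)
  also have "\<dots> \<le> (f (r u))\<^sup>2 * 1"
    using \<omega>_le[OF ru] by (intro mult_left_mono) auto
  finally have "\<bar>L u\<bar> \<le> f (r u)"
    using f_pos[OF ru] by (simp add: abs_le_square_iff[of "L u" "f (r u)", symmetric])
  then show False
    using R[of "r u"] u const[OF u(1)] by simp
qed

text \<open>At \<open>t1\<close> the geodesic moves radially with unit speed, and by concavity \<open>w\<close> was not smaller
  before. This bounds the time spent between the equator and \<open>t1\<close>.\<close>

lemma w_crossing:
  assumes "t0 \<le> t" "t \<le> t1"
  shows "w t \<ge> 1 / 3"
proof -
  have r: "r t1 > 0"
    using t1 r_pos by simp
  have "\<omega> t1 = 0"
    using L_eq[OF r] L_beyond[of t1] f_pos[OF r] by simp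
  moreover have "bump (c t1) = 0"
    using bump_vanishes(1)[of t1] t1 by simp
  ultimately have "(r t1 * w t1)\<^sup>2 = 1\<^sup>2"
    using energy[OF r] by (simp add: q_eq power_mult_distrib)
  moreover have "r t1 * w t1 \<ge> 0"
    using w_nonneg[OF t1(1)] r by simp
  ultimately have "r t1 * w t1 = 1"
    using power2_eq_imp_eq zero_le_one by blast
  then have "w t1 = 4 / (3 * pi)"
    using pi_gt_zero t1 by (simp add: field_simps)
  moreover have "4 / (3 * pi) \<ge> 1 / 3"
    using pi_gt_zero pi_less_4 by (simp add: field_simps)
  ultimately show ?thesis
    using w_antimono[OF assms] by linarith
qed

lemma crossing_time: "t1 - t0 \<le> 3 / 2"
proof -
  have "ln (r t1) \<ge> ln (r t0) + 1 / 3 * (t1 - t0)"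
    using t1 r_pos w_crossing by (intro log_radius_ge) auto
  moreover have "ln (r t1) - ln (r t0) = ln (3 / 2)"
    unfolding t1 start using pi_gt_zero ln_div[of "3 * pi / 4" "pi / 2"] by simp
  moreover have "ln (3 / 2) \<le> (3 / 2 - 1 :: real)"
    by (rule ln_le_minus_one) simp
  ultimately show ?thesis
    by argo
qed

text \<open>The torque is at most a small multiple of \<open>\<bar>n1\<bar>\<close>, because the angular derivative of the bump has
  the factor \<open>x = r n1\<close>. Integrating it back from \<open>t1\<close>, where \<open>L = 0\<close>, over the bounded crossing time
  shows that \<open>n1\<close> changes by at most a quarter of its own maximum \<open>M\<close>. So \<open>n1\<close> keeps its sign, or
  vanishes identically.\<close>

lemma n1_nearly_constant:
  assumes "t0 \<le> t" "t \<le> t1"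
  shows "\<bar>n1 t - n1 t1\<bar> \<le> \<bar>n1 t1\<bar> / 2"
proof -
  have "continuous_on {t0..t1} (\<lambda>t. \<bar>n1 t\<bar>)"
    using r_pos by (intro continuous_on_rabs continuous_at_imp_continuous_on ballI DERIV_isCont[OF n_deriv(1)]) auto
  then obtain tm where tm: "tm \<in> {t0..t1}" "\<And>t. t \<in> {t0..t1} \<Longrightarrow> \<bar>n1 t\<bar> \<le> \<bar>n1 tm\<bar>"
    using continuous_attains_sup[of "{t0..t1}" "\<lambda>t. \<bar>n1 t\<bar>"] t1 by auto
  define M where "M = \<bar>n1 tm\<bar>"
  have torque: "\<bar>\<epsilon>\<^sup>2 / 2 * bump_angular (c u) * (c u \<bullet> c' u)\<^sup>2\<bar> \<le> 27 / 20000 * M" if u: "u \<in> {t0..t1}" for u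
  proof (cases "r u \<le> 2 * pi / 3 \<or> r u \<ge> 3 * pi / 4")
    case True
    then show ?thesis
      using bump_vanishes(2)[OF True] by (simp add: M_def)
  next
    case False
    then have r3: "r u \<le> 3" "r u > 0"
      using pi_less_4 r_pos u by auto
    have "\<bar>c u $ 1\<bar> \<le> 3 * M"
      unfolding n_eq abs_mult M_def using tm(2)[OF u] r3 by (intro mult_mono) auto
    moreover have "\<bar>flat' (c u $ 2) * cutoff (c u \<bullet> c u)\<bar> \<le> 1"
      using flat'_nonneg[of "c u $ 2"] cutoff_nonneg[of "c u \<bullet> c u"] flat'_le_1[of "c u $ 2"] cutoff_le_1[of "c u \<bullet> c u"]
      by (auto simp: mult_le_one)
    ultimately have b: "\<bar>bump_angular (c u)\<bar> \<le> 1 * (3 * M)"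
      unfolding bump_angular_def abs_mult[of _ "c u $ 1"] by (intro mult_mono) auto
    have "(c u \<bullet> c' u)\<^sup>2 = q u * (q u * (w u)\<^sup>2)"
      unfolding radial_angular[OF r3(2)] by (simp add: power2_eq_square)
    also have "\<dots> \<le> 9 * 1"
      using w_le[OF r3(2)] q_pos[OF r3(2)] power_mono[of "r u" 3 2] r3 by (intro mult_mono) (auto simp: q_eq)
    finally have m: "(c u \<bullet> c' u)\<^sup>2 \<le> 9"
      by simp
    have "\<bar>\<epsilon>\<^sup>2 / 2 * bump_angular (c u) * (c u \<bullet> c' u)\<^sup>2\<bar> \<le> (1 / 20000) * (1 * (3 * M)) * 9"
      unfolding abs_mult using b m \<epsilon> by (intro mult_mono) (auto simp: M_def)
    then show ?thesis
      by simp
  qed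
  have L: "\<bar>L u\<bar> \<le> 27 / 20000 * M * (3 / 2)" if u: "u \<in> {t0..t1}" for u
  proof -
    have "norm (L u - L t1) \<le> 27 / 20000 * M * norm (u - t1)"
      using u torque t1
      by (intro field_differentiable_bound[of "{t0..t1}"]) (auto intro: has_field_derivative_at_within L_deriv)
    also have "\<dots> \<le> 27 / 20000 * M * (3 / 2)"
      using u crossing_time by (intro mult_left_mono) (auto simp: M_def)
    finally show ?thesis
      using L_beyond[of t1] by simp
  qed
  have "\<bar>- \<omega> u * n2 u\<bar> \<le> 81 / 20000 * M" if u: "u \<in> {t0..t1}" for u
  proof -
    have r: "r u > 0"
      using u r_pos by simp
    have "1 / 2 * \<bar>\<omega> u\<bar> \<le> (f (r u))\<^sup>2 * \<bar>\<omega> u\<bar>"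
      using u outside r_between by (intro mult_right_mono f_ge) auto
    also have "\<dots> = \<bar>L u\<bar>"
      unfolding L_eq[OF r] by (simp add: abs_mult)
    finally have "\<bar>\<omega> u\<bar> \<le> 81 / 20000 * M"
      using L[OF u] by simp
    then have "\<bar>\<omega> u\<bar> * \<bar>n2 u\<bar> \<le> 81 / 20000 * M * 1"
      using n_unit(3)[OF r] by (intro mult_mono) (auto simp: M_def)
    then show ?thesis
      by (simp add: abs_mult)
  qed
  then have drift: "\<bar>n1 u - n1 t1\<bar> \<le> M / 4" if u: "u \<in> {t0..t1}" for u
  proof -
    have "norm (n1 u - n1 t1) \<le> 81 / 20000 * M * norm (u - t1)"
      using u t1 r_pos \<open>\<And>u. u \<in> {t0..t1} \<Longrightarrow> \<bar>- \<omega> u * n2 u\<bar> \<le> 81 / 20000 * M\<close>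
      by (intro field_differentiable_bound[of "{t0..t1}"]) (auto intro: has_field_derivative_at_within n_deriv)
    also have "\<dots> \<le> 81 / 20000 * M * (3 / 2)"
      using u crossing_time by (intro mult_left_mono) (auto simp: M_def)
    also have "\<dots> \<le> M / 4"
      by (simp add: M_def)
    finally show ?thesis
      by simp
  qed
  have "M \<le> \<bar>n1 t1\<bar> + M / 4"
    using drift[OF tm(1)] unfolding M_def by linarith
  then show ?thesis
    using drift[of t] assms by auto
qed

lemma L_zero_without_torque: "(\<And>u. t \<le> u \<Longrightarrow> u \<le> t1 \<Longrightarrow> bump_angular (c u) = 0) \<Longrightarrow> t \<le> t1 \<Longrightarrow> L t = 0"
proof -
  assume b: "\<And>u. t \<le> u \<Longrightarrow> u \<le> t1 \<Longrightarrow> bump_angular (c u) = 0" and t: "t \<le> t1"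
  have "L t1 \<le> L t" "L t \<le> L t1"
    using L_deriv b t by (auto intro!: DERIV_nonpos_imp_nonincreasing[of t t1] DERIV_nonneg_imp_nondecreasing[of t t1]) force+
  then show ?thesis
    using L_beyond[of t1] by simp
qed

text \<open>\<open>\<sigma>\<close> is the side of the vertical axis on which the geodesic escapes.\<close>

lemma torque_sign:
  assumes \<sigma>: "\<sigma> = sgn (n1 t1)" and t: "t0 \<le> t" "t \<le> t1"
  shows "\<sigma> * n1 t \<ge> 0" "n1 t = 0 \<longleftrightarrow> n1 t1 = 0" "\<sigma> * bump_angular (c t) \<ge> 0"
proof -
  show 1: "\<sigma> * n1 t \<ge> 0" "n1 t = 0 \<longleftrightarrow> n1 t1 = 0"
    using n1_nearly_constant[OF t] unfolding \<sigma> by (auto simp: sgn_if abs_if split: if_splits)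
  have "\<sigma> * bump_angular (c t) = flat' (c t $ 2) * cutoff (c t \<bullet> c t) * (r t * (\<sigma> * n1 t))"
    by (simp add: bump_angular_def n_eq)
  also have "\<dots> \<ge> 0"
    by (intro mult_nonneg_nonneg[OF mult_nonneg_nonneg[OF flat'_nonneg cutoff_nonneg]]
        mult_nonneg_nonneg[OF r_nonneg 1(1)])
  finally show "\<sigma> * bump_angular (c t) \<ge> 0" .
qed

lemma signed_L_mono:
  assumes \<sigma>: "\<sigma> = sgn (n1 t1)" and t: "t0 \<le> s" "s \<le> t" "t \<le> t1"
  shows "\<sigma> * L s \<le> \<sigma> * L t"
proof (rule DERIV_nonneg_imp_nondecreasing[OF t(2)])
  fix u assume u: "s \<le> u" "u \<le> t"
  have "((\<lambda>t. \<sigma> * L t) has_real_derivative \<sigma> * (\<epsilon>\<^sup>2 / 2 * bump_angular (c u) * (c u \<bullet> c' u)\<^sup>2)) (at u)"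
    by (rule DERIV_cmult[OF L_deriv])
  moreover have "\<sigma> * (\<epsilon>\<^sup>2 / 2 * bump_angular (c u) * (c u \<bullet> c' u)\<^sup>2) =
      (\<sigma> * bump_angular (c u)) * (\<epsilon>\<^sup>2 / 2 * (c u \<bullet> c' u)\<^sup>2)"
    by simp
  moreover have "\<dots> \<ge> 0"
    using u t by (intro mult_nonneg_nonneg[OF torque_sign(3)[OF \<sigma>]]) auto
  ultimately show "\<exists>y. ((\<lambda>t. \<sigma> * L t) has_real_derivative y) (at u) \<and> 0 \<le> y"
    by metis
qed

text \<open>As \<open>\<sigma> L\<close> increases to \<open>0\<close>, it is nonpositive: the geodesic turns away from the upper half of the
  vertical axis, so \<open>n2\<close> decreases. If it starts in the closed lower half plane, it stays there, where
  there is no torque. If it starts with \<open>L = 0\<close>, then \<open>\<sigma> L\<close> is squeezed between \<open>0\<close> and \<open>0\<close>.\<close>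

lemma L_vanishes:
  assumes "n2 t0 \<le> 0 \<or> L t0 = 0" and "t0 \<le> t"
  shows "L t = 0"
proof (cases "t1 \<le> t")
  case True
  then show ?thesis
    by (rule L_beyond)
next
  case False
  define \<sigma> where "\<sigma> = sgn (n1 t1)"
  note sign = torque_sign[OF \<sigma>_def]
  have \<sigma>L: "\<sigma> * L u \<le> 0" if "t0 \<le> u" "u \<le> t1" for u
    using signed_L_mono[OF \<sigma>_def that order_refl] L_beyond[of t1] by simp
  show ?thesis
  proof (cases "n1 t1 = 0")
    case True
    then have "bump_angular (c u) = 0" if "t \<le> u" "u \<le> t1" for u
      using sign(2)[of u] that assms(2) by (simp add: bump_angular_def n_eq)
    then show ?thesis
      using False by (intro L_zero_without_torque) auto
  next
    case n1: False
    then have \<sigma>2: "\<sigma> * \<sigma> = 1" "\<sigma> \<noteq> 0"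
      by (auto simp: \<sigma>_def sgn_if)
    from assms(1) show ?thesis
    proof
      assume "L t0 = 0"
      then have "\<sigma> * L t \<ge> 0"
        using signed_L_mono[OF \<sigma>_def, of t0 t] assms False by simp
      then show ?thesis
        using \<sigma>L[of t] \<sigma>2 assms False by simp
    next
      assume n2: "n2 t0 \<le> 0"
      have n2_neg: "n2 u \<le> 0" if u: "t0 \<le> u" "u \<le> t1" for u
      proof -
        have "n2 u \<le> n2 t0"
        proof (rule DERIV_nonpos_imp_nonincreasing[OF u(1)])
          fix v assume v: "t0 \<le> v" "v \<le> u"
          then have r: "r v > 0"
            using r_pos by simp
          have "(f (r v))\<^sup>2 * (\<omega> v * n1 v) = (\<sigma> * \<sigma>) * (L v * n1 v)"
            unfolding \<sigma>2 L_eq[OF r] by simp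
          also have "\<dots> = (\<sigma> * L v) * (\<sigma> * n1 v)"
            by simp
          also have "\<dots> \<le> 0"
            using u v by (intro mult_nonpos_nonneg[OF \<sigma>L sign(1)]) auto
          finally have "\<omega> v * n1 v \<le> 0"
            using f_pos[OF r] by (simp add: mult_le_0_iff)
          then show "\<exists>y. (n2 has_real_derivative y) (at v) \<and> y \<le> 0"
            using n_deriv(2)[OF r] by blast
        qed
        then show ?thesis
          using n2 by simp
      qed
      have "bump_angular (c u) = 0" if "t \<le> u" "u \<le> t1" for u
      proof -
        have "c u $ 2 \<le> 0"
          unfolding n_eq using n2_neg[of u] that assms(2) r_nonneg[of u] by (intro mult_nonneg_nonpos) auto
        then show ?thesis
          by (simp add: bump_angular_def flat'_eq_0)
      qed
      then show ?thesis
        using False by (intro L_zero_without_torque) auto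
    qed
  qed
qed

text \<open>A radial end in the open upper half plane must be on the vertical axis, since otherwise it would
  feel a torque.\<close>

lemma radial_escape:
  assumes L: "\<And>t. t0 \<le> t \<Longrightarrow> L t = 0"
  shows "t0 \<le> t \<Longrightarrow> n1 t = n1 t0" "t0 \<le> t \<Longrightarrow> n2 t = n2 t0" "n1 t0 = 0 \<or> n2 t0 \<le> 0"
proof -
  have \<omega>: "\<omega> u = 0" if "t0 \<le> u" for u
    using L[OF that] L_eq[OF r_pos[OF that]] f_pos[OF r_pos[OF that]] by simp
  show n1: "n1 t = n1 t0" if "t0 \<le> t" for t
  proof -
    have "n1 t \<le> n1 t0" "n1 t0 \<le> n1 t"
      using n_deriv(1)[OF r_pos] \<omega> that
      by (auto intro!: DERIV_nonpos_imp_nonincreasing[of t0 t] DERIV_nonneg_imp_nondecreasing[of t0 t])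
    then show ?thesis
      by simp
  qed
  show n2: "n2 t = n2 t0" if "t0 \<le> t" for t
  proof -
    have "n2 t \<le> n2 t0" "n2 t0 \<le> n2 t"
      using n_deriv(2)[OF r_pos] \<omega> that
      by (auto intro!: DERIV_nonpos_imp_nonincreasing[of t0 t] DERIV_nonneg_imp_nondecreasing[of t0 t])
    then show ?thesis
      by simp
  qed
  \<comment> \<open>Look at the torque at a time at which the geodesic is inside the support of the cutoff.\<close>
  have "\<exists>x. t0 \<le> x \<and> x \<le> t1 \<and> r x = 17 * pi / 24"
    using t1 start pi_gt_zero by (intro IVT' r_continuous) linarith+
  then obtain u where u: "t0 \<le> u" "u \<le> t1" "r u = 17 * pi / 24"
    by blast
  have "17 * pi / 24 \<noteq> pi / 2"
    using pi_gt_zero by (simp add: field_simps)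
  then have "u \<noteq> t0"
    using u(3) start by metis
  then have "t0 < u"
    using u by simp
  have "(L has_real_derivative 0) (at u)"
    by (rule has_field_derivative_transform_within_open[of "\<lambda>_. 0" _ _ "{t0<..}"])
      (use \<open>t0 < u\<close> L in auto)
  from DERIV_unique[OF this L_deriv]
  have "bump_angular (c u) = 0 \<or> c u \<bullet> c' u = 0"
    using \<epsilon> by simp
  moreover have "c u \<bullet> c' u > 0"
    using radial_angular(1)[OF r_pos[OF u(1)]] q_pos[OF r_pos[OF u(1)]] w_crossing[OF u(1,2)] by simp
  ultimately have "bump_angular (c u) = 0"
    by simp
  moreover have "cutoff (c u \<bullet> c u) > 0"
    unfolding q_def[symmetric] q_eq u(3) using pi_gt_zero
    by (intro cutoff_pos power_strict_mono) auto
  ultimately have "flat' (r u * n2 u) = 0 \<or> r u * n1 u = 0"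
    by (simp add: bump_angular_def n_eq)
  then show "n1 t0 = 0 \<or> n2 t0 \<le> 0"
    using flat'_pos[of "r u * n2 u"] n1[OF u(1)] n2[OF u(1)] r_pos[OF u(1)]
    by (auto simp: not_less[symmetric])
qed

end

section \<open>Passages through the hemisphere\<close>

lemma harmonic_oscillator:
  fixes y v :: "real \<Rightarrow> real"
  assumes "convex S" and "\<And>x. x \<in> S \<Longrightarrow> (y has_real_derivative v x) (at x)"
    and "\<And>x. x \<in> S \<Longrightarrow> (v has_real_derivative - y x) (at x)" and "s \<in> S" "t \<in> S"
  shows "y t = cos (t - s) * y s + sin (t - s) * v s"
proof -
  define \<phi> where "\<phi> x = cos (t - x) * y x + sin (t - x) * v x" for x
  have "(\<phi> has_real_derivative 0) (at x within S)" if "x \<in> S" for x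
    unfolding \<phi>_def
    by (rule has_field_derivative_at_within)
      (auto intro!: derivative_eq_intros assms(2,3) that)
  then have "\<phi> t = \<phi> s"
    using has_field_derivative_zero_constant[OF assms(1), of \<phi>] assms(4,5) by metis
  then show ?thesis
    by (simp add: \<phi>_def)
qed

lemma first_crossing:
  fixes h :: "real \<Rightarrow> real"
  assumes "continuous_on UNIV h" "h s < b" "s \<le> t" "b \<le> h t"
  obtains u where "s < u" "u \<le> t" "h u = b" "\<And>v. s \<le> v \<Longrightarrow> v < u \<Longrightarrow> h v < b"
proof -
  define K where "K = {s..t} \<inter> h -` {b..}"
  have "compact K"
    unfolding K_def using continuous_closed_vimage[of "{b..}" h] assms(1)
    by (intro compact_Int_closed) (auto simp: continuous_on_eq_continuous_at)
  moreover have "K \<noteq> {}"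
    using assms unfolding K_def by auto
  ultimately obtain u where u: "u \<in> K" "\<And>v. v \<in> K \<Longrightarrow> u \<le> v"
    using compact_attains_inf[of K] by auto
  have below: "h v < b" if "s \<le> v" "v < u" for v
    using u that by (force simp: K_def)
  have "s < u"
    using u(1) assms(2) by (cases "s = u") (auto simp: K_def)
  moreover have "h u \<le> b"
  proof (rule tendsto_upperbound)
    show "(h \<longlongrightarrow> h u) (at_left u)"
      using assms(1) continuous_on_eq_continuous_at[OF open_UNIV, of h]
      by (intro tendsto_within_subset[OF isContD]) auto
    have "\<forall>\<^sub>F v in at_left u. v \<in> {s<..<u}"
      by (rule eventually_at_left_real[OF \<open>s < u\<close>])
    then show "\<forall>\<^sub>F v in at_left u. h v \<le> b"
      by eventually_elim (use below in \<open>force intro: less_imp_le\<close>)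
  qed simp
  ultimately show thesis
    using that[of u] u(1) below by (auto simp: K_def)
qed

context perturbed_plane
begin

text \<open>Near the origin the metric is invariant under \<open>x \<mapsto> - x\<close>, so its derivative there is odd and
  even.\<close>

lemma G_deriv_origin: "v \<bullet> (frechet_derivative G (at 0) h *v w) = 0"
proof -
  define F where "F x = v \<bullet> (G x *v w)" for x
  define D where "D h = v \<bullet> (frechet_derivative G (at 0) h *v w)" for h
  have F: "(F has_derivative D) (at 0)"
    unfolding F_def D_def by (rule metric_form_has_derivative[OF metric_G])
  have "((\<lambda>x. F (- x)) has_derivative (\<lambda>h. D (- h))) (at 0)"
    using has_derivative_compose[of uminus "\<lambda>h. - h" 0 UNIV F D] F
    by (auto intro!: derivative_eq_intros)
  then have "(F has_derivative (\<lambda>h. D (- h))) (at 0)"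
  proof (rule has_derivative_transform_within_open)
    show "F (- x) = F x" if x: "x \<in> ball 0 1" for x
    proof (cases "x = 0")
      case False
      have "norm x \<le> 2 * pi / 3"
        using x pi_gt3 by simp
      then have "(norm x)\<^sup>2 \<le> (2 * pi / 3)\<^sup>2"
        by (intro power_mono) auto
      then have "bump x = 0" "bump (- x) = 0"
        using bump_eq_0(1)[of x] bump_eq_0(1)[of "- x"] by (simp_all add: power2_norm_eq_inner)
      then show ?thesis
        using G_inner[of x v w] G_inner[of "- x" v w] False by (simp add: F_def wedge_def algebra_simps)
    qed simp
  qed auto
  from has_derivative_unique[OF F this] have "D h = D (- h)"
    by metis
  moreover have "D (- h) = - D h"
    using linear_neg[OF has_derivative_linear[OF F]] .
  ultimately show ?thesis
    by (simp add: D_def)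
qed

end

context unit_geodesic
begin

lemma bump_vanishes_near: "r t < 2 * pi / 3 \<Longrightarrow> bump (c t) = 0 \<and> bump_angular (c t) = 0 \<and> bump_radial (c t) = 0"
  using bump_vanishes[of t] by simp

lemma L_constant:
  assumes "convex S" "\<And>t. t \<in> S \<Longrightarrow> r t < 2 * pi / 3" "s \<in> S" "t \<in> S"
  shows "L t = L s"
proof -
  have "(L has_real_derivative 0) (at x within S)" if "x \<in> S" for x
    using L_deriv[of x] bump_vanishes_near[OF assms(2)[OF that]]
    by (auto intro: has_field_derivative_at_within)
  then show ?thesis
    using has_field_derivative_zero_constant[OF assms(1), of L] assms(3,4) by metis
qed

lemma w_deriv_sphere:
  assumes "r t > 0" "r t < 2 * pi / 3"
  shows "(w has_real_derivative - (w t)\<^sup>2 + sin (r t) * cos (r t) * (\<omega> t)\<^sup>2 / r t) (at t)"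
proof -
  have "r t < 3 * pi / 4"
    using assms(2) pi_gt_zero by linarith
  then have "f (r t) = sin (r t)" "deriv f (r t) = cos (r t)"
    using assms f_sin deriv_f_cos by auto
  moreover have "r t * x / (r t)\<^sup>2 = x / r t" for x
    using assms by (simp add: power2_eq_square)
  ultimately show ?thesis
    using w_deriv[OF assms(1)] bump_vanishes_near[OF assms(2)] q_pos[OF assms(1)] assms
    by (simp add: add_divide_distrib diff_divide_distrib mult.assoc) (simp add: q_eq)
qed

text \<open>Polar coordinates break down for a geodesic through the origin. Its angular momentum vanishes, and
  therefore its Cartesian acceleration does: away from the origin because \<open>c' = w c\<close> and
  \<open>w' = - w\<^sup>2\<close>, and at the origin because the Christoffel symbols vanish there.\<close>

lemma straight_line:
  assumes S: "convex S" "open S" and small: "\<And>t. t \<in> S \<Longrightarrow> r t < 2 * pi / 3"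
    and \<tau>: "\<tau> \<in> S" "c \<tau> = 0"
  obtains e where "norm e = 1" "\<And>t. t \<in> S \<Longrightarrow> c t = (t - \<tau>) *\<^sub>R e"
proof -
  have "L \<tau> = 0"
    using \<tau> by (simp add: L_def)
  then have L: "L t = 0" if "t \<in> S" for t
    using L_constant[OF S(1) small \<tau>(1) that] by simp
  have \<omega>: "\<omega> t = 0" if "t \<in> S" "r t > 0" for t
    using L[OF that(1)] L_eq[OF that(2)] f_pos[OF that(2)] by simp
  have c': "c' t = w t *\<^sub>R c t" if "t \<in> S" "r t > 0" for t
  proof -
    have "wedge (c t) (c' t) = 0" "c t \<bullet> c' t = q t * w t" "q t > 0"
      using radial_angular[OF that(2)] \<omega>[OF that] q_pos[OF that(2)] by simp_all
    moreover have "q t * c' t $ 1 = (c t \<bullet> c' t) * c t $ 1 - wedge (c t) (c' t) * c t $ 2"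
      "q t * c' t $ 2 = (c t \<bullet> c' t) * c t $ 2 + wedge (c t) (c' t) * c t $ 1"
      by (simp_all add: q_def inner_2 wedge_def algebra_simps)
    ultimately show ?thesis
      by (simp add: vec2_eq_iff)
  qed
  have "c'' t = 0" if t: "t \<in> S" for t
  proof (cases "r t > 0")
    case True
    have "open (S \<inter> r -` {0<..})"
      using S(2) r_continuous by (intro open_Int open_vimage) auto
    have "((\<lambda>t. w t *\<^sub>R c t) has_vector_derivative c'' t) (at t)"
      using c'_deriv[of t]
    proof (rule has_vector_derivative_transform_within_open)
      show "open (S \<inter> r -` {0<..})" "t \<in> S \<inter> r -` {0<..}"
        using \<open>open (S \<inter> r -` {0<..})\<close> True t by auto
    qed (use c' in auto)
    moreover have "((\<lambda>t. w t *\<^sub>R c t) has_vector_derivative w t *\<^sub>R c' t + (- (w t)\<^sup>2) *\<^sub>R c t) (at t)"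
      using has_vector_derivative_scaleR[OF w_deriv_sphere[OF True small[OF t]] c_deriv[of t]] \<omega>[OF t True]
      by simp
    ultimately have "c'' t = w t *\<^sub>R c' t + (- (w t)\<^sup>2) *\<^sub>R c t"
      by (rule vector_derivative_unique_at)
    then show ?thesis
      by (simp add: c'[OF t True] power2_eq_square)
  next
    case False
    then have "c t = 0"
      using r_nonneg[of t] by (simp add: r_def)
    then have "c'' t \<bullet> (G (c t) *v c'' t) = 0"
      unfolding geodesic_equation by (simp add: G_deriv_origin)
    then show ?thesis
      using metric_G unfolding riemannian_metric_def by (metis less_irrefl)
  qed
  then have "(c' has_vector_derivative 0) (at t within S)" if "t \<in> S" for t
    using c'_deriv[of t] that by (auto intro: has_vector_derivative_at_within)
  then obtain e where e: "\<And>t. t \<in> S \<Longrightarrow> c' t = e"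
    using has_vector_derivative_zero_constant[OF S(1), of c'] by blast
  have "((\<lambda>t. c t - t *\<^sub>R e) has_vector_derivative 0) (at t within S)" if "t \<in> S" for t
    using c_deriv[of t] e[OF that]
    by (auto intro!: derivative_eq_intros has_vector_derivative_at_within[where S = S])
  then obtain d where d: "\<And>t. t \<in> S \<Longrightarrow> c t - t *\<^sub>R e = d"
    using has_vector_derivative_zero_constant[OF S(1), of "\<lambda>t. c t - t *\<^sub>R e"] by blast
  have c: "c t = (t - \<tau>) *\<^sub>R e" if "t \<in> S" for t
  proof -
    have "c t - t *\<^sub>R e = - (\<tau> *\<^sub>R e)"
      using d[OF that] d[OF \<tau>(1)] \<tau>(2) by simp
    then show ?thesis
      by (simp add: scaleR_diff_left diff_eq_eq)
  qed
  have "e \<noteq> 0"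
    using unit_speed[of \<tau>] e[OF \<tau>(1)] by auto
  obtain \<delta> where "\<delta> > 0" "ball \<tau> \<delta> \<subseteq> S"
    using S(2) \<tau>(1) open_contains_ball by blast
  then have t: "\<tau> + \<delta> / 2 \<in> S"
    by (auto simp: subset_iff dist_real_def)
  then have rt: "r (\<tau> + \<delta> / 2) > 0"
    using c[OF t] \<open>e \<noteq> 0\<close> \<open>\<delta> > 0\<close> by (simp add: r_def)
  have "norm e ^ 2 = (w (\<tau> + \<delta> / 2))\<^sup>2 * q (\<tau> + \<delta> / 2)"
    using c'[OF t rt] e[OF t] by (simp add: q_eq r_def power_mult_distrib)
  also have "\<dots> = 1"
    using energy[OF rt] \<omega>[OF t rt] bump_vanishes_near[OF small[OF t]] by (simp add: mult.commute)
  finally have "norm e = 1"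
    using power2_eq_imp_eq[of "norm e" 1] by simp
  then show thesis
    using that c by blast
qed

text \<open>In the spherical part, where \<open>(r, n)\<close> are polar coordinates of the point
  \<open>(sin r * n, cos r)\<close> of the unit sphere in space, geodesics are great circles: the three coordinates
  of this point are harmonic oscillators.\<close>

lemma great_circle:
  assumes S: "convex S" "open S" and small: "\<And>t. t \<in> S \<Longrightarrow> r t < 2 * pi / 3"
    and st: "s \<in> S" "t \<in> S" and "r s > 0"
  shows "sin (r t) * n1 t = cos (t - s) * (sin (r s) * n1 s)
      + sin (t - s) * (cos (r s) * (r s * w s) * n1 s - sin (r s) * \<omega> s * n2 s)" (is ?x)
    and "sin (r t) * n2 t = cos (t - s) * (sin (r s) * n2 s)
      + sin (t - s) * (cos (r s) * (r s * w s) * n2 s + sin (r s) * \<omega> s * n1 s)" (is ?y)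
    and "cos (r t) = cos (t - s) * cos (r s) + sin (t - s) * (- sin (r s) * (r s * w s))" (is ?z)
proof -
  have "?x \<and> ?y \<and> ?z"
  proof (cases "\<exists>\<tau>\<in>S. c \<tau> = 0")
    case True
    then obtain \<tau> where \<tau>: "\<tau> \<in> S" "c \<tau> = 0"
      by blast
    obtain e where e: "norm e = 1" "\<And>t. t \<in> S \<Longrightarrow> c t = (t - \<tau>) *\<^sub>R e"
      using straight_line[OF S small \<tau>] by blast
    have r: "r u = \<bar>u - \<tau>\<bar>" if "u \<in> S" for u
      using e that by (simp add: r_def)
    have P: "sin (r u) * n1 u = sin (u - \<tau>) * e $ 1" "sin (r u) * n2 u = sin (u - \<tau>) * e $ 2"
        "cos (r u) = cos (u - \<tau>)" if "u \<in> S" for u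
    proof -
      have "sin \<bar>x\<bar> * (x * y / \<bar>x\<bar>) = sin x * y" for x y :: real
        by (cases "x = 0") (auto simp: abs_if)
      then show "sin (r u) * n1 u = sin (u - \<tau>) * e $ 1" "sin (r u) * n2 u = sin (u - \<tau>) * e $ 2"
        unfolding r[OF that] n1_def n2_def e(2)[OF that] by simp_all
      show "cos (r u) = cos (u - \<tau>)"
        unfolding r[OF that] by (rule cos_abs_real)
    qed
    have "s \<noteq> \<tau>"
      using \<open>r s > 0\<close> r[OF st(1)] by auto
    have "(c has_vector_derivative e) (at s)"
    proof (rule has_vector_derivative_transform_within_open[OF _ S(2) st(1)])
      show "((\<lambda>t. (t - \<tau>) *\<^sub>R e) has_vector_derivative e) (at s)"
        by (auto intro!: derivative_eq_intros)
    qed (use e(2) in auto)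
    then have "c' s = e"
      using c_deriv vector_derivative_unique_at by blast
    have ee: "e \<bullet> e = 1"
      using e(1) by (simp add: norm_eq_1)
    have "sin \<bar>x\<bar> * (\<bar>x\<bar> * (1 / x)) = sin x" if "x \<noteq> 0" for x :: real
      using that by (auto simp: abs_if)
    from this[of "s - \<tau>"]
    have "\<omega> s = 0" "r s * w s * n1 s = e $ 1" "r s * w s * n2 s = e $ 2" "sin (r s) * (r s * w s) = sin (s - \<tau>)"
      using \<open>s \<noteq> \<tau>\<close> \<open>c' s = e\<close> ee
      by (simp_all add: \<omega>_def wedge_def w_def q_def n1_def n2_def e(2)[OF st(1)] r[OF st(1)])
    then have V: "cos (r s) * (r s * w s) * n1 s - sin (r s) * \<omega> s * n2 s = cos (s - \<tau>) * e $ 1"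
        "cos (r s) * (r s * w s) * n2 s + sin (r s) * \<omega> s * n1 s = cos (s - \<tau>) * e $ 2"
        "- sin (r s) * (r s * w s) = - sin (s - \<tau>)"
      by (simp_all add: P(3)[OF st(1)] mult.assoc)
    have "t - \<tau> = (t - s) + (s - \<tau>)"
      by simp
    then have "sin (t - \<tau>) = cos (t - s) * sin (s - \<tau>) + sin (t - s) * cos (s - \<tau>)"
      "cos (t - \<tau>) = cos (t - s) * cos (s - \<tau>) - sin (t - s) * sin (s - \<tau>)"
      by (metis sin_add add.commute mult.commute) (metis cos_add \<open>t - \<tau> = (t - s) + (s - \<tau>)\<close>)
    then show ?thesis
      unfolding V unfolding P[OF st(1)] P[OF st(2)] by (simp add: algebra_simps)
  next
    case False
    then have r0: "r u > 0" if "u \<in> S" for u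
      using that by (simp add: r_pos_iff)
    have sin0: "sin (r u) > 0" if "u \<in> S" for u
      using r0[OF that] small[OF that] pi_gt_zero by (intro sin_gt_zero) linarith+
    define \<rho> where "\<rho> u = r u * w u" for u
    have dr: "(r has_real_derivative \<rho> u) (at u)" if "u \<in> S" for u
      unfolding \<rho>_def by (rule r_deriv[OF r0[OF that]])
    have d\<rho>: "(\<rho> has_real_derivative sin (r u) * cos (r u) * (\<omega> u)\<^sup>2) (at u)" if "u \<in> S" for u
    proof -
      have "(\<rho> has_real_derivative r u * w u * w u + (- (w u)\<^sup>2 + sin (r u) * cos (r u) * (\<omega> u)\<^sup>2 / r u) * r u) (at u)"
        unfolding \<rho>_def by (rule DERIV_mult[OF r_deriv[OF r0[OF that]] w_deriv_sphere[OF r0[OF that] small[OF that]]])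
      then show ?thesis
        using r0[OF that] by (simp add: algebra_simps power2_eq_square)
    qed
    have d\<omega>: "(\<omega> has_real_derivative - 2 * cos (r u) * \<rho> u * \<omega> u / sin (r u)) (at u)" if "u \<in> S" for u
    proof -
      have "\<omega> v = L u / (sin (r v))\<^sup>2" if v: "v \<in> S" for v
      proof -
        have "r v < 3 * pi / 4"
          using small[OF v] pi_gt_zero by linarith
        then have "L v = (sin (r v))\<^sup>2 * \<omega> v"
          using L_eq[OF r0[OF v]] f_sin[OF r0[OF v]] by simp
        moreover have "L v = L u"
          by (rule L_constant[OF S(1) small \<open>u \<in> S\<close> v])
        ultimately show ?thesis
          using sin0[OF v] by (simp add: field_simps)
      qed
      note \<omega>_eq = this
      have "((\<lambda>v. L u / (sin (r v))\<^sup>2) has_real_derivative - 2 * cos (r u) * \<rho> u * (L u / (sin (r u))\<^sup>2) / sin (r u)) (at u)"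
        using sin0[OF that]
        by (auto intro!: derivative_eq_intros dr that simp: field_simps power2_eq_square power3_eq_cube)
      then show ?thesis
        unfolding \<omega>_eq[OF that, symmetric]
        by (rule has_field_derivative_transform_within_open[OF _ S(2) that]) (use \<omega>_eq in auto)
    qed
    have e: "(\<rho> u)\<^sup>2 = 1 - (sin (r u))\<^sup>2 * (\<omega> u)\<^sup>2" if "u \<in> S" for u
    proof -
      have "r u < 3 * pi / 4"
        using small[OF that] pi_gt_zero by linarith
      then show ?thesis
        using energy[OF r0[OF that]] bump_vanishes_near[OF small[OF that]] f_sin[OF r0[OF that]]
        by (simp add: \<rho>_def power_mult_distrib q_eq)
    qed
    have ss: "(sin x)\<^sup>2 = 1 - (cos x)\<^sup>2" for x :: real
      by (simp add: sin_squared_eq)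
    have ?x
      unfolding \<rho>_def[symmetric]
    proof (rule harmonic_oscillator[OF S(1) _ _ st, where y = "\<lambda>u. sin (r u) * n1 u"
        and v = "\<lambda>u. cos (r u) * (r u * w u) * n1 u - sin (r u) * \<omega> u * n2 u", folded \<rho>_def])
      fix u assume u: "u \<in> S"
      show "((\<lambda>u. sin (r u) * n1 u) has_real_derivative cos (r u) * \<rho> u * n1 u - sin (r u) * \<omega> u * n2 u) (at u)"
        by (auto intro!: derivative_eq_intros dr n_deriv r0 u)
      have "((\<lambda>u. cos (r u) * \<rho> u * n1 u - sin (r u) * \<omega> u * n2 u) has_real_derivative
          (- sin (r u) * \<rho> u * \<rho> u + cos (r u) * (sin (r u) * cos (r u) * (\<omega> u)\<^sup>2)) * n1 u
          + cos (r u) * \<rho> u * (- \<omega> u * n2 u)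
          - ((cos (r u) * \<rho> u * \<omega> u + sin (r u) * (- 2 * cos (r u) * \<rho> u * \<omega> u / sin (r u))) * n2 u
          + sin (r u) * \<omega> u * (\<omega> u * n1 u))) (at u)"
        by (auto intro!: derivative_eq_intros dr d\<rho> d\<omega> n_deriv r0 u simp: algebra_simps)
      moreover have "sin (r u) * (- 2 * cos (r u) * \<rho> u * \<omega> u / sin (r u)) = - 2 * cos (r u) * \<rho> u * \<omega> u"
        using sin0[OF u] by simp
      moreover have "(- sin (r u) * \<rho> u * \<rho> u + cos (r u) * (sin (r u) * cos (r u) * (\<omega> u)\<^sup>2)) * n1 u
          + cos (r u) * \<rho> u * (- \<omega> u * n2 u)
          - ((cos (r u) * \<rho> u * \<omega> u + (- 2 * cos (r u) * \<rho> u * \<omega> u)) * n2 u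
          + sin (r u) * \<omega> u * (\<omega> u * n1 u)) = - (sin (r u) * n1 u)"
        using e[OF u] ss[of "r u"] by algebra
      ultimately show "((\<lambda>u. cos (r u) * \<rho> u * n1 u - sin (r u) * \<omega> u * n2 u) has_real_derivative - (sin (r u) * n1 u)) (at u)"
        by simp
    qed
    moreover have ?y
      unfolding \<rho>_def[symmetric]
    proof (rule harmonic_oscillator[OF S(1) _ _ st, where y = "\<lambda>u. sin (r u) * n2 u"
        and v = "\<lambda>u. cos (r u) * (r u * w u) * n2 u + sin (r u) * \<omega> u * n1 u", folded \<rho>_def])
      fix u assume u: "u \<in> S"
      show "((\<lambda>u. sin (r u) * n2 u) has_real_derivative cos (r u) * \<rho> u * n2 u + sin (r u) * \<omega> u * n1 u) (at u)"
        by (auto intro!: derivative_eq_intros dr n_deriv r0 u)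
      have "((\<lambda>u. cos (r u) * \<rho> u * n2 u + sin (r u) * \<omega> u * n1 u) has_real_derivative
          (- sin (r u) * \<rho> u * \<rho> u + cos (r u) * (sin (r u) * cos (r u) * (\<omega> u)\<^sup>2)) * n2 u
          + cos (r u) * \<rho> u * (\<omega> u * n1 u)
          + ((cos (r u) * \<rho> u * \<omega> u + sin (r u) * (- 2 * cos (r u) * \<rho> u * \<omega> u / sin (r u))) * n1 u
          + sin (r u) * \<omega> u * (- \<omega> u * n2 u))) (at u)"
        by (auto intro!: derivative_eq_intros dr d\<rho> d\<omega> n_deriv r0 u simp: algebra_simps)
      moreover have "sin (r u) * (- 2 * cos (r u) * \<rho> u * \<omega> u / sin (r u)) = - 2 * cos (r u) * \<rho> u * \<omega> u"
        using sin0[OF u] by simp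
      moreover have "(- sin (r u) * \<rho> u * \<rho> u + cos (r u) * (sin (r u) * cos (r u) * (\<omega> u)\<^sup>2)) * n2 u
          + cos (r u) * \<rho> u * (\<omega> u * n1 u)
          + ((cos (r u) * \<rho> u * \<omega> u + (- 2 * cos (r u) * \<rho> u * \<omega> u)) * n1 u
          + sin (r u) * \<omega> u * (- \<omega> u * n2 u)) = - (sin (r u) * n2 u)"
        using e[OF u] ss[of "r u"] by algebra
      ultimately show "((\<lambda>u. cos (r u) * \<rho> u * n2 u + sin (r u) * \<omega> u * n1 u) has_real_derivative - (sin (r u) * n2 u)) (at u)"
        by simp
    qed
    moreover have ?z
      unfolding \<rho>_def[symmetric]
    proof (rule harmonic_oscillator[OF S(1) _ _ st, where y = "\<lambda>u. cos (r u)"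
        and v = "\<lambda>u. - sin (r u) * (r u * w u)", folded \<rho>_def])
      fix u assume u: "u \<in> S"
      show "((\<lambda>u. cos (r u)) has_real_derivative - sin (r u) * \<rho> u) (at u)"
        by (auto intro!: derivative_eq_intros dr u)
      have "((\<lambda>u. - sin (r u) * \<rho> u) has_real_derivative
          - (cos (r u) * \<rho> u * \<rho> u + sin (r u) * (sin (r u) * cos (r u) * (\<omega> u)\<^sup>2))) (at u)"
        by (auto intro!: derivative_eq_intros dr d\<rho> u simp: algebra_simps)
      moreover have "- (cos (r u) * \<rho> u * \<rho> u + sin (r u) * (sin (r u) * cos (r u) * (\<omega> u)\<^sup>2)) = - cos (r u)"
        using e[OF u] ss[of "r u"] by algebra
      ultimately show "((\<lambda>u. - sin (r u) * \<rho> u) has_real_derivative - cos (r u)) (at u)"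
        by simp
    qed
    ultimately show ?thesis
      by blast
  qed
  then show ?x ?y ?z
    by blast+
qed

lemma reversed: "unit_geodesic f g \<epsilon> (\<lambda>t. c (- t)) (\<lambda>t. - c' (- t)) (\<lambda>t. c'' (- t))"
proof
  have neg: "((\<lambda>t. - t) has_real_derivative - 1) (at t)" for t :: real
    by (auto intro!: derivative_eq_intros)
  show "((\<lambda>t. c (- t)) has_vector_derivative - c' (- t)) (at t)" for t
    using vector_diff_chain_at[of uminus "-1" t c "c' (- t)"] neg c_deriv
    by (simp add: o_def has_real_derivative_iff_has_vector_derivative)
  have "((\<lambda>t. c' (- t)) has_vector_derivative - c'' (- t)) (at t)" for t
    using vector_diff_chain_at[of uminus "-1" t c' "c'' (- t)"] neg c'_deriv
    by (simp add: o_def has_real_derivative_iff_has_vector_derivative)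
  from has_vector_derivative_minus[OF this]
  show "((\<lambda>t. - c' (- t)) has_vector_derivative c'' (- t)) (at t)" for t
    by simp
  have minus: "A *v (- v) = - (A *v v)" for A :: "real^2^2" and v
    using linear_neg[OF matrix_vector_mul_linear] .
  have "frechet_derivative G (at x) (- v) *v w = - (frechet_derivative G (at x) v *v w)" for x v w
  proof -
    have "frechet_derivative G (at x) (- v) = - frechet_derivative G (at x) v"
      using linear_neg[OF has_derivative_linear[OF riemannian_metric_has_derivative[OF metric_G]]] .
    then show ?thesis
      by (simp add: matrix_vector_mult_def vec_eq_iff sum_negf)
  qed
  then show "w \<bullet> (G (c (- t)) *v c'' (- t)) =
      1/2 * (- c' (- t) \<bullet> (frechet_derivative G (at (c (- t))) w *v - c' (- t)))
      - - c' (- t) \<bullet> (frechet_derivative G (at (c (- t))) (- c' (- t)) *v w)" for t w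
    unfolding geodesic_equation by (simp add: minus)
  show "- c' (- t) \<bullet> (G (c (- t)) *v - c' (- t)) = 1" for t
    using unit_speed by (simp add: minus)
qed

lemma revisit_not_injective: "s \<noteq> t \<Longrightarrow> c s = c t \<Longrightarrow> \<not> inj c"
  by (auto simp: inj_def)

text \<open>On the equator \<open>\<omega>\<close> is constantly \<open>1\<close> or \<open>- 1\<close>.\<close>

lemma equator_not_injective:
  assumes eq: "\<And>t. t0 \<le> t \<Longrightarrow> r t = pi / 2"
  shows "\<not> inj c"
proof -
  define S where "S = {t0<..}"
  have r: "r t = pi / 2" "r t > 0" if "t \<in> S" for t
  proof -
    show "r t = pi / 2"
      using eq[of t] that by (simp add: S_def)
    then show "r t > 0"
      using pi_gt_zero by linarith
  qed
  have w: "w t = 0" if "t \<in> S" for t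
  proof -
    have "(r has_real_derivative 0) (at t)"
      by (rule has_field_derivative_transform_within_open[of "\<lambda>_. pi / 2" _ _ S])
        (use that r in \<open>auto simp: S_def\<close>)
    then have "r t * w t = 0"
      using DERIV_unique[OF r_deriv[OF r(2)[OF that]]] by blast
    then show ?thesis
      using r[OF that] by simp
  qed
  have small: "r t < 2 * pi / 3" if "t \<in> S" for t
    using r(1)[OF that] pi_gt_zero by linarith
  have f1: "f (pi / 2) = 1"
    using f_sin[of "pi / 2"] pi_gt_zero by simp
  have \<omega>2: "(\<omega> t)\<^sup>2 = 1" if "t \<in> S" for t
    using energy[OF r(2)[OF that]] w[OF that] r(1)[OF that] f1 by simp
  have \<omega>: "\<omega> t = L (t0 + 1)" if "t \<in> S" for t
  proof -
    have "L t = \<omega> t"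
      using L_eq[OF r(2)[OF that]] r(1)[OF that] f1 by simp
    moreover have "L t = L (t0 + 1)"
      by (rule L_constant[of S, OF _ small]) (use that in \<open>auto simp: S_def\<close>)
    ultimately show ?thesis
      by simp
  qed
  have "0 < 1 + 2 * pi"
    using pi_gt_zero by linarith
  then have S: "convex S" "t0 + 1 \<in> S" "t0 + 1 + 2 * pi \<in> S"
    by (auto simp: S_def)
  have period: "y (t0 + 1 + 2 * pi) = y (t0 + 1)"
    if "\<And>t. t \<in> S \<Longrightarrow> (y has_real_derivative v t) (at t)"
      "\<And>t. t \<in> S \<Longrightarrow> (v has_real_derivative - y t) (at t)" for y v :: "real \<Rightarrow> real"
    using harmonic_oscillator[OF S(1) that S(2,3)] by simp
  have \<omega>\<omega>: "L (t0 + 1) * L (t0 + 1) = 1"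
    using \<omega>2[OF S(2)] \<omega>[OF S(2)] by (simp add: power2_eq_square)
  have "n1 (t0 + 1 + 2 * pi) = n1 (t0 + 1)"
  proof (rule period)
    fix t assume t: "t \<in> S"
    show "(n1 has_real_derivative - L (t0 + 1) * n2 t) (at t)"
      using n_deriv(1)[OF r(2)[OF t]] \<omega>[OF t] by simp
    show "((\<lambda>t. - L (t0 + 1) * n2 t) has_real_derivative - n1 t) (at t)"
      using DERIV_cmult[OF n_deriv(2)[OF r(2)[OF t]], of "- L (t0 + 1)"] \<omega>[OF t] \<omega>\<omega>
      by (simp add: mult.assoc[symmetric])
  qed
  moreover have "n2 (t0 + 1 + 2 * pi) = n2 (t0 + 1)"
  proof (rule period)
    fix t assume t: "t \<in> S"
    show "(n2 has_real_derivative L (t0 + 1) * n1 t) (at t)"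
      using n_deriv(2)[OF r(2)[OF t]] \<omega>[OF t] by simp
    show "((\<lambda>t. L (t0 + 1) * n1 t) has_real_derivative - n2 t) (at t)"
      using DERIV_cmult[OF n_deriv(1)[OF r(2)[OF t]], of "L (t0 + 1)"] \<omega>[OF t] \<omega>\<omega>
      by (simp add: mult.assoc[symmetric])
  qed
  ultimately have "c (t0 + 1 + 2 * pi) = c (t0 + 1)"
    using r(1)[OF S(2)] r(1)[OF S(3)] by (simp add: vec2_eq_iff n_eq)
  then show ?thesis
    using revisit_not_injective[of "t0 + 1 + 2 * pi" "t0 + 1"] by simp
qed

text \<open>\<open>a\<close> is the time at which the geodesic enters the closed hemisphere; it stays there for time
  \<open>\<pi>\<close>, following half of the great circle with direction \<open>(L a, \<mu>)\<close> at the entrance.\<close>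

definition passage :: "real \<Rightarrow> bool"
  where "passage a \<longleftrightarrow> r a = pi / 2 \<and> r (a + pi) = pi / 2 \<and> (\<forall>t. a < t \<and> t < a + pi \<longrightarrow> r t < pi / 2) \<and>
    (\<exists>\<mu>>0. (L a)\<^sup>2 + \<mu>\<^sup>2 = 1 \<and> (\<forall>t. a \<le> t \<and> t \<le> a + pi \<longrightarrow>
      sin (r t) * n1 t = cos (t - a) * n1 a - sin (t - a) * L a * n2 a \<and>
      sin (r t) * n2 t = cos (t - a) * n2 a + sin (t - a) * L a * n1 a \<and>
      cos (r t) = sin (t - a) * \<mu> \<and> L t = L a))"

lemma passage_r:
  assumes "passage a"
  shows "r a = pi / 2" "r (a + pi) = pi / 2" "a < t \<Longrightarrow> t < a + pi \<Longrightarrow> r t < pi / 2"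
    and "a \<le> t \<Longrightarrow> t \<le> a + pi \<Longrightarrow> r t \<le> pi / 2"
proof -
  show 1: "r a = pi / 2" "r (a + pi) = pi / 2"
    and 2: "a < t \<Longrightarrow> t < a + pi \<Longrightarrow> r t < pi / 2"
    using assms unfolding passage_def by blast+
  show "r t \<le> pi / 2" if "a \<le> t" "t \<le> a + pi"
  proof (cases "t = a \<or> t = a + pi")
    case True
    then show ?thesis
      using 1 by auto
  next
    case False
    then have "r t < pi / 2"
      using that by (intro 2) auto
    then show ?thesis
      by simp
  qed
qed

text \<open>The height \<open>cos r\<close> above the equatorial plane changes its sign after time \<open>\<pi>\<close>.\<close>

lemma exit_exists:
  assumes "r s < pi / 2"
  shows "\<exists>t\<ge>s. r t \<ge> pi / 2"
proof (rule ccontr)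
  assume "\<not> ?thesis"
  then have less: "r t < pi / 2" if "s \<le> t" for t
    using that by force
  define S where "S = {s<..}"
  have small: "r t < 2 * pi / 3" if "t \<in> S" for t
  proof -
    have "r t < pi / 2"
      using less[of t] that by (simp add: S_def)
    then show ?thesis
      using pi_gt_zero by linarith
  qed
  have "0 < 1 + pi"
    using pi_gt_zero by linarith
  with small have S: "convex S" "open S" "\<And>t. t \<in> S \<Longrightarrow> r t < 2 * pi / 3" "s + 1 \<in> S" "s + 1 + pi \<in> S" "s + 1 + 4 \<in> S"
    by (auto simp: S_def)
  show False
  proof (cases "c (s + 1) = 0")
    case True
    obtain e where "norm e = 1" "c (s + 1 + 4) = (s + 1 + 4 - (s + 1)) *\<^sub>R e"
      using straight_line[OF S(1-3) S(4) True] S(6) by metis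
    then have "r (s + 1 + 4) = 4"
      by (simp add: r_def)
    then show False
      using less[of "s + 1 + 4"] pi_less_4 by simp
  next
    case False
    then have "cos (r (s + 1 + pi)) = - cos (r (s + 1))"
      using great_circle(3)[OF S(1-3) S(4) S(5)] by (simp add: r_pos_iff)
    moreover have "cos (r t) > 0" if "s \<le> t" for t
      using less[OF that] r_nonneg[of t] pi_gt_zero by (intro cos_gt_zero_pi) linarith+
    ultimately show False
      using pi_gt_zero by (smt (verit))
  qed
qed

lemma passage_exists:
  assumes s: "r s < pi / 2"
  obtains a where "passage a" "a < s" "s < a + pi"
proof -
  interpret rev: unit_geodesic f g \<epsilon> "\<lambda>t. c (- t)" "\<lambda>t. - c' (- t)" "\<lambda>t. c'' (- t)"
    by (rule reversed)
  have rr: "rev.r t = r (- t)" for t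
    by (simp add: rev.r_def r_def)
  obtain tb where "s \<le> tb" "r tb \<ge> pi / 2"
    using exit_exists[OF s] by blast
  then obtain b where b: "s < b" "r b = pi / 2" "\<And>v. s \<le> v \<Longrightarrow> v < b \<Longrightarrow> r v < pi / 2"
    using first_crossing[OF r_continuous s] by blast
  have s': "rev.r (- s) < pi / 2"
    using s by (simp add: rr)
  obtain ta where "- s \<le> ta" "rev.r ta \<ge> pi / 2"
    using rev.exit_exists[OF s'] by blast
  then obtain a' where a': "- s < a'" "rev.r a' = pi / 2" "\<And>v. - s \<le> v \<Longrightarrow> v < a' \<Longrightarrow> rev.r v < pi / 2"
    using first_crossing[OF rev.r_continuous s'] by blast
  define a where "a = - a'"
  have a: "a < s" "r a = pi / 2"
    using a' by (auto simp: a_def rr)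
  have inside: "r t < pi / 2" if "a < t" "t < b" for t
    using b(3)[of t] a'(3)[of "- t"] that by (cases "s \<le> t") (auto simp: a_def rr)
  have "open (r -` {..<2 * pi / 3})"
    using r_continuous by (intro open_vimage) auto
  moreover have "r a < 2 * pi / 3" "r b < 2 * pi / 3"
    using a(2) b(2) pi_gt_zero by linarith+
  then have "a \<in> r -` {..<2 * pi / 3}" "b \<in> r -` {..<2 * pi / 3}"
    by auto
  ultimately obtain d1 d2 where d: "d1 > 0" "ball a d1 \<subseteq> r -` {..<2 * pi / 3}" "d2 > 0" "ball b d2 \<subseteq> r -` {..<2 * pi / 3}"
    by (meson open_contains_ball)
  define S where "S = {a - d1<..<b + d2}"
  have small: "r t < 2 * pi / 3" if "t \<in> S" for t
  proof -
    consider "t \<le> a" | "a < t \<and> t < b" | "b \<le> t"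
      by linarith
    then show ?thesis
    proof cases
      case 1
      then have "t \<in> ball a d1"
        using that by (auto simp: S_def dist_real_def)
      then show ?thesis
        using d by auto
    next
      case 2
      then have "r t < pi / 2"
        using inside by blast
      then show ?thesis
        using pi_gt_zero by linarith
    next
      case 3
      then have "t \<in> ball b d2"
        using that by (auto simp: S_def dist_real_def)
      then show ?thesis
        using d by auto
    qed
  qed
  have S: "convex S" "open S" "a \<in> S"
    using a b d by (auto simp: S_def)
  have inS: "t \<in> S" if "a \<le> t" "t \<le> b" for t
    using that d by (auto simp: S_def)
  have ra: "r a > 0"
    unfolding a using pi_gt_zero by simp
  have f1: "f (pi / 2) = 1"
    using f_sin[of "pi / 2"] pi_gt_zero by simp
  have \<omega>: "\<omega> a = L a"
    using L_eq[OF ra] a f1 by simp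
  define \<mu> where "\<mu> = - (r a * w a)"
  have circle: "sin (r t) * n1 t = cos (t - a) * n1 a - sin (t - a) * L a * n2 a"
      "sin (r t) * n2 t = cos (t - a) * n2 a + sin (t - a) * L a * n1 a"
      "cos (r t) = sin (t - a) * \<mu>" "L t = L a" if "a \<le> t" "t \<le> b" for t
    using great_circle[OF S(1,2) small S(3) inS[OF that] ra] L_constant[OF S(1) small S(3) inS[OF that]]
    by (simp_all add: a \<omega> \<mu>_def)
  have "f (r a) = 1"
    unfolding a by (rule f1)
  then have "\<mu>\<^sup>2 + (L a)\<^sup>2 = 1"
    using energy[OF ra] bump_vanishes_near[OF small[OF S(3)]] \<omega>
    by (simp add: \<mu>_def q_eq power_mult_distrib)
  have pos: "sin (t - a) * \<mu> > 0" if "a < t" "t < b" for t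
  proof -
    have "cos (r t) > 0"
      using inside[OF that] r_nonneg[of t] pi_gt_zero by (intro cos_gt_zero_pi) linarith+
    then show ?thesis
      using circle(3)[of t] that by simp
  qed
  have "\<mu> \<noteq> 0"
    using pos[of s] a b by auto
  have "sin (b - a) = 0"
    using circle(3)[of b] b a \<open>\<mu> \<noteq> 0\<close> by simp
  have "b - a \<le> pi"
  proof (rule ccontr)
    assume "\<not> b - a \<le> pi"
    then show False
      using pos[of "a + pi"] pi_gt_zero by simp
  qed
  moreover have "\<not> b - a < pi"
    using sin_gt_zero[of "b - a"] \<open>sin (b - a) = 0\<close> a b by auto
  ultimately have b_eq: "b = a + pi"
    by simp
  have "sin (s - a) > 0"
    using a b b_eq by (intro sin_gt_zero) auto
  then have "\<mu> > 0"
    using pos[of s] a b by (simp add: zero_less_mult_iff)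
  then have "passage a"
    unfolding passage_def
  proof (intro conjI exI[of _ \<mu>] allI impI)
    show "r a = pi / 2" "r (a + pi) = pi / 2"
      using a(2) b(2) unfolding b_eq by simp_all
    show "r t < pi / 2" if "a < t \<and> t < a + pi" for t
      using inside[of t] that unfolding b_eq by blast
    show "(L a)\<^sup>2 + \<mu>\<^sup>2 = 1"
      using \<open>\<mu>\<^sup>2 + (L a)\<^sup>2 = 1\<close> by linarith
    fix t
    assume "a \<le> t \<and> t \<le> a + pi"
    then have "a \<le> t" "t \<le> b"
      by (simp_all add: b_eq)
    from circle[OF this]
    show "sin (r t) * n1 t = cos (t - a) * n1 a - sin (t - a) * L a * n2 a"
      "sin (r t) * n2 t = cos (t - a) * n2 a + sin (t - a) * L a * n1 a"
      "cos (r t) = sin (t - a) * \<mu>" "L t = L a"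
      by blast+
  qed
  then show thesis
    using that a b b_eq by simp
qed

text \<open>The planes of two half great circles in the same closed hemisphere have a line in common, and one of
  its two points on the sphere is in this hemisphere. Formally, along the first half circle the
  distance \<open>D\<close> from the plane of the second one has opposite values at both ends, and a point of the
  closed hemisphere in this plane is on the second half circle. A zero of \<open>D\<close> is chosen before the
  end of the first passage, so that the two passages meet at different times even if the second one
  begins when the first one ends.\<close>

lemma passages_intersect:
  assumes a: "passage a" and a': "passage a'" and "a + pi \<le> a'"
  shows "\<not> inj c"
proof -
  obtain \<mu> where \<mu>: "\<mu> > 0" "(L a)\<^sup>2 + \<mu>\<^sup>2 = 1" and circle: "\<And>t. a \<le> t \<Longrightarrow> t \<le> a + pi \<Longrightarrow>
      sin (r t) * n1 t = cos (t - a) * n1 a - sin (t - a) * L a * n2 a \<and>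
      sin (r t) * n2 t = cos (t - a) * n2 a + sin (t - a) * L a * n1 a \<and> cos (r t) = sin (t - a) * \<mu>"
    using a unfolding passage_def by blast
  obtain \<mu>' where \<mu>': "\<mu>' > 0" "(L a')\<^sup>2 + \<mu>'\<^sup>2 = 1" and circle': "\<And>t. a' \<le> t \<Longrightarrow> t \<le> a' + pi \<Longrightarrow>
      sin (r t) * n1 t = cos (t - a') * n1 a' - sin (t - a') * L a' * n2 a' \<and>
      sin (r t) * n2 t = cos (t - a') * n2 a' + sin (t - a') * L a' * n1 a' \<and> cos (r t) = sin (t - a') * \<mu>'"
    using a' unfolding passage_def by blast
  note hemi = passage_r(4)
  define X Y Z where "X t = sin (r t) * n1 t" and "Y t = sin (r t) * n2 t" and "Z t = cos (r t)" for t
  \<comment> \<open>The inner product of the first half circle with the normal of the plane of the second one.\<close>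
  define D where "D t = L a' * Z t - \<mu>' * (Y t * n1 a' - X t * n2 a')" for t
  have X: "X t = cos (t - a) * n1 a - sin (t - a) * L a * n2 a"
    and Y: "Y t = cos (t - a) * n2 a + sin (t - a) * L a * n1 a"
    and Z: "Z t = sin (t - a) * \<mu>" if "a \<le> t" "t \<le> a + pi" for t
    using circle[OF that] by (simp_all add: X_def Y_def Z_def)
  have D_end: "D (a + pi) = - D a"
    unfolding D_def by (simp add: X Y Z algebra_simps)
  obtain t where t: "a \<le> t" "t < a + pi" "D t = 0"
  proof (cases "D a = 0")
    case True
    then show ?thesis
      using that[of a] by simp
  next
    case False
    have cont: "continuous_on {a..a + pi} D"
    proof -
      have "continuous_on {a..a + pi} (\<lambda>t. L a' * (sin (t - a) * \<mu>) - \<mu>' * ((cos (t - a) * n2 a + sin (t - a) * L a * n1 a) * n1 a'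
          - (cos (t - a) * n1 a - sin (t - a) * L a * n2 a) * n2 a'))"
        by (intro continuous_intros)
      then show ?thesis
        by (rule continuous_on_eq) (simp add: D_def X Y Z)
    qed
    have "\<exists>t. a \<le> t \<and> t \<le> a + pi \<and> D t = 0"
    proof (cases "D a < 0")
      case True
      then show ?thesis
        using D_end cont by (intro IVT') auto
    next
      case False
      then show ?thesis
        using D_end cont by (intro IVT2') auto
    qed
    then obtain t where "a \<le> t" "t \<le> a + pi" "D t = 0"
      by blast
    then show ?thesis
      using that[of t] False D_end by (cases "t = a + pi") auto
  qed
  have unit: "(X u)\<^sup>2 + (Y u)\<^sup>2 + (Z u)\<^sup>2 = 1" for u
  proof (cases "r u > 0")
    case True
    have "(X u)\<^sup>2 + (Y u)\<^sup>2 = (sin (r u))\<^sup>2 * ((n1 u)\<^sup>2 + (n2 u)\<^sup>2)"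
      by (simp add: X_def Y_def power_mult_distrib distrib_left)
    then show ?thesis
      using n_unit(1)[OF True] by (simp add: Z_def)
  next
    case False
    then show ?thesis
      using r_nonneg[of u] by (simp add: X_def Y_def Z_def)
  qed
  have e: "(n1 a')\<^sup>2 + (n2 a')\<^sup>2 = 1"
    using passage_r(1)[OF a'] pi_gt_zero by (intro n_unit(1)) linarith
  \<comment> \<open>Coordinates of the intersection point with respect to the second half circle.\<close>
  define x y where "x = X t * n1 a' + Y t * n2 a'" and "y = Y t * n1 a' - X t * n2 a'"
  define s where "s = L a' * y + \<mu>' * Z t"
  have D0: "L a' * Z t = \<mu>' * y"
    using t(3) by (simp add: D_def y_def)
  have y: "y = s * L a'"
  proof -
    have "s * L a' = (L a')\<^sup>2 * y + \<mu>' * (L a' * Z t)"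
      by (simp add: s_def power2_eq_square algebra_simps)
    also have "\<dots> = ((L a')\<^sup>2 + \<mu>'\<^sup>2) * y"
      unfolding D0 by (simp add: power2_eq_square algebra_simps)
    finally show ?thesis
      using \<mu>'(2) by simp
  qed
  have z: "Z t = s * \<mu>'"
  proof -
    have "s * \<mu>' = L a' * (\<mu>' * y) + \<mu>'\<^sup>2 * Z t"
      by (simp add: s_def power2_eq_square algebra_simps)
    also have "\<dots> = ((L a')\<^sup>2 + \<mu>'\<^sup>2) * Z t"
      unfolding D0[symmetric] by (simp add: power2_eq_square algebra_simps)
    finally show ?thesis
      using \<mu>'(2) by simp
  qed
  have XY: "X t = x * n1 a' - y * n2 a'" "Y t = x * n2 a' + y * n1 a'"
  proof -
    have "x * n1 a' - y * n2 a' = X t * ((n1 a')\<^sup>2 + (n2 a')\<^sup>2)"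
      "x * n2 a' + y * n1 a' = Y t * ((n1 a')\<^sup>2 + (n2 a')\<^sup>2)"
      by (simp_all add: x_def y_def power2_eq_square algebra_simps)
    then show "X t = x * n1 a' - y * n2 a'" "Y t = x * n2 a' + y * n1 a'"
      by (simp_all add: e)
  qed
  have "x\<^sup>2 + s\<^sup>2 = 1"
  proof -
    have "(X t)\<^sup>2 + (Y t)\<^sup>2 = (x\<^sup>2 + y\<^sup>2) * ((n1 a')\<^sup>2 + (n2 a')\<^sup>2)"
      unfolding XY by (simp add: power2_eq_square algebra_simps)
    moreover have "y\<^sup>2 + (Z t)\<^sup>2 = s\<^sup>2 * ((L a')\<^sup>2 + \<mu>'\<^sup>2)"
      unfolding y z by (simp add: power2_eq_square algebra_simps)
    ultimately show ?thesis
      using unit[of t] by (simp add: e \<mu>'(2))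
  qed
  moreover have "s \<ge> 0"
  proof -
    have "0 \<le> sin (t - a)"
      using t by (intro sin_ge_zero) auto
    then have "Z t \<ge> 0"
      using Z[of t] t \<mu> by simp
    then show ?thesis
      using z \<mu>' by (simp add: zero_le_mult_iff)
  qed
  ultimately obtain \<tau> where \<tau>: "0 \<le> \<tau>" "\<tau> \<le> pi" "x = cos \<tau>" "s = sin \<tau>"
    using sincos_total_pi[of s x] by (metis add.commute)
  define t' where "t' = a' + \<tau>"
  have t': "a' \<le> t'" "t' \<le> a' + pi" "t' - a' = \<tau>"
    using \<tau> by (auto simp: t'_def)
  have same: "X t' = X t" "Y t' = Y t" "Z t' = Z t"
    using circle'[OF t'(1,2)] unfolding X_def[of t'] Y_def[of t'] Z_def[of t'] XY y z \<tau> t'(3)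
    by (simp_all add: mult_ac)
  have "r t' = r t"
  proof (rule cos_inj_pi)
    show "cos (r t') = cos (r t)"
      using same(3) by (simp add: Z_def)
  qed (use hemi[OF a, of t] hemi[OF a', of t'] t t' r_nonneg[of t] r_nonneg[of t'] pi_gt_zero in auto)
  have "c t' = c t"
  proof (cases "r t = 0")
    case True
    then show ?thesis
      using \<open>r t' = r t\<close> by (simp add: r_def)
  next
    case False
    then have "sin (r t) > 0"
      using r_nonneg[of t] hemi[OF a, of t] t pi_gt_zero by (intro sin_gt_zero) auto
    then have "n1 t' = n1 t" "n2 t' = n2 t"
      using same(1,2) by (simp_all add: X_def Y_def \<open>r t' = r t\<close>)
    then show ?thesis
      by (simp add: vec2_eq_iff n_eq \<open>r t' = r t\<close>)
  qed
  moreover have "t' \<noteq> t"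
    using t t' assms(3) by simp
  ultimately show ?thesis
    by (rule revisit_not_injective[rotated])
qed

text \<open>The ends before and after the only passage are treated alike, by reversing the time of the first
  one. They start at antipodal points of the equator.\<close>

lemma injective_geodesic_on_axis:
  assumes inj: "inj c"
  shows "(\<forall>t. c t $ 1 = 0) \<or> (\<forall>t. c t $ 2 = 0)"
proof -
  interpret rev: unit_geodesic f g \<epsilon> "\<lambda>t. c (- t)" "\<lambda>t. - c' (- t)" "\<lambda>t. c'' (- t)"
    by (rule reversed)
  have rr: "rev.r t = r (- t)" and rn: "rev.n1 t = n1 (- t)" "rev.n2 t = n2 (- t)" and rL: "rev.L t = - L (- t)"
    and rw: "rev.w t = - w (- t)" for t
  proof -
    show "rev.r t = r (- t)"
      by (simp add: rev.r_def r_def)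
    then show "rev.n1 t = n1 (- t)" "rev.n2 t = n2 (- t)"
      by (simp_all add: rev.n1_def n1_def rev.n2_def n2_def)
    show "rev.L t = - L (- t)"
      using linear_neg[OF matrix_vector_mul_linear, of "G (c (- t))"] by (simp add: rev.L_def L_def)
    show "rev.w t = - w (- t)"
      by (simp add: rev.w_def w_def rev.q_def q_def)
  qed
  have inj': "inj (\<lambda>t. c (- t))"
    by (rule injI) (use inj in \<open>auto dest: injD\<close>)
  have "\<exists>s. r s < pi / 2"
  proof (rule ccontr)
    assume "\<not> ?thesis"
    then have out: "r t \<ge> pi / 2" for t
      by (force simp: not_less)
    then have r0: "r t > 0" for t
      using pi_gt_zero by (meson half_gt_zero less_le_trans)
    have w: "w t = 0" for t
    proof -
      interpret outgoing f g \<epsilon> c c' c'' t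
        by unfold_locales (rule out)
      interpret ro: outgoing f g \<epsilon> "\<lambda>t. c (- t)" "\<lambda>t. - c' (- t)" "\<lambda>t. c'' (- t)" "- t"
        by unfold_locales (unfold rr, rule out)
      show ?thesis
        using w_nonneg[of t] ro.w_nonneg[of "- t"] by (simp add: rw)
    qed
    have "r t = pi / 2" for t
    proof (rule ccontr)
      assume "r t \<noteq> pi / 2"
      then have "r t > pi / 2"
        using out[of t] by simp
      then have "r t * f (r t) * deriv f (r t) < 0"
        using deriv_f_neg[of "r t"] f_pos[OF r0] r0[of t] by (simp add: mult_pos_neg)
      moreover have "\<omega> t \<noteq> 0"
        using energy[OF r0[of t]] w[of t] by auto
      ultimately have neg: "r t * f (r t) * deriv f (r t) * (\<omega> t)\<^sup>2 < 0"
        by (simp add: mult_neg_pos)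
      obtain d where d: "(w has_real_derivative d) (at t)"
        "d \<le> - (q t * (w t)\<^sup>2 - r t * f (r t) * deriv f (r t) * (\<omega> t)\<^sup>2) / (4 * q t)"
        by (rule concavity[OF out])
      have "w = (\<lambda>_. 0)"
        using w by blast
      then have "d = 0"
        using d(1) DERIV_unique[OF _ DERIV_const] by metis
      then have "0 \<le> r t * f (r t) * deriv f (r t) * (\<omega> t)\<^sup>2 / (4 * q t)"
        using d(2) w[of t] by simp
      then show False
        using neg q_pos[OF r0[of t]] by (simp add: zero_le_divide_iff)
    qed
    then show False
      using equator_not_injective inj by blast
  qed
  then obtain s a where a: "passage a" "a < s" "s < a + pi"
    using passage_exists by metis
  have outside: "r t \<ge> pi / 2" if "t \<le> a \<or> a + pi \<le> t" for t
  proof (rule ccontr)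
    assume "\<not> r t \<ge> pi / 2"
    then obtain b where b: "passage b" "b < t" "t < b + pi"
      using passage_exists[of t] by auto
    \<comment> \<open>At the ends of one passage the geodesic is on the equator, hence not inside the other one.\<close>
    have "b + pi \<le> a \<or> a + pi \<le> b"
    proof (rule ccontr)
      assume "\<not> ?thesis"
      then consider "a < b" "b < a + pi" | "b < a" "a < b + pi" | "a = b"
        by linarith
      then show False
      proof cases
        case 1
        then show False
          using passage_r(3)[OF a(1) 1] passage_r(1)[OF b(1)] by simp
      next
        case 2
        then show False
          using passage_r(3)[OF b(1) 2] passage_r(1)[OF a(1)] by simp
      next
        case 3
        then show False
          using that b(2,3) by auto
      qed
    qed
    then show False
      using passages_intersect a(1) b(1) inj by blast
  qed
  have ends: "r a = pi / 2" "r (a + pi) = pi / 2"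
    using a(1) by (auto simp: passage_def)
  obtain \<mu> where circle: "\<And>t. a \<le> t \<Longrightarrow> t \<le> a + pi \<Longrightarrow>
      sin (r t) * n1 t = cos (t - a) * n1 a - sin (t - a) * L a * n2 a \<and>
      sin (r t) * n2 t = cos (t - a) * n2 a + sin (t - a) * L a * n1 a \<and> L t = L a"
    using a(1) unfolding passage_def by blast
  have opp: "n1 (a + pi) = - n1 a" "n2 (a + pi) = - n2 a" "L (a + pi) = L a"
    using circle[of "a + pi"] ends by simp_all
  interpret E: escaping f g \<epsilon> c c' c'' "a + pi"
  proof
    show "\<exists>s\<ge>a + pi. pi / 2 < r s"
    proof (rule ccontr)
      assume "\<not> ?thesis"
      then have "r t = pi / 2" if "a + pi \<le> t" for t
        using outside[of t] that by force
      then show False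
        using equator_not_injective inj by blast
    qed
    show "r (a + pi) = pi / 2"
      by (rule ends)
    show "r t \<ge> pi / 2" if "a + pi \<le> t" for t
      using outside that by blast
  qed
  interpret R: escaping f g \<epsilon> "\<lambda>t. c (- t)" "\<lambda>t. - c' (- t)" "\<lambda>t. c'' (- t)" "- a"
  proof
    show "\<exists>s\<ge>- a. pi / 2 < rev.r s"
    proof (rule ccontr)
      assume "\<not> ?thesis"
      then have "rev.r t = pi / 2" if "- a \<le> t" for t
        using outside[of "- t"] that by (force simp: rr)
      then show False
        using rev.equator_not_injective inj' by blast
    qed
    show "rev.r (- a) = pi / 2"
      by (simp add: rr ends)
    show "rev.r t \<ge> pi / 2" if "- a \<le> t" for t
      using outside[of "- t"] that unfolding rr by linarith
  qed
  \<comment> \<open>One of the two antipodal points on the equator lies in the closed lower half plane.\<close>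
  have La: "L a = 0"
  proof (cases "n2 a \<le> 0")
    case True
    then show ?thesis
      using R.L_vanishes[of "- a"] by (simp add: rn rL)
  next
    case False
    then show ?thesis
      using E.L_vanishes[of "a + pi"] opp by simp
  qed
  have LE: "L t = 0" if "a + pi \<le> t" for t
    using E.L_vanishes[OF _ that] La opp by simp
  have LR: "rev.L t = 0" if "- a \<le> t" for t
    using R.L_vanishes[OF _ that] La by (simp add: rL)
  have n_E: "n1 t = - n1 a" "n2 t = - n2 a" if "a + pi \<le> t" for t
    using E.radial_escape(1,2)[OF LE that] opp by simp_all
  have n_R: "n1 t = n1 a" "n2 t = n2 a" if "t \<le> a" for t
    using R.radial_escape(1,2)[OF LR, of "- t"] that by (simp_all add: rn)
  have "n1 a = 0 \<or> n2 a = 0"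
    using E.radial_escape(3)[OF LE] R.radial_escape(3)[OF LR] opp by (auto simp: rn)
  moreover have sin_pos: "r t = 0 \<or> sin (r t) \<noteq> 0" if "a \<le> t" "t \<le> a + pi" for t
  proof -
    have "r t \<le> pi / 2"
      using passage_r(4)[OF a(1) that] .
    then have "r t < pi"
      using pi_gt_zero by linarith
    then show ?thesis
      using sin_gt_zero[of "r t"] r_nonneg[of t] by (cases "r t = 0") auto
  qed
  moreover have "n1 a = 0 \<Longrightarrow> c t $ 1 = 0" "n2 a = 0 \<Longrightarrow> c t $ 2 = 0" for t
  proof -
    consider "t \<le> a" | "a \<le> t \<and> t \<le> a + pi" | "a + pi \<le> t"
      by linarith
    then have "(n1 a = 0 \<longrightarrow> c t $ 1 = 0) \<and> (n2 a = 0 \<longrightarrow> c t $ 2 = 0)"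
    proof cases
      case 1
      then show ?thesis
        unfolding n_eq n_R[OF 1] by simp
    next
      case 2
      then show ?thesis
        using circle[of t] sin_pos[of t] La by (auto simp: n_eq)
    next
      case 3
      then show ?thesis
        unfolding n_eq n_E[OF 3] by simp
    qed
    then show "n1 a = 0 \<Longrightarrow> c t $ 1 = 0" "n2 a = 0 \<Longrightarrow> c t $ 2 = 0"
      by blast+
  qed
  ultimately show ?thesis
    by blast
qed

end

section \<open>The two injective geodesics\<close>

context perturbed_plane
begin

definition axis_metric :: "real^2 \<Rightarrow> real \<Rightarrow> real"
  where "axis_metric e y = e \<bullet> (G (y *\<^sub>R e) *v e)"

definition axis_metric' :: "real^2 \<Rightarrow> real \<Rightarrow> real"
  where "axis_metric' e y = e \<bullet> (frechet_derivative G (at (y *\<^sub>R e)) e *v e)"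

text \<open>Arc length along the axis spanned by \<open>e\<close>. The integrand vanishes for \<open>y \<le> 2\<close>, so that the integral
  over the empty interval has the right value for negative \<open>y\<close>.\<close>

definition axis_length :: "real^2 \<Rightarrow> real \<Rightarrow> real"
  where "axis_length e y = y + integral {0..y} (\<lambda>y. sqrt (axis_metric e y) - 1)"

definition axis_geodesic :: "real^2 \<Rightarrow> real \<Rightarrow> real^2"
  where "axis_geodesic e t = inv (axis_length e) t *\<^sub>R e"

context
  fixes e :: "real^2"
  assumes e: "e = vector [1, 0] \<or> e = vector [0, 1]"
begin

lemma e_simps: "e \<bullet> e = 1" "e \<bullet> rot e = 0" "rot e \<bullet> e = 0" "wedge (y *\<^sub>R e) e = 0" "norm e = 1" "e \<noteq> 0"
  using e by (auto simp: inner_2 wedge_def norm_eq_1 vec2_eq_iff)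

lemma axis_metric_derivs:
  "((\<lambda>y. v \<bullet> (G (y *\<^sub>R e) *v u)) has_real_derivative v \<bullet> (frechet_derivative G (at (y *\<^sub>R e)) e *v u)) (at y)"
proof -
  have "((\<lambda>y. y *\<^sub>R e) has_vector_derivative e) (at y)"
    by (auto intro!: derivative_eq_intros)
  from vector_derivative_diff_chain_within[OF this has_derivative_at_withinI[OF metric_form_has_derivative[OF metric_G]]]
  show ?thesis
    by (simp add: o_def has_real_derivative_iff_has_vector_derivative)
qed

lemma axis_metric_deriv: "(axis_metric e has_real_derivative axis_metric' e y) (at y)"
  unfolding axis_metric_def[abs_def] axis_metric'_def by (rule axis_metric_derivs)

lemma axis_metric_continuous: "continuous_on A (axis_metric e)"
  by (intro continuous_at_imp_continuous_on ballI DERIV_isCont[OF axis_metric_deriv])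

lemma axis_metric_eq:
  assumes "y \<noteq> 0"
  shows "axis_metric e y = 1 + \<epsilon>\<^sup>2 * bump (y *\<^sub>R e) * y\<^sup>2"
proof -
  have "y *\<^sub>R e \<noteq> 0"
    using assms e_simps by simp
  from G_inner[OF this, of e e] show ?thesis
    unfolding axis_metric_def using assms by (simp add: e_simps power2_eq_square)
qed

lemma axis_metric_ge_1: "axis_metric e y \<ge> 1"
proof -
  have *: "axis_metric e y \<ge> 1" if "y \<noteq> 0" for y
    unfolding axis_metric_eq[OF that] using bump_nonneg by simp
  have "axis_metric e 0 \<ge> 1"
  proof (rule tendsto_lowerbound)
    show "(axis_metric e \<longlongrightarrow> axis_metric e 0) (at 0)"
      using DERIV_isCont[OF axis_metric_deriv] isContD by blast
    show "\<forall>\<^sub>F y in at 0. 1 \<le> axis_metric e y"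
      using * by (auto simp: eventually_at_filter)
  qed simp
  then show ?thesis
    using * by (cases "y = 0") auto
qed

lemma axis_metric_small:
  assumes "y \<le> 2"
  shows "axis_metric e y = 1"
proof -
  have *: "axis_metric e y = 1" if "y \<le> 2" "y \<noteq> 0" for y
  proof -
    have "bump (y *\<^sub>R e) = 0"
    proof (cases "y \<ge> 0")
      case True
      have "y \<le> 2 * pi / 3"
        using that pi_gt3 by linarith
      then have "y\<^sup>2 \<le> (2 * pi / 3)\<^sup>2"
        using True by (intro power_mono) auto
      then show ?thesis
        by (intro bump_eq_0) (simp add: e_simps power2_eq_square)
    next
      case False
      then have "(y *\<^sub>R e) $ 2 \<le> 0"
        using e by auto
      then show ?thesis
        by (simp add: bump_def flat_eq_0)
    qed
    then show ?thesis
      by (simp add: axis_metric_eq[OF that(2)])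
  qed
  have "axis_metric e 0 = 1"
  proof (rule tendsto_unique)
    show "(axis_metric e \<longlongrightarrow> axis_metric e 0) (at 0)"
      using DERIV_isCont[OF axis_metric_deriv] isContD by blast
    show "(axis_metric e \<longlongrightarrow> 1) (at 0)"
    proof (rule tendsto_eventually)
      show "\<forall>\<^sub>F y in at 0. axis_metric e y = 1"
        unfolding eventually_at using * by (intro exI[of _ 1]) (auto simp: dist_real_def)
    qed
  qed simp
  then show ?thesis
    using * assms by (cases "y = 0") auto
qed

lemma axis_length_deriv: "(axis_length e has_real_derivative sqrt (axis_metric e y)) (at y)"
proof -
  let ?h = "\<lambda>y. sqrt (axis_metric e y) - 1"
  have "((\<lambda>y. integral {0..y} ?h) has_real_derivative ?h y) (at y)"
  proof (cases "y < 2")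
    case True
    have zero: "integral {0..x} ?h = 0" if "x < 2" for x
    proof -
      have "integral {0..x} ?h = integral {0..x} (\<lambda>_. 0)"
        by (rule integral_cong) (use that axis_metric_small in auto)
      then show ?thesis
        by simp
    qed
    have "((\<lambda>_. 0 :: real) has_real_derivative 0) (at y)"
      by simp
    then have "((\<lambda>y. integral {0..y} ?h) has_real_derivative 0) (at y)"
      by (rule has_field_derivative_transform_within_open[where S = "{..<2}"])
        (use True zero in auto)
    then show ?thesis
      using axis_metric_small[of y] True by simp
  next
    case False
    have "((\<lambda>y. integral {0..y} ?h) has_real_derivative ?h y) (at y within {0..y + 1})"
      using False by (intro integral_has_real_derivative continuous_intros axis_metric_continuous) auto
    moreover have "at y within {0..y + 1} = at y"
      using False by (intro at_within_interior) auto
    ultimately show ?thesis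
      by simp
  qed
  from DERIV_add[OF DERIV_ident this] show ?thesis
    unfolding axis_length_def[abs_def] by simp
qed

lemma axis_length_expands:
  assumes "x \<le> y"
  shows "y - x \<le> axis_length e y - axis_length e x"
proof -
  have "axis_length e x - x \<le> axis_length e y - y"
  proof (rule DERIV_nonneg_imp_nondecreasing[OF assms])
    fix u
    have "((\<lambda>y. axis_length e y - y) has_real_derivative sqrt (axis_metric e u) - 1) (at u)"
      by (rule DERIV_diff[OF axis_length_deriv DERIV_ident])
    then show "\<exists>z. ((\<lambda>y. axis_length e y - y) has_real_derivative z) (at u) \<and> 0 \<le> z"
      using axis_metric_ge_1[of u] by auto
  qed
  then show ?thesis
    by simp
qed

lemma axis_length_bij: "bij (axis_length e)"
proof (rule bijI)
  show "inj (axis_length e)"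
  proof (rule injI)
    fix x y assume "axis_length e x = axis_length e y"
    then show "x = y"
      using axis_length_expands[of x y] axis_length_expands[of y x] by linarith
  qed
  show "surj (axis_length e)"
  proof (unfold surj_def, rule allI)
    fix s
    define a where "a = axis_length e 0"
    have "axis_length e (- \<bar>s - a\<bar>) \<le> s" "s \<le> axis_length e \<bar>s - a\<bar>"
      using axis_length_expands[of "- \<bar>s - a\<bar>" 0] axis_length_expands[of 0 "\<bar>s - a\<bar>"]
      by (auto simp: a_def)
    moreover have "continuous_on {- \<bar>s - a\<bar>..\<bar>s - a\<bar>} (axis_length e)"
      by (intro continuous_at_imp_continuous_on ballI DERIV_isCont[OF axis_length_deriv])
    ultimately have "\<exists>x. - \<bar>s - a\<bar> \<le> x \<and> x \<le> \<bar>s - a\<bar> \<and> axis_length e x = s"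
      by (intro IVT') auto
    then show "\<exists>x. s = axis_length e x"
      by blast
  qed
qed

lemma inv_axis_length: "axis_length e (inv (axis_length e) t) = t" "inv (axis_length e) (axis_length e y) = y"
  using axis_length_bij by (simp_all add: bij_is_surj surj_f_inv_f bij_is_inj)

lemma inv_axis_length_deriv:
  "(inv (axis_length e) has_real_derivative 1 / sqrt (axis_metric e (inv (axis_length e) t))) (at t)"
proof -
  let ?Y = "inv (axis_length e)"
  have lip: "\<bar>?Y s - ?Y t\<bar> \<le> \<bar>s - t\<bar>" for s t
    using axis_length_expands[of "?Y s" "?Y t"] axis_length_expands[of "?Y t" "?Y s"]
    unfolding inv_axis_length by linarith
  have "isCont ?Y t"
    unfolding continuous_at_eps_delta dist_real_def
  proof (intro allI impI)
    fix d :: real assume "d > 0"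
    then show "\<exists>\<delta>>0. \<forall>x'. \<bar>x' - t\<bar> < \<delta> \<longrightarrow> \<bar>?Y x' - ?Y t\<bar> < d"
      using lip[of _ t] by (intro exI[of _ d]) (auto intro: le_less_trans)
  qed
  moreover have "sqrt (axis_metric e (?Y t)) \<noteq> 0"
    using axis_metric_ge_1[of "?Y t"] by auto
  ultimately have "(?Y has_real_derivative inverse (sqrt (axis_metric e (?Y t)))) (at t)"
    by (intro DERIV_inverse_function[OF axis_length_deriv, of "?Y" _ "t - 1" "t + 1"])
      (auto simp: inv_axis_length)
  then show ?thesis
    by (simp add: inverse_eq_divide)
qed

text \<open>The axes are orthogonal to the rotation field, and the length of \<open>e\<close> is critical in the angular
  direction: for the horizontal axis because the bump is flat at \<open>y = 0\<close>, for the vertical axis because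
  \<open>y = r sin \<theta>\<close> is critical there.\<close>

lemma axis_normal_derivs:
  "e \<bullet> (G (y *\<^sub>R e) *v rot e) = 0"
  "e \<bullet> (frechet_derivative G (at (y *\<^sub>R e)) e *v rot e) = 0"
  "e \<bullet> (frechet_derivative G (at (y *\<^sub>R e)) (rot e) *v e) = 0"
proof -
  show *: "e \<bullet> (G (y *\<^sub>R e) *v rot e) = 0" for y
  proof (cases "y = 0")
    case True
    then show ?thesis
      using polar_form_origin[OF metric polar_form, of e] by (simp add: perturb_inner)
  next
    case False
    then have "y *\<^sub>R e \<noteq> 0"
      using e_simps by simp
    from G_inner[OF this] show ?thesis
      by (simp add: e_simps)
  qed
  have "((\<lambda>y. e \<bullet> (G (y *\<^sub>R e) *v rot e)) has_real_derivative 0) (at y)"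
    unfolding * by simp
  then show "e \<bullet> (frechet_derivative G (at (y *\<^sub>R e)) e *v rot e) = 0"
    using DERIV_unique[OF axis_metric_derivs] by blast
  show "e \<bullet> (frechet_derivative G (at (y *\<^sub>R e)) (rot e) *v e) = 0"
  proof (cases "y = 0")
    case True
    then show ?thesis
      by (simp add: G_deriv_origin)
  next
    case False
    then have x: "y *\<^sub>R e \<noteq> 0"
      using e_simps by simp
    have "flat' ((y *\<^sub>R e) $ 2) * cutoff z * rot e $ 2 = 0" for z
      using e by (auto simp: flat'_eq_0)
    then show ?thesis
      unfolding G_deriv[OF x] e_simps by (simp add: e_simps)
  qed
qed

lemma axis_decompose: "w = (e \<bullet> w) *\<^sub>R e + (rot e \<bullet> w) *\<^sub>R rot e"
  using e by (auto simp: vec2_eq_iff inner_2)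

lemma axis_geodesic_injective_geodesic: "axis_geodesic e \<in> injective_geodesics G"
proof -
  let ?Y = "inv (axis_length e)"
  define A where "A t = axis_metric e (?Y t)" for t
  define Y' where "Y' t = 1 / sqrt (A t)" for t
  define Y'' where "Y'' t = - (axis_metric' e (?Y t) / (2 * (A t)\<^sup>2))" for t
  have A: "A t \<ge> 1" for t
    unfolding A_def by (rule axis_metric_ge_1)
  have dY: "(?Y has_real_derivative Y' t) (at t)" for t
    unfolding Y'_def A_def by (rule inv_axis_length_deriv)
  have dA: "(A has_real_derivative axis_metric' e (?Y t) * Y' t) (at t)" for t
    unfolding A_def by (rule DERIV_chain2[OF axis_metric_deriv dY])
  have sq: "sqrt (A t) * sqrt (A t) = A t" "sqrt (A t) > 0" for t
    using A[of t] by auto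
  have Y'2: "A t * (Y' t)\<^sup>2 = 1" for t
    using A[of t] by (simp add: Y'_def power_divide)
  have dY': "(Y' has_real_derivative Y'' t) (at t)" for t
  proof -
    have "((\<lambda>t. sqrt (A t)) has_real_derivative inverse (sqrt (A t)) / 2 * (axis_metric' e (?Y t) * Y' t)) (at t)"
      using DERIV_chain2[OF DERIV_real_sqrt dA] A[of t] by simp
    from DERIV_divide[OF DERIV_const this, of 1] sq(2)[of t]
    have "(Y' has_real_derivative - (inverse (sqrt (A t)) / 2 * (axis_metric' e (?Y t) * Y' t)) / (sqrt (A t) * sqrt (A t))) (at t)"
      unfolding Y'_def[abs_def] by simp
    moreover have "- (inverse (sqrt (A t)) / 2 * (axis_metric' e (?Y t) * Y' t)) / (sqrt (A t) * sqrt (A t)) = Y'' t"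
      unfolding Y''_def Y'_def using sq[of t] by (simp add: power2_eq_square field_simps)
    ultimately show ?thesis
      by simp
  qed
  have c: "(axis_geodesic e has_vector_derivative Y' t *\<^sub>R e) (at t)"
    and c': "((\<lambda>t. Y' t *\<^sub>R e) has_vector_derivative Y'' t *\<^sub>R e) (at t)" for t
    unfolding axis_geodesic_def[abs_def]
    using has_vector_derivative_scaleR[OF dY has_vector_derivative_const, of e]
      has_vector_derivative_scaleR[OF dY' has_vector_derivative_const, of e] by simp_all
  have "w \<bullet> (G (axis_geodesic e t) *v (Y'' t *\<^sub>R e)) =
      1/2 * ((Y' t *\<^sub>R e) \<bullet> (frechet_derivative G (at (axis_geodesic e t)) w *v (Y' t *\<^sub>R e)))
      - (Y' t *\<^sub>R e) \<bullet> (frechet_derivative G (at (axis_geodesic e t)) (Y' t *\<^sub>R e) *v w)" for t w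
  proof -
    define a b where "a = e \<bullet> w" and "b = rot e \<bullet> w"
    have w: "w = a *\<^sub>R e + b *\<^sub>R rot e"
      unfolding a_def b_def by (rule axis_decompose)
    have x: "axis_geodesic e t = ?Y t *\<^sub>R e"
      by (simp add: axis_geodesic_def)
    define D where "D = frechet_derivative G (at (?Y t *\<^sub>R e))"
    have lin: "linear D"
      unfolding D_def using has_derivative_linear[OF riemannian_metric_has_derivative[OF metric_G]] .
    have D: "D (a *\<^sub>R e + b *\<^sub>R rot e) = a *\<^sub>R D e + b *\<^sub>R D (rot e)" "D (Y' t *\<^sub>R e) = Y' t *\<^sub>R D e"
      using lin by (simp_all add: linear_add linear_scale)
    have n: "e \<bullet> (G (?Y t *\<^sub>R e) *v rot e) = 0" "rot e \<bullet> (G (?Y t *\<^sub>R e) *v e) = 0"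
      "e \<bullet> (D e *v rot e) = 0" "e \<bullet> (D (rot e) *v e) = 0"
      using axis_normal_derivs riemannian_metric_symmetric[OF metric_G, of "rot e" _ e] by (simp_all add: D_def)
    have m: "e \<bullet> (G (?Y t *\<^sub>R e) *v e) = A t" "e \<bullet> (D e *v e) = axis_metric' e (?Y t)"
      by (simp_all add: A_def axis_metric_def axis_metric'_def D_def)
    have lhs: "w \<bullet> (G (axis_geodesic e t) *v (Y'' t *\<^sub>R e)) = Y'' t * (a * A t)"
      unfolding w x by (simp add: matrix_vector_mult_scaleR inner_add_left n m)
    have 1: "(Y' t *\<^sub>R e) \<bullet> (D w *v (Y' t *\<^sub>R e)) = (Y' t)\<^sup>2 * (a * axis_metric' e (?Y t))"
      unfolding w D
      by (simp add: matrix_vector_mult_scaleR matrix_vector_mult_add_rdistrib scaleR_matrix_vector_assoc[symmetric]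
          inner_add_right n m power2_eq_square)
    have 2: "(Y' t *\<^sub>R e) \<bullet> (D (Y' t *\<^sub>R e) *v w) = (Y' t)\<^sup>2 * (a * axis_metric' e (?Y t))"
      unfolding w D
      by (simp add: matrix_vector_mult_scaleR matrix_vector_right_distrib scaleR_matrix_vector_assoc[symmetric]
          inner_add_right n m power2_eq_square)
    have "(Y' t)\<^sup>2 = 1 / A t"
      using Y'2[of t] A[of t] by (simp add: field_simps)
    then have "Y'' t * (a * A t) = 1/2 * ((Y' t)\<^sup>2 * (a * axis_metric' e (?Y t))) - (Y' t)\<^sup>2 * (a * axis_metric' e (?Y t))"
      using A[of t] unfolding Y''_def by (simp add: field_simps power2_eq_square)
    then show ?thesis
      unfolding x D_def[symmetric] 1 2 lhs[unfolded x] .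
  qed
  then have "geodesic G (axis_geodesic e)"
    unfolding geodesic_iff[OF metric_G]
    by (intro exI[of _ "\<lambda>t. Y' t *\<^sub>R e"] exI[of _ "\<lambda>t. Y'' t *\<^sub>R e"] allI conjI c c')
  moreover have "arclength_parameterized G (axis_geodesic e)"
    unfolding arclength_parameterized_def
  proof
    fix t
    have "e \<bullet> (G (axis_geodesic e t) *v e) = A t"
      by (simp add: A_def axis_metric_def axis_geodesic_def)
    then show "vector_derivative (axis_geodesic e) (at t) \<bullet> (G (axis_geodesic e t) *v vector_derivative (axis_geodesic e) (at t)) = 1"
      unfolding vector_derivative_at[OF c]
      using Y'2[of t] by (simp add: matrix_vector_mult_scaleR power2_eq_square mult_ac)
  qed
  moreover have "inj (axis_geodesic e)"
    unfolding axis_geodesic_def[abs_def]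
    using bij_imp_bij_inv[OF axis_length_bij] e_simps by (auto simp: inj_def bij_def)
  ultimately show ?thesis
    by (simp add: injective_geodesics_def)
qed

text \<open>Unit speed means that the arc length along the axis grows with speed \<open>1\<close> or \<open>- 1\<close>, and the sign is
  constant by continuity.\<close>

lemma geodesic_on_axis_reparam:
  assumes c: "\<And>t. (c has_vector_derivative c' t) (at t)" and c': "\<And>t. isCont c' t"
    and unit: "\<And>t. c' t \<bullet> (G (c t) *v c' t) = 1" and on: "\<And>t. rot e \<bullet> c t = 0"
  shows "(axis_geodesic e, c) \<in> reparam"
proof -
  define y where "y t = e \<bullet> c t" for t
  define y' where "y' t = e \<bullet> c' t" for t
  have c_eq: "c t = y t *\<^sub>R e" for t
    using axis_decompose[of "c t"] by (simp add: on y_def)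
  have dy: "(y has_real_derivative y' t) (at t)" for t
    unfolding y_def[abs_def] y'_def has_real_derivative_iff_has_vector_derivative
    by (rule bounded_linear.has_vector_derivative[OF bounded_linear_inner_right c])
  have "((\<lambda>t. y t *\<^sub>R e) has_vector_derivative y' t *\<^sub>R e) (at t)" for t
    using has_vector_derivative_scaleR[OF dy has_vector_derivative_const, of e] by simp
  moreover have "c = (\<lambda>t. y t *\<^sub>R e)"
    using c_eq by blast
  ultimately have c'_eq: "c' t = y' t *\<^sub>R e" for t
    using vector_derivative_unique_at c by metis
  define \<sigma> where "\<sigma> t = sqrt (axis_metric e (y t)) * y' t" for t
  have \<sigma>2: "(\<sigma> t)\<^sup>2 = 1" for t
    using unit[of t] axis_metric_ge_1[of "y t"] unfolding c_eq[of t] c'_eq \<sigma>_def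
    by (simp add: matrix_vector_mult_scaleR axis_metric_def power_mult_distrib power2_eq_square mult_ac)
  have "isCont \<sigma> t" for t
    unfolding \<sigma>_def[abs_def] y'_def
    by (intro continuous_intros c' isCont_o2[OF DERIV_isCont[OF dy] DERIV_isCont[OF axis_metric_deriv]])
  then have "connected (range \<sigma>)"
    by (intro connected_continuous_image continuous_at_imp_continuous_on) auto
  moreover have "range \<sigma> \<subseteq> {1, -1}"
    using \<sigma>2 by (auto simp: power2_eq_1_iff)
  ultimately obtain s where s: "range \<sigma> = {s}"
    using connected_finite_iff_sing[of "range \<sigma>"] finite_subset[of "range \<sigma>" "{1, -1}"] by auto
  then have \<sigma>s: "\<sigma> t = s" for t
    by blast
  have "((\<lambda>t. axis_length e (y t) - s * t) has_real_derivative 0) (at t)" for t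
    using DERIV_diff[OF DERIV_chain2[OF axis_length_deriv dy[of t]] DERIV_cmult[OF DERIV_ident, of s]]
      \<sigma>s[of t] by (simp add: \<sigma>_def)
  then have cst: "axis_length e (y t) - s * t = axis_length e (y 0) - s * 0" for t
    using DERIV_isconst_all[of "\<lambda>t. axis_length e (y t) - s * t" t 0] by simp
  have len: "axis_length e (y t) = s * t + axis_length e (y 0)" for t
    using cst[of t] by linarith
  have yt: "y t = inv (axis_length e) (s * t + axis_length e (y 0))" for t
    using inv_axis_length(2)[of "y t"] unfolding len[of t] by (rule sym)
  have "c t = axis_geodesic e (s * t + axis_length e (y 0))" for t
    by (simp only: c_eq[of t] axis_geodesic_def yt[of t, symmetric])
  moreover have "s \<in> {1, -1}"
    using s \<open>range \<sigma> \<subseteq> {1, -1}\<close> by auto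
  ultimately show ?thesis
    unfolding reparam_def by blast
qed

end

lemma two_injective_geodesics: "card (injective_geodesics G // reparam) = 2"
proof -
  define e1 e2 :: "real^2" where "e1 = vector [1, 0]" and "e2 = vector [0, 1]"
  let ?c1 = "axis_geodesic e1" and ?c2 = "axis_geodesic e2"
  have e: "e1 = vector [1, 0] \<or> e1 = vector [0, 1]" "e2 = vector [1, 0] \<or> e2 = vector [0, 1]"
    by (auto simp: e1_def e2_def)
  have mem: "?c1 \<in> injective_geodesics G" "?c2 \<in> injective_geodesics G"
    using axis_geodesic_injective_geodesic e by blast+
  have classify: "(?c1, c) \<in> reparam \<or> (?c2, c) \<in> reparam" if c: "c \<in> injective_geodesics G" for c
  proof -
    have "geodesic G c" "arclength_parameterized G c" "inj c"
      using c by (auto simp: injective_geodesics_def)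
    then obtain c' c'' where d: "\<And>t. (c has_vector_derivative c' t) (at t)"
      "\<And>t. (c' has_vector_derivative c'' t) (at t)"
      "\<And>t w. w \<bullet> (G (c t) *v c'' t) = 1/2 * (c' t \<bullet> (frechet_derivative G (at (c t)) w *v c' t))
        - c' t \<bullet> (frechet_derivative G (at (c t)) (c' t) *v w)"
      unfolding geodesic_iff[OF metric_G] by blast
    have unit: "c' t \<bullet> (G (c t) *v c' t) = 1" for t
      using \<open>arclength_parameterized G c\<close> vector_derivative_at[OF d(1)]
      unfolding arclength_parameterized_def by metis
    interpret unit_geodesic f g \<epsilon> c c' c''
      by unfold_locales (rule d unit)+
    have "isCont c' t" for t
      using d(2) has_vector_derivative_continuous by blast
    note reparam = geodesic_on_axis_reparam[OF _ d(1) this unit]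
    from injective_geodesic_on_axis[OF \<open>inj c\<close>] show ?thesis
    proof
      assume "\<forall>t. c t $ 1 = 0"
      then have "rot e2 \<bullet> c t = 0" for t
        by (simp add: inner_2 e2_def)
      then show ?thesis
        using reparam[OF e(2)] by blast
    next
      assume "\<forall>t. c t $ 2 = 0"
      then have "rot e1 \<bullet> c t = 0" for t
        by (simp add: inner_2 e1_def)
      then show ?thesis
        using reparam[OF e(1)] by blast
    qed
  qed
  have "(?c1, ?c2) \<notin> reparam"
  proof
    assume "(?c1, ?c2) \<in> reparam"
    then obtain \<sigma> s0 where s: "\<And>s. ?c2 s = ?c1 (\<sigma> * s + s0)"
      unfolding reparam_def by blast
    have "?c2 s = 0" for s
    proof -
      have "?c2 s $ 1 = 0"
        by (simp add: axis_geodesic_def e2_def)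
      moreover have "?c2 s $ 2 = 0"
        unfolding s by (simp add: axis_geodesic_def e1_def)
      ultimately show ?thesis
        by (simp add: vec2_eq_iff)
    qed
    then have "?c2 0 = ?c2 1"
      by simp
    then show False
      using mem(2) injD[of ?c2 0 1] by (simp add: injective_geodesics_def)
  qed
  then have "reparam `` {?c1} \<noteq> reparam `` {?c2}"
    using eq_equiv_class[OF _ equiv_reparam] by blast
  moreover have "injective_geodesics G // reparam = {reparam `` {?c1}, reparam `` {?c2}}"
  proof
    show "injective_geodesics G // reparam \<subseteq> {reparam `` {?c1}, reparam `` {?c2}}"
    proof
      fix X assume "X \<in> injective_geodesics G // reparam"
      then obtain c where c: "c \<in> injective_geodesics G" "X = reparam `` {c}"
        by (rule quotientE)
      then show "X \<in> {reparam `` {?c1}, reparam `` {?c2}}"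
        using classify[OF c(1)] equiv_class_eq[OF equiv_reparam] by blast
    qed
    show "{reparam `` {?c1}, reparam `` {?c2}} \<subseteq> injective_geodesics G // reparam"
      using mem by (auto intro: quotientI)
  qed
  ultimately show ?thesis
    by simp
qed

end

theorem proposition1p6:
  fixes f :: "real \<Rightarrow> real" and g :: "real^2 \<Rightarrow> real^2^2"
  assumes "smooth_on {0<..} f"
    and "\<And>r. r > 0 \<Longrightarrow> f r > 0"
    and "\<And>r. 0 < r \<Longrightarrow> r < 3 * pi / 4 \<Longrightarrow> f r = sin r"
    and "\<And>r. r > pi / 2 \<Longrightarrow> deriv f r < 0"
    and "(f \<longlongrightarrow> 0) at_top"
    and "riemannian_metric g"
    and "polar_form g f"
  shows "\<exists>\<epsilon>\<^sub>0 > 0. \<exists>G :: real \<Rightarrow> real^2 \<Rightarrow> real^2^2.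
    smooth_on ({-\<epsilon>\<^sub>0<..<\<epsilon>\<^sub>0} \<times> UNIV) (\<lambda>(\<epsilon>, x). G \<epsilon> x) \<and>
    (\<forall>\<epsilon>\<in>{-\<epsilon>\<^sub>0<..<\<epsilon>\<^sub>0}. riemannian_metric (G \<epsilon>)) \<and>
    G 0 = g \<and>
    (\<forall>\<epsilon>\<in>{-\<epsilon>\<^sub>0<..<\<epsilon>\<^sub>0}. \<forall>x.
       x \<notin> {polar r \<theta> | r \<theta>. pi / 2 < r \<and> r < 3 * pi / 4 \<and> 0 < \<theta> \<and> \<theta> < pi} \<longrightarrow>
       G \<epsilon> x = g x) \<and>
    (\<forall>\<epsilon>. 0 < \<bar>\<epsilon>\<bar> \<and> \<bar>\<epsilon>\<bar> < \<epsilon>\<^sub>0 \<longrightarrow>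
       card (injective_geodesics (G \<epsilon>) // reparam) = 2)"
proof (intro exI[of _ "1 / 100"] exI[of _ "perturb g"] conjI ballI allI impI)
  show "smooth_on ({- (1 / 100)<..<1 / 100} \<times> UNIV) (\<lambda>(\<epsilon>, x). perturb g \<epsilon> x)"
    by (rule smooth_on_perturb[OF assms(6)]) simp
  show "riemannian_metric (perturb g \<epsilon>)" for \<epsilon>
    by (rule riemannian_metric_perturb[OF assms(6)])
  show "perturb g 0 = g"
    by (simp add: perturb_def fun_eq_iff)
  show "perturb g \<epsilon> x = g x"
    if "x \<notin> {polar r \<theta> | r \<theta>. pi / 2 < r \<and> r < 3 * pi / 4 \<and> 0 < \<theta> \<and> \<theta> < pi}" for \<epsilon> x
    using bump_eq_0_outside[OF that] by (simp add: perturb_def)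
  show "card (injective_geodesics (perturb g \<epsilon>) // reparam) = 2" if \<epsilon>: "0 < \<bar>\<epsilon>\<bar> \<and> \<bar>\<epsilon>\<bar> < 1 / 100" for \<epsilon>
  proof -
    have "\<bar>\<epsilon>\<bar>\<^sup>2 \<le> (1 / 100)\<^sup>2"
      using \<epsilon> by (intro power_mono) auto
    then interpret perturbed_plane f g \<epsilon>
      using assms \<epsilon> by unfold_locales (auto simp: power_divide)
    show ?thesis
      by (rule two_injective_geodesics)
  qed
qed simp

end
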